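(* Let $X=\{X(t),t\in T\}$ be a stochastic process from the space $SF_\psi(\Omega)$ with determining constant $C_\Delta$, where $(T,\rho)$ is a compact metric separable space, and suppose $$R(t,s)=EX(t)X(s)=\int_\Lambda f(t,\lambda)f(s,\lambda)\,d\mu(\lambda),$$ where $(\Lambda,\mathcal A,\mu)$ is some measurable space, $f(t,\cdot)\in L_2(\Lambda,\mu)$ for any $t\in T$, and the system of functions $f(t,\cdot)$, $t\in T$, is complete in $L_2(\Lambda,\mu)$. Assume that $X$ also satisfies the following conditions of the expansion theorem: $X$ is a second-order process with $EX(t)=0$ and $EX(t)\overline{X(s)}=\int_\Lambda f(t,\lambda)\overline{f(s,\lambda)}\,d\mu(\lambda)$; $(\Lambda,\mathcal A,\mu)$ and $(T,\mathcal F,v)$ are measurable spaces with $\sigma$-finite measures $\mu$ and $v$; $f\in L_2(T\times\Lambda)$; $\{g_k\}$ is an orthonormal basis in $L_2(\Lambda,\mu)$; and there exist functions $b_k(t)$ with $\int_T|b_k(t)|^2dv(t)<\infty$ that solve the integral equations $g_k(\lambda)=\int_Tb_k(t)f(t,\lambda)\,dv(t)$. Hence $X(t)=\sum_{k=1}^\infty\xi_ka_k(t)$, where the series converges in mean square, and therefore also in the norm of the space $SF_\psi(\Omega)$, $$a_k(t)=\int_\Lambda f(t,\lambda)\overline{g_k(\lambda)}\,d\mu(\lambda),$$ and $\xi_k$ are random variables with $E\xi_k=0$, $E\xi_k\xi_l=\delta_{kl}$, which also belong to the space $SF_\psi(\Omega)$. Let $X_N(t)=\sum_{k=1}^N\xi_ka_k(t)$,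 $N\ge1$, and $Y_N(t)=X(t)-X_N(t)$. If $$\sup_{\rho(t,s)\le h}\big(E|Y_N(t)-Y_N(s)|^2\big)^{1/2}\le\sigma_N(h),$$ where for any $N$, $\sigma_N(h)$, $h>0$, is a continuous monotonically increasing function with $\sigma_N(0)=0$, and for some $z>0$ (hence, for any $z>0$) $$\int_0^z\varkappa\Big(\mathbf N\big(\sigma_N^{(-1)}(u/C_\Delta)\big)\Big)du<\infty,$$ where $\sigma_N^{(-1)}$ is the inverse function of $\sigma_N$, $\mathbf N$ is the metric massiveness of $(T,\rho)$, and $\varkappa$ is the majorizing characteristic of the space $SF_\psi(\Omega)$, then with probability one $$\sup_{t\in T}Y_N(t)\in SF_\psi(\Omega)$$ and $$\Big\|\sup_{t\in T}|Y_N(t)|\Big\|_\psi\le B_N(p),\qquad 0<p<1,$$ where $$B_N(p)=\inf_{t\in T}C_\Delta\big(E|Y_N(t)|^2\big)^{1/2}+\frac1{p(1-p)}\int_0^{\gamma p}\varkappa\Big(\mathbf N\big(\sigma_N^{(-1)}(u/C_\Delta)\big)\Big)du,\qquad \gamma=C_\Delta\,\sigma_N\Big(\sup_{t,s\in T}\rho(t,s)\Big).$$ Moreover, for $\varepsilon>0$, $$P\Big\{\sup_{t\in T}|Y_N(t)|>\varepsilon\Big\}\le\inf_{u\ge1}\frac{B_N^u(p)(\psi(u))^u}{\varepsilon^u}.$$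
   Context: Let $\psi(u)>0$, $u\ge1$, be a monotonically increasing continuous function with $\psi(u)\to\infty$ as $u\to\infty$. $\mathbf F_\psi(\Omega)$ is the Banach space of random variables with norm $\|\xi\|_\psi=\sup_{u\ge1}\frac{(E|\xi|^u)^{1/u}}{\psi(u)}<\infty$. A family $\Delta$ of random variables $\xi\in\mathbf F_\psi(\Omega)$ with $E\xi=0$ is called strictly $\mathbf F_\psi(\Omega)$, denoted $SF_\psi(\Omega)$ (and also referred to as the space $SF_\psi(\Omega)$ of random variables, with the norm $\|\cdot\|_\psi$), if there is a constant $C_\Delta$ (the determining constant) such that $\|\sum_{i\in I}\lambda_i\xi_i\|_\psi\le C_\Delta\big(E(\sum_{i\in I}\lambda_i\xi_i)^2\big)^{1/2}$ for every at most countable set of $\xi_i\in\Delta$, $i\in I$, and all real $\lambda_i$. A process $X$ is from $SF_\psi(\Omega)$ if the family $\{X(t),t\in T\}$ is strictly $\mathbf F_\psi(\Omega)$. A majorizing characteristic of a space of random variables with norm $\|\cdot\|_\psi$ is a non-decreasing sequence $\varkappa(n)$, $n\ge1$, such that $\|\max_{1\le i\le n}|\xi_i|\|_\psi\le\varkappa(n)\max_{1\le i\le n}\|\xi_i\|_\psi$ for any $\xi_1,\dots,\xi_n$ from this space. The metric massiveness $\mathbf N(u)$ is the smallest number of closed balls of radius at most $u$ that cover $T$. $\delta_{kl}$ is the Kronecker delta.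
   Formalization: Y_N is assumed to be a separable process (Doob), as uncountable suprema can otherwise break the bound; "sup Y_N in SF_psi" (needs mean zero) becomes: sup Y_N is in F_psi and, once centred, strictly F_psi; f and g_k are real-valued. *)

theory Defs
  imports "HOL-Probability.Probability"
begin

definition square_integrable :: "'a measure \<Rightarrow> ('a \<Rightarrow> real) \<Rightarrow> bool" where
  "square_integrable M h \<longleftrightarrow> h \<in> borel_measurable M \<and> integrable M (\<lambda>x. (h x)\<^sup>2)"

definition norm2 :: "'a measure \<Rightarrow> ('a \<Rightarrow> real) \<Rightarrow> real" where
  "norm2 M h = sqrt (\<integral>x. (h x)\<^sup>2 \<partial>M)"

text \<open>The nonnegative integral is used because it is \<open>\<infinity>\<close>, not 0, when the
  difference is not square integrable.\<close>

definition ms_converges :: "'a measure \<Rightarrow> (nat \<Rightarrow> 'a \<Rightarrow> real) \<Rightarrow> ('a \<Rightarrow> real) \<Rightarrow> bool" where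
  "ms_converges M S h \<longleftrightarrow>
     (\<lambda>n. \<integral>\<^sup>+x. ennreal ((S n x - h x)\<^sup>2) \<partial>M) \<longlonglongrightarrow> 0"

text \<open>Completeness of a system: its finite linear combinations are dense in \<open>L\<^sub>2\<close>.\<close>

definition complete_system :: "'a measure \<Rightarrow> 'i set \<Rightarrow> ('i \<Rightarrow> 'a \<Rightarrow> real) \<Rightarrow> bool" where
  "complete_system M I h \<longleftrightarrow>
     (\<forall>i\<in>I. square_integrable M (h i)) \<and>
     (\<forall>\<phi>. square_integrable M \<phi> \<longrightarrow>
        (\<forall>\<epsilon>>0. \<exists>J c. finite J \<and> J \<subseteq> I \<and>
           norm2 M (\<lambda>x. \<phi> x - (\<Sum>j\<in>J. c j * h j x)) < \<epsilon>))"

definition orthonormal :: "'a measure \<Rightarrow> 'i set \<Rightarrow> ('i \<Rightarrow> 'a \<Rightarrow> real) \<Rightarrow> bool" where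
  "orthonormal M I h \<longleftrightarrow>
     (\<forall>i\<in>I. square_integrable M (h i)) \<and>
     (\<forall>i\<in>I. \<forall>j\<in>I. (\<integral>x. h i x * h j x \<partial>M) = (if i = j then 1 else 0))"

definition orthonormal_basis :: "'a measure \<Rightarrow> 'i set \<Rightarrow> ('i \<Rightarrow> 'a \<Rightarrow> real) \<Rightarrow> bool" where
  "orthonormal_basis M I h \<longleftrightarrow> orthonormal M I h \<and> complete_system M I h"

definition psi_function :: "(real \<Rightarrow> real) \<Rightarrow> bool" where
  "psi_function \<psi> \<longleftrightarrow>
     (\<forall>u\<ge>1. 0 < \<psi> u) \<and> mono_on {1..} \<psi> \<and> continuous_on {1..} \<psi> \<and>
     filterlim \<psi> at_top at_top"

definition psi_norm :: "'w measure \<Rightarrow> (real \<Rightarrow> real) \<Rightarrow> ('w \<Rightarrow> real) \<Rightarrow> real" where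
  "psi_norm M \<psi> \<xi> = (SUP u\<in>{1..}. (\<integral>\<omega>. \<bar>\<xi> \<omega>\<bar> powr u \<partial>M) powr (1 / u) / \<psi> u)"

text \<open>For a variable outside the following space the real number \<open>psi_norm\<close> is meaningless, so
  membership is always required or concluded along with a norm estimate; it is automatic for
  finite sums and maxima of members.\<close>

definition F_psi :: "'w measure \<Rightarrow> (real \<Rightarrow> real) \<Rightarrow> ('w \<Rightarrow> real) set" where
  "F_psi M \<psi> = {\<xi> \<in> borel_measurable M.
     (\<forall>u\<ge>1. integrable M (\<lambda>\<omega>. \<bar>\<xi> \<omega>\<bar> powr u)) \<and>
     bdd_above ((\<lambda>u. (\<integral>\<omega>. \<bar>\<xi> \<omega>\<bar> powr u \<partial>M) powr (1 / u) / \<psi> u) ` {1..})}"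

text \<open>A strictly \<open>F\<^sub>\<psi>\<close> family \<open>\<Delta>\<close> with determining constant \<open>C\<close>. The sums over at most countable
  index sets are the mean-square limits \<open>\<eta>\<close> of sequences of partial sums; finite sums are the
  case in which all but finitely many coefficients vanish.\<close>

definition strictly_F_psi ::
    "'w measure \<Rightarrow> (real \<Rightarrow> real) \<Rightarrow> ('w \<Rightarrow> real) set \<Rightarrow> real \<Rightarrow> bool" where
  "strictly_F_psi M \<psi> \<Delta> C \<longleftrightarrow>
     0 < C \<and>
     (\<forall>\<xi>\<in>\<Delta>. \<xi> \<in> F_psi M \<psi> \<and> (\<integral>\<omega>. \<xi> \<omega> \<partial>M) = 0) \<and>
     (\<forall>(\<xi> :: nat \<Rightarrow> 'w \<Rightarrow> real) c \<eta>.
        (\<forall>i. \<xi> i \<in> \<Delta>) \<and> \<eta> \<in> borel_measurable M \<and>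
        ms_converges M (\<lambda>n \<omega>. \<Sum>i<n. c i * \<xi> i \<omega>) \<eta> \<longrightarrow>
        \<eta> \<in> F_psi M \<psi> \<and> psi_norm M \<psi> \<eta> \<le> C * norm2 M \<eta>)"

text \<open>The space generated by a strictly \<open>F\<^sub>\<psi>\<close> family: its closed linear span in \<open>F\<^sub>\<psi>\<close>.\<close>

definition SF_space ::
    "'w measure \<Rightarrow> (real \<Rightarrow> real) \<Rightarrow> ('w \<Rightarrow> real) set \<Rightarrow> ('w \<Rightarrow> real) set" where
  "SF_space M \<psi> \<Delta> = {\<eta> \<in> F_psi M \<psi>.
     \<forall>\<epsilon>>0. \<exists>J c. finite J \<and> J \<subseteq> \<Delta> \<and>
       psi_norm M \<psi> (\<lambda>\<omega>. \<eta> \<omega> - (\<Sum>\<zeta>\<in>J. c \<zeta> * \<zeta> \<omega>)) < \<epsilon>}"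

definition majorizing_characteristic ::
    "'w measure \<Rightarrow> (real \<Rightarrow> real) \<Rightarrow> ('w \<Rightarrow> real) set \<Rightarrow> (nat \<Rightarrow> real) \<Rightarrow> bool" where
  "majorizing_characteristic M \<psi> V \<kappa> \<longleftrightarrow>
     mono_on {1..} \<kappa> \<and>
     (\<forall>n\<ge>1. \<forall>\<xi>. (\<forall>i\<in>{1..n}. \<xi> i \<in> V) \<longrightarrow>
        psi_norm M \<psi> (\<lambda>\<omega>. MAX i\<in>{1..n}. \<bar>\<xi> i \<omega>\<bar>)
          \<le> \<kappa> n * (MAX i\<in>{1..n}. psi_norm M \<psi> (\<xi> i)))"

text \<open>Centres lie in \<open>T\<close>, which is the whole metric space. For compact \<open>T\<close> a finite cover exists
  for every \<open>u > 0\<close>; only such \<open>u\<close> matter.\<close>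

definition metric_massiveness :: "'t::metric_space set \<Rightarrow> real \<Rightarrow> nat" where
  "metric_massiveness T u =
     (LEAST n. \<exists>c r. (\<forall>i<n. c i \<in> T \<and> r i \<le> u) \<and> T \<subseteq> (\<Union>i<n. cball (c i) (r i)))"

text \<open>Separability of a process in the sense of Doob: outside a null set the graph of every sample
  path lies in the closure of its restriction to one countable set of parameters.\<close>

definition separable_process ::
    "'w measure \<Rightarrow> 't::metric_space set \<Rightarrow> ('t \<Rightarrow> 'w \<Rightarrow> real) \<Rightarrow> bool" where
  "separable_process M T Y \<longleftrightarrow>
     (\<exists>S. countable S \<and> S \<subseteq> T \<and>
       (AE \<omega> in M. \<forall>t\<in>T. \<forall>\<epsilon>>0. \<exists>s\<in>S. dist s t < \<epsilon> \<and> \<bar>Y s \<omega> - Y t \<omega>\<bar> < \<epsilon>))"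

definition coefficient ::
    "'l measure \<Rightarrow> ('t \<Rightarrow> 'l \<Rightarrow> real) \<Rightarrow> (nat \<Rightarrow> 'l \<Rightarrow> real) \<Rightarrow> nat \<Rightarrow> 't \<Rightarrow> real" where
  "coefficient \<mu> f g k t = (\<integral>l. f t l * g k l \<partial>\<mu>)"

definition partial_sum ::
    "(nat \<Rightarrow> 't \<Rightarrow> real) \<Rightarrow> (nat \<Rightarrow> 'w \<Rightarrow> real) \<Rightarrow> nat \<Rightarrow> 't \<Rightarrow> 'w \<Rightarrow> real" where
  "partial_sum a \<xi> N t \<omega> = (\<Sum>k=1..N. \<xi> k \<omega> * a k t)"

definition remainder ::
    "('t \<Rightarrow> 'w \<Rightarrow> real) \<Rightarrow> (nat \<Rightarrow> 't \<Rightarrow> real) \<Rightarrow> (nat \<Rightarrow> 'w \<Rightarrow> real) \<Rightarrow> nat \<Rightarrow> 't \<Rightarrow> 'w \<Rightarrow> real"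
  where
  "remainder X a \<xi> N t \<omega> = X t \<omega> - partial_sum a \<xi> N t \<omega>"

definition ms_expansion ::
    "'w measure \<Rightarrow> 't set \<Rightarrow> ('t \<Rightarrow> 'w \<Rightarrow> real) \<Rightarrow> (nat \<Rightarrow> 't \<Rightarrow> real) \<Rightarrow>
     (nat \<Rightarrow> 'w \<Rightarrow> real) \<Rightarrow> bool" where
  "ms_expansion M T X a \<xi> \<longleftrightarrow>
     orthonormal M {1..} \<xi> \<and>
     (\<forall>k\<ge>1. (\<integral>\<omega>. \<xi> k \<omega> \<partial>M) = 0) \<and>
     (\<forall>t\<in>T. ms_converges M (\<lambda>n. partial_sum a \<xi> n t) (X t))"

text \<open>The integrand \<open>\<kappa> (N (\<sigma>\<^sup>-\<^sup>1 (u / C)))\<close>. If \<open>\<sigma>\<close> is bounded and \<open>u / C\<close> lies outside its range, the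
  value does not depend on \<open>u\<close>, so it does not affect integrability near 0, and the
  bound below only uses \<open>u / C\<close> inside the range.\<close>

definition entropy_integrand ::
    "'t::metric_space set \<Rightarrow> (nat \<Rightarrow> real) \<Rightarrow> real \<Rightarrow> (real \<Rightarrow> real) \<Rightarrow> real \<Rightarrow> real" where
  "entropy_integrand T \<kappa> C \<sigma> u = \<kappa> (metric_massiveness T (the_inv_into {0..} \<sigma> (u / C)))"

definition sup_bound ::
    "'w measure \<Rightarrow> 't::metric_space set \<Rightarrow> ('t \<Rightarrow> 'w \<Rightarrow> real) \<Rightarrow> (nat \<Rightarrow> real) \<Rightarrow> real \<Rightarrow>
     (real \<Rightarrow> real) \<Rightarrow> real \<Rightarrow> real" where
  "sup_bound M T Y \<kappa> C \<sigma> p =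
     (let \<gamma> = C * \<sigma> (diameter T) in
       (INF t\<in>T. C * norm2 M (Y t)) +
       1 / (p * (1 - p)) * (LINT u:{0<..<\<gamma> * p}|lborel. entropy_integrand T \<kappa> C \<sigma> u))"

end

theory Submission
  imports Defs
begin

text \<open>
  Everything rests on one estimate. Let \<open>H\<close> be the closed linear span of the values of \<open>X\<close> in
  \<open>L\<^sub>2\<close>. For finite linear combinations \<open>\<parallel>\<eta>\<parallel>\<^sub>\<psi> \<le> C \<parallel>\<eta>\<parallel>\<^sub>2\<close> is the assumption on \<open>X\<close>; a mean-square
  limit is an almost sure limit of a subsequence, so by Fatou's lemma the estimate holds on all of
  \<open>H\<close> (\<open>H_psi_bounded\<close>). Mean-square statements about members of \<open>H\<close> thereby become statements about
  the norm of \<open>F\<^sub>\<psi>\<close>.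

  The covariance of \<open>X\<close> is the Gram kernel of the functions \<open>f\<^sub>t\<close>, so \<open>f\<^sub>t \<mapsto> X\<^sub>t\<close> extends to an isometry
  of the closed linear spans. The images \<open>\<xi>\<^sub>k\<close> of the basis functions \<open>g\<^sub>k\<close> give an expansion, which is
  the image of the Fourier series of \<open>f\<^sub>t\<close> (\<open>ex_ms_expansion\<close>). Conversely, the variables of any
  expansion lie in \<open>H\<close>, because they are as far from the linear combinations of the \<open>X\<^sub>t\<close> as the \<open>g\<^sub>k\<close>
  are from those of the \<open>f\<^sub>t\<close> (\<open>ms_expansion_in_closed_span\<close>). Hence \<open>Y\<^sub>N(t)\<close> and its increments lie
  in \<open>H\<close>, and an increment over a distance at most \<open>h\<close> has norm at most \<open>C \<sigma>\<^sub>N(h)\<close>.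

  The supremum is estimated by chaining (\<open>chaining\<close>, \<open>chain_bound\<close>). With \<open>\<gamma> = C \<sigma>(diam T)\<close> choose
  radii \<open>\<epsilon>\<^sub>k\<close> such that \<open>C \<sigma>(\<epsilon>\<^sub>k) = \<gamma> p\<^sup>k\<close> and minimal \<open>\<epsilon>\<^sub>k\<close>-nets of \<open>T\<close>; the net for \<open>k = 0\<close>
  consists of a single arbitrary point \<open>t\<^sub>0\<close>. Moving from the \<open>k\<close>-th net to the preceding one
  costs the maximum of \<open>N(\<epsilon>\<^sub>k)\<close> increments, which has norm at most \<open>\<kappa>(N(\<epsilon>\<^sub>k)) \<gamma> p\<^sup>k\<^sup>-\<^sup>1\<close>. These bounds
  sum up to at most \<open>1 / (p (1 - p))\<close> times the entropy integral, since its integrand is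
  nonincreasing. The norm of \<open>Y(t\<^sub>0)\<close> adds \<open>C \<parallel>Y(t\<^sub>0)\<parallel>\<^sub>2\<close>, and \<open>t\<^sub>0\<close> is optimized at the end. The
  argument bounds the process on a countable set of parameters only; separability extends the bound
  to \<open>T\<close>, where the supremum agrees with a measurable function up to a null set and is therefore
  measurable for the completed measure.
\<close>

section \<open>Moment bounds in the space \<open>F\<^sub>\<psi>\<close>\<close>

lemma convex_combination_powr:
  fixes x y :: real
  assumes "0 \<le> x" "0 \<le> y" "0 \<le> s" "0 \<le> t" "s + t = 1" "1 \<le> u"
  shows "(s * x + t * y) powr u \<le> s * x powr u + t * y powr u"
proof -
  have scaled: "(r * z) powr u \<le> r * z powr u" if "0 \<le> r" "r \<le> 1" "0 \<le> z" for r z :: real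
  proof -
    have "r powr u \<le> r powr 1" if "0 < r"
      using that \<open>r \<le> 1\<close> assms(6) by (intro powr_mono') auto
    then have "r powr u \<le> r"
      using \<open>0 \<le> r\<close> by (cases "r = 0") auto
    then show ?thesis
      using that by (simp add: powr_mult mult_right_mono)
  qed
  have st: "s \<le> 1" "t \<le> 1" using assms by auto
  consider "x = 0" | "y = 0" | "0 < x" "0 < y" using assms by linarith
  then show ?thesis
  proof cases
    case 3
    have s: "s = 1 - t" using assms(5) by simp
    show ?thesis
      using convex_onD[OF powr_convex[OF assms(6)], of t x y] 3 assms(4) st(2)
      unfolding s by simp
  qed (use scaled[of t y] scaled[of s x] assms st in auto)
qed

text \<open>Minkowski's inequality in the form in which it is used: the bounds \<open>a\<close> and \<open>b\<close> of the
  two \<open>L\<^sub>u\<close> norms add up. For positive \<open>a\<close>, \<open>b\<close> it is the convexity of \<open>r\<^sup>u\<close>, applied to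
  \<open>\<bar>x\<bar> / a\<close> and \<open>\<bar>y\<bar> / b\<close> with weights \<open>a / (a + b)\<close> and \<open>b / (a + b)\<close>.\<close>

lemma moment_add_le:
  fixes x y :: "'w \<Rightarrow> real"
  assumes [measurable]: "x \<in> borel_measurable M" "y \<in> borel_measurable M"
    and u: "1 \<le> u" and ab: "0 \<le> a" "0 \<le> b"
    and x: "(\<integral>\<^sup>+\<omega>. ennreal (\<bar>x \<omega>\<bar> powr u) \<partial>M) \<le> ennreal (a powr u)"
    and y: "(\<integral>\<^sup>+\<omega>. ennreal (\<bar>y \<omega>\<bar> powr u) \<partial>M) \<le> ennreal (b powr u)"
  shows "(\<integral>\<^sup>+\<omega>. ennreal (\<bar>x \<omega> + y \<omega>\<bar> powr u) \<partial>M) \<le> ennreal ((a + b) powr u)"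
proof -
  have zero: "AE \<omega> in M. z \<omega> = 0"
    if "(\<integral>\<^sup>+\<omega>. ennreal (\<bar>z \<omega>\<bar> powr u) \<partial>M) \<le> ennreal (0 powr u)"
      and [measurable]: "z \<in> borel_measurable M" for z :: "'w \<Rightarrow> real"
  proof -
    have "(\<integral>\<^sup>+\<omega>. ennreal (\<bar>z \<omega>\<bar> powr u) \<partial>M) = 0" using that by simp
    then have "AE \<omega> in M. ennreal (\<bar>z \<omega>\<bar> powr u) = 0"
      by (subst (asm) nn_integral_0_iff_AE) auto
    then show ?thesis
      by eventually_elim (simp add: ennreal_eq_0_iff powr_nonneg_iff)
  qed
  consider "a = 0" | "b = 0" | "0 < a" "0 < b" using ab by linarith
  then show ?thesis
  proof cases
    case 1
    have "AE \<omega> in M. x \<omega> = 0" using zero[of x] x 1 by simp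
    then have "(\<integral>\<^sup>+\<omega>. ennreal (\<bar>x \<omega> + y \<omega>\<bar> powr u) \<partial>M) = (\<integral>\<^sup>+\<omega>. ennreal (\<bar>y \<omega>\<bar> powr u) \<partial>M)"
      by (intro nn_integral_cong_AE) auto
    then show ?thesis using y 1 by simp
  next
    case 2
    have "AE \<omega> in M. y \<omega> = 0" using zero[of y] y 2 by simp
    then have "(\<integral>\<^sup>+\<omega>. ennreal (\<bar>x \<omega> + y \<omega>\<bar> powr u) \<partial>M) = (\<integral>\<^sup>+\<omega>. ennreal (\<bar>x \<omega>\<bar> powr u) \<partial>M)"
      by (intro nn_integral_cong_AE) auto
    then show ?thesis using x 2 by simp
  next
    case 3
    define A where "A = (a + b) powr u * (a / (a + b)) / a powr u"
    define B where "B = (a + b) powr u * (b / (a + b)) / b powr u"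
    have A0: "0 \<le> A" "0 \<le> B" using 3 by (auto simp: A_def B_def)
    have "\<bar>x \<omega> + y \<omega>\<bar> powr u \<le> A * \<bar>x \<omega>\<bar> powr u + B * \<bar>y \<omega>\<bar> powr u" for \<omega>
    proof -
      have "\<bar>x \<omega> + y \<omega>\<bar> powr u \<le> (\<bar>x \<omega>\<bar> + \<bar>y \<omega>\<bar>) powr u"
        using u by (intro powr_mono2) auto
      also have "\<bar>x \<omega>\<bar> + \<bar>y \<omega>\<bar>
          = (a + b) * (a / (a + b) * (\<bar>x \<omega>\<bar> / a) + b / (a + b) * (\<bar>y \<omega>\<bar> / b))"
        using 3 by (simp add: divide_simps)
      also have "\<dots> powr u = (a + b) powr u *
          (a / (a + b) * (\<bar>x \<omega>\<bar> / a) + b / (a + b) * (\<bar>y \<omega>\<bar> / b)) powr u"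
        by (rule powr_mult)
      also have "\<dots> \<le> (a + b) powr u *
          (a / (a + b) * (\<bar>x \<omega>\<bar> / a) powr u + b / (a + b) * (\<bar>y \<omega>\<bar> / b) powr u)"
        using 3 u by (intro mult_left_mono convex_combination_powr)
          (auto simp: add_divide_distrib[symmetric])
      also have "\<dots> = A * \<bar>x \<omega>\<bar> powr u + B * \<bar>y \<omega>\<bar> powr u"
        using 3 by (simp add: A_def B_def powr_divide algebra_simps)
      finally show ?thesis .
    qed
    then have "(\<integral>\<^sup>+\<omega>. ennreal (\<bar>x \<omega> + y \<omega>\<bar> powr u) \<partial>M)
        \<le> (\<integral>\<^sup>+\<omega>. ennreal A * ennreal (\<bar>x \<omega>\<bar> powr u) + ennreal B * ennreal (\<bar>y \<omega>\<bar> powr u) \<partial>M)"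
      using A0 by (intro nn_integral_mono)
        (auto simp: ennreal_mult'[symmetric] ennreal_plus[symmetric] simp del: ennreal_plus intro!: ennreal_leI)
    also have "\<dots> = ennreal A * (\<integral>\<^sup>+\<omega>. ennreal (\<bar>x \<omega>\<bar> powr u) \<partial>M)
        + ennreal B * (\<integral>\<^sup>+\<omega>. ennreal (\<bar>y \<omega>\<bar> powr u) \<partial>M)"
      by (simp add: nn_integral_add nn_integral_cmult)
    also have "\<dots> \<le> ennreal A * ennreal (a powr u) + ennreal B * ennreal (b powr u)"
      by (intro add_mono mult_left_mono x y) auto
    also have "\<dots> = ennreal (A * a powr u + B * b powr u)"
      using A0 by (simp add: ennreal_mult' ennreal_plus)
    also have "A * a powr u + B * b powr u = (a + b) powr u * (a / (a + b) + b / (a + b))"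
      using 3 by (simp add: A_def B_def distrib_left)
    also have "\<dots> = (a + b) powr u"
      using 3 by (simp add: add_divide_distrib[symmetric])
    finally show ?thesis .
  qed
qed

text \<open>Membership in \<open>F\<^sub>\<psi>\<close> and a norm bound in one predicate. Its nonnegative integrals make sense
  for all measurable functions, so that limit theorems apply to it directly.\<close>

definition psi_bounded :: "'w measure \<Rightarrow> (real \<Rightarrow> real) \<Rightarrow> real \<Rightarrow> ('w \<Rightarrow> real) \<Rightarrow> bool" where
  "psi_bounded M \<psi> B \<xi> \<longleftrightarrow> 0 \<le> B \<and> \<xi> \<in> borel_measurable M \<and>
     (\<forall>u\<ge>1. (\<integral>\<^sup>+\<omega>. ennreal (\<bar>\<xi> \<omega>\<bar> powr u) \<partial>M) \<le> ennreal ((B * \<psi> u) powr u))"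

lemma psi_boundedD:
  assumes "psi_bounded M \<psi> B \<xi>"
  shows "0 \<le> B" "\<xi> \<in> borel_measurable M"
    "\<And>u. 1 \<le> u \<Longrightarrow> (\<integral>\<^sup>+\<omega>. ennreal (\<bar>\<xi> \<omega>\<bar> powr u) \<partial>M) \<le> ennreal ((B * \<psi> u) powr u)"
  using assms by (auto simp: psi_bounded_def)

lemma psi_bounded_integrable:
  assumes "psi_bounded M \<psi> B \<xi>" "1 \<le> u"
  shows "integrable M (\<lambda>\<omega>. \<bar>\<xi> \<omega>\<bar> powr u)"
    and "(\<integral>\<omega>. \<bar>\<xi> \<omega>\<bar> powr u \<partial>M) \<le> (B * \<psi> u) powr u"
proof -
  note [measurable] = psi_boundedD(2)[OF assms(1)]
  note le = psi_boundedD(3)[OF assms]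
  show int: "integrable M (\<lambda>\<omega>. \<bar>\<xi> \<omega>\<bar> powr u)"
    using le by (intro integrableI_nonneg) (auto simp: less_top[symmetric] top_unique)
  show "(\<integral>\<omega>. \<bar>\<xi> \<omega>\<bar> powr u \<partial>M) \<le> (B * \<psi> u) powr u"
    using le by (simp add: nn_integral_eq_integral[OF int] ennreal_le_iff)
qed

lemma psi_norm_nonneg:
  assumes "\<xi> \<in> F_psi M \<psi>" "\<And>u. 1 \<le> u \<Longrightarrow> 0 < \<psi> u"
  shows "0 \<le> psi_norm M \<psi> \<xi>"
proof -
  have "0 \<le> (\<integral>\<omega>. \<bar>\<xi> \<omega>\<bar> powr 1 \<partial>M) powr (1 / 1) / \<psi> 1"
    using assms(2)[of 1] by simp
  also have "\<dots> \<le> psi_norm M \<psi> \<xi>"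
    unfolding psi_norm_def using assms(1) by (intro cSUP_upper) (auto simp: F_psi_def)
  finally show ?thesis .
qed

lemma psi_bounded_iff:
  assumes \<psi>: "\<And>u. 1 \<le> u \<Longrightarrow> 0 < \<psi> u"
  shows "psi_bounded M \<psi> B \<xi> \<longleftrightarrow> \<xi> \<in> F_psi M \<psi> \<and> psi_norm M \<psi> \<xi> \<le> B"
proof
  assume b: "psi_bounded M \<psi> B \<xi>"
  have le: "(\<integral>\<omega>. \<bar>\<xi> \<omega>\<bar> powr u \<partial>M) powr (1 / u) / \<psi> u \<le> B" if "1 \<le> u" for u
  proof -
    have "(\<integral>\<omega>. \<bar>\<xi> \<omega>\<bar> powr u \<partial>M) powr (1 / u) \<le> ((B * \<psi> u) powr u) powr (1 / u)"
      using psi_bounded_integrable(2)[OF b that] that by (intro powr_mono2) auto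
    also have "\<dots> = B * \<psi> u"
      using that psi_boundedD(1)[OF b] \<psi>[OF that] by (simp add: powr_powr)
    finally show ?thesis using \<psi>[OF that] by (simp add: divide_simps)
  qed
  then show "\<xi> \<in> F_psi M \<psi> \<and> psi_norm M \<psi> \<xi> \<le> B"
    using psi_boundedD(2)[OF b] psi_bounded_integrable(1)[OF b]
    unfolding F_psi_def psi_norm_def by (auto intro!: cSUP_least bdd_aboveI2)
next
  assume a: "\<xi> \<in> F_psi M \<psi> \<and> psi_norm M \<psi> \<xi> \<le> B"
  have B: "0 \<le> B" using psi_norm_nonneg[of \<xi> M \<psi>] \<psi> a by fastforce
  have "(\<integral>\<^sup>+\<omega>. ennreal (\<bar>\<xi> \<omega>\<bar> powr u) \<partial>M) \<le> ennreal ((B * \<psi> u) powr u)" if u: "1 \<le> u" for u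
  proof -
    let ?I = "\<integral>\<omega>. \<bar>\<xi> \<omega>\<bar> powr u \<partial>M"
    have "?I powr (1 / u) / \<psi> u \<le> psi_norm M \<psi> \<xi>"
      unfolding psi_norm_def using a u by (intro cSUP_upper) (auto simp: F_psi_def)
    also have "\<dots> \<le> B" using a by simp
    finally have "?I powr (1 / u) \<le> B * \<psi> u"
      using \<psi>[OF u] by (simp add: pos_divide_le_eq)
    then have "(?I powr (1 / u)) powr u \<le> (B * \<psi> u) powr u"
      using u by (intro powr_mono2) auto
    moreover have "(?I powr (1 / u)) powr u = ?I"
      using u by (simp add: powr_powr)
    ultimately show ?thesis
      using a u by (subst nn_integral_eq_integral) (auto simp: F_psi_def intro!: ennreal_leI)
  qed
  then show "psi_bounded M \<psi> B \<xi>"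
    using a B by (auto simp: psi_bounded_def F_psi_def)
qed

lemma psi_bounded_add:
  assumes x: "psi_bounded M \<psi> a x" and y: "psi_bounded M \<psi> b y"
    and \<psi>: "\<And>u. 1 \<le> u \<Longrightarrow> 0 < \<psi> u"
  shows "psi_bounded M \<psi> (a + b) (\<lambda>\<omega>. x \<omega> + y \<omega>)"
proof -
  note d = psi_boundedD[OF x] psi_boundedD[OF y]
  have "(\<integral>\<^sup>+\<omega>. ennreal (\<bar>x \<omega> + y \<omega>\<bar> powr u) \<partial>M) \<le> ennreal ((a * \<psi> u + b * \<psi> u) powr u)"
    if "1 \<le> u" for u
    using that d \<psi>[OF that] by (intro moment_add_le) auto
  then show ?thesis
    using d by (auto simp: psi_bounded_def distrib_right)
qed

lemma psi_bounded_zero: "psi_bounded M \<psi> 0 (\<lambda>\<omega>. 0)"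
  by (simp add: psi_bounded_def)

lemma psi_bounded_sum:
  assumes "\<And>i. i \<in> I \<Longrightarrow> psi_bounded M \<psi> (B i) (x i)"
    and "\<And>u. 1 \<le> u \<Longrightarrow> 0 < \<psi> u"
  shows "psi_bounded M \<psi> (\<Sum>i\<in>I. B i) (\<lambda>\<omega>. \<Sum>i\<in>I. x i \<omega>)"
  using assms
  by (induction I rule: infinite_finite_induct) (auto simp: psi_bounded_zero intro!: psi_bounded_add)

lemma psi_bounded_mono:
  assumes x: "psi_bounded M \<psi> a x" and "y \<in> borel_measurable M"
    and le: "AE \<omega> in M. \<bar>y \<omega>\<bar> \<le> \<bar>x \<omega>\<bar>" and "a \<le> b"
    and \<psi>: "\<And>u. 1 \<le> u \<Longrightarrow> 0 < \<psi> u"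
  shows "psi_bounded M \<psi> b y"
proof -
  have "(\<integral>\<^sup>+\<omega>. ennreal (\<bar>y \<omega>\<bar> powr u) \<partial>M) \<le> ennreal ((b * \<psi> u) powr u)" if u: "1 \<le> u" for u
  proof -
    have "(\<integral>\<^sup>+\<omega>. ennreal (\<bar>y \<omega>\<bar> powr u) \<partial>M) \<le> (\<integral>\<^sup>+\<omega>. ennreal (\<bar>x \<omega>\<bar> powr u) \<partial>M)"
      using le u by (intro nn_integral_mono_AE) (auto intro!: ennreal_leI powr_mono2)
    also have "\<dots> \<le> ennreal ((a * \<psi> u) powr u)" by (rule psi_boundedD(3)[OF x u])
    also have "\<dots> \<le> ennreal ((b * \<psi> u) powr u)"
      using u \<psi>[OF u] \<open>a \<le> b\<close> psi_boundedD(1)[OF x]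
      by (intro ennreal_leI powr_mono2 mult_right_mono) auto
    finally show ?thesis .
  qed
  then show ?thesis
    using assms psi_boundedD(1)[OF x] by (auto simp: psi_bounded_def)
qed

lemma psi_bounded_completion:
  assumes "psi_bounded M \<psi> B x"
  shows "psi_bounded (completion M) \<psi> B x"
  using assms by (auto simp: psi_bounded_def nn_integral_completion intro: measurable_completion)

lemma psi_bounded_cmult:
  assumes x: "psi_bounded M \<psi> B x" and \<psi>: "\<And>u. 1 \<le> u \<Longrightarrow> 0 < \<psi> u"
  shows "psi_bounded M \<psi> (\<bar>c\<bar> * B) (\<lambda>\<omega>. c * x \<omega>)"
proof -
  note d = psi_boundedD[OF x]
  note [measurable] = d(2)
  have "(\<integral>\<^sup>+\<omega>. ennreal (\<bar>c * x \<omega>\<bar> powr u) \<partial>M) \<le> ennreal ((\<bar>c\<bar> * B * \<psi> u) powr u)"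
    if u: "1 \<le> u" for u
  proof -
    have "(\<integral>\<^sup>+\<omega>. ennreal (\<bar>c * x \<omega>\<bar> powr u) \<partial>M)
        = ennreal (\<bar>c\<bar> powr u) * (\<integral>\<^sup>+\<omega>. ennreal (\<bar>x \<omega>\<bar> powr u) \<partial>M)"
      by (simp add: nn_integral_cmult[symmetric] ennreal_mult'[symmetric] abs_mult powr_mult)
    also have "\<dots> \<le> ennreal (\<bar>c\<bar> powr u) * ennreal ((B * \<psi> u) powr u)"
      by (intro mult_left_mono d(3)[OF u]) auto
    also have "\<dots> = ennreal ((\<bar>c\<bar> * B * \<psi> u) powr u)"
      using d(1) \<psi>[OF u] by (simp add: ennreal_mult'[symmetric] powr_mult mult.assoc)
    finally show ?thesis .
  qed
  then show ?thesis using d by (auto simp: psi_bounded_def)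
qed

lemma (in prob_space) psi_bounded_const:
  assumes mono: "mono_on {1..} \<psi>" and \<psi>: "\<And>u. 1 \<le> u \<Longrightarrow> 0 < \<psi> u"
  shows "psi_bounded M \<psi> (\<bar>c\<bar> / \<psi> 1) (\<lambda>\<omega>. c)"
proof -
  have "\<bar>c\<bar> powr u \<le> (\<bar>c\<bar> / \<psi> 1 * \<psi> u) powr u" if u: "1 \<le> u" for u
  proof -
    have "\<psi> 1 \<le> \<psi> u" using mono u by (auto intro: mono_onD)
    then have "\<bar>c\<bar> * 1 \<le> \<bar>c\<bar> * (\<psi> u / \<psi> 1)"
      using \<psi>[of 1] by (intro mult_left_mono) auto
    then show ?thesis using u by (intro powr_mono2) (auto simp: field_simps)
  qed
  then show ?thesis
    using \<psi>[of 1] by (auto simp: psi_bounded_def emeasure_space_1 intro!: ennreal_leI)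
qed

text \<open>Norm balls of \<open>F\<^sub>\<psi>\<close> are closed under almost sure convergence, by Fatou's lemma.\<close>

lemma psi_bounded_AE_limit:
  assumes x: "\<And>n. psi_bounded M \<psi> (B n) (x n)" and lim: "AE \<omega> in M. (\<lambda>n. x n \<omega>) \<longlonglongrightarrow> z \<omega>"
    and B: "B \<longlonglongrightarrow> b" and [measurable]: "z \<in> borel_measurable M"
    and \<psi>: "\<And>u. 1 \<le> u \<Longrightarrow> 0 < \<psi> u"
  shows "psi_bounded M \<psi> b z"
proof -
  note [measurable] = psi_boundedD(2)[OF x]
  have b: "0 \<le> b" using B psi_boundedD(1)[OF x] by (intro LIMSEQ_le_const) auto
  have "(\<integral>\<^sup>+\<omega>. ennreal (\<bar>z \<omega>\<bar> powr u) \<partial>M) \<le> ennreal ((b * \<psi> u) powr u)" if u: "1 \<le> u" for u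
  proof -
    have eq: "AE \<omega> in M. ennreal (\<bar>z \<omega>\<bar> powr u) = liminf (\<lambda>n. ennreal (\<bar>x n \<omega>\<bar> powr u))"
      using lim
    proof eventually_elim
      case (elim \<omega>)
      have "(\<lambda>n. ennreal (\<bar>x n \<omega>\<bar> powr u)) \<longlonglongrightarrow> ennreal (\<bar>z \<omega>\<bar> powr u)"
        using u by (intro tendsto_ennrealI tendsto_powr' tendsto_rabs elim tendsto_const) auto
      then show ?case by (rule lim_imp_Liminf[OF sequentially_bot, symmetric])
    qed
    have "(\<integral>\<^sup>+\<omega>. ennreal (\<bar>z \<omega>\<bar> powr u) \<partial>M)
        = (\<integral>\<^sup>+\<omega>. liminf (\<lambda>n. ennreal (\<bar>x n \<omega>\<bar> powr u)) \<partial>M)"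
      by (rule nn_integral_cong_AE[OF eq])
    also have "\<dots> \<le> liminf (\<lambda>n. \<integral>\<^sup>+\<omega>. ennreal (\<bar>x n \<omega>\<bar> powr u) \<partial>M)"
      by (rule nn_integral_liminf) simp
    also have "\<dots> \<le> liminf (\<lambda>n. ennreal ((B n * \<psi> u) powr u))"
      using psi_boundedD(3)[OF x u] by (intro Liminf_mono always_eventually) auto
    also have "\<dots> = ennreal ((b * \<psi> u) powr u)"
      using u \<psi>[OF u] B b psi_boundedD(1)[OF x]
      by (intro lim_imp_Liminf tendsto_ennrealI tendsto_powr' tendsto_mult tendsto_const) auto
    finally show ?thesis .
  qed
  then show ?thesis using b by (auto simp: psi_bounded_def)
qed

text \<open>Markov's inequality for \<open>\<bar>x\<bar>\<^sup>u\<close>, one estimate for each order \<open>u\<close>.\<close>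

lemma (in prob_space) psi_bounded_tail:
  assumes x: "psi_bounded M \<psi> B x" and "0 < \<epsilon>" and \<psi>: "\<And>u. 1 \<le> u \<Longrightarrow> 0 < \<psi> u"
  shows "measure M {\<omega> \<in> space M. x \<omega> > \<epsilon>} \<le> (INF u\<in>{1..}. B powr u * \<psi> u powr u / \<epsilon> powr u)"
proof (rule cINF_greatest)
  fix u :: real assume "u \<in> {1..}"
  then have u: "1 \<le> u" by simp
  note d = psi_boundedD[OF x] psi_bounded_integrable[OF x u]
  note [measurable] = d(2)
  have "measure M {\<omega> \<in> space M. x \<omega> > \<epsilon>}
      \<le> measure M {\<omega> \<in> space M. \<epsilon> powr u \<le> \<bar>x \<omega>\<bar> powr u}"
    using \<open>0 < \<epsilon>\<close> u by (intro finite_measure_mono) (auto intro!: powr_mono2)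
  also have "\<dots> \<le> (\<integral>\<omega>. \<bar>x \<omega>\<bar> powr u \<partial>M) / \<epsilon> powr u"
    using integral_Markov_inequality_measure[OF d(4), of "{}" "\<epsilon> powr u"] \<open>0 < \<epsilon>\<close> by simp
  also have "\<dots> \<le> (B * \<psi> u) powr u / \<epsilon> powr u"
    by (intro divide_right_mono d) auto
  also have "\<dots> = B powr u * \<psi> u powr u / \<epsilon> powr u"
    using d(1) \<psi>[OF u] by (simp add: powr_mult)
  finally show "measure M {\<omega> \<in> space M. x \<omega> > \<epsilon>} \<le> B powr u * \<psi> u powr u / \<epsilon> powr u" .
qed simp

section \<open>Square integrable functions\<close>

lemma square_integrable_borel:
  "square_integrable M x \<Longrightarrow> x \<in> borel_measurable M"
  by (simp add: square_integrable_def)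

lemma square_integrable_mult:
  assumes "square_integrable M x" "square_integrable M y"
  shows "integrable M (\<lambda>\<omega>. x \<omega> * y \<omega>)"
proof (rule Bochner_Integration.integrable_bound)
  show "integrable M (\<lambda>\<omega>. (x \<omega>)\<^sup>2 + (y \<omega>)\<^sup>2)"
    using assms by (auto simp: square_integrable_def)
  have "\<bar>a * b\<bar> \<le> a\<^sup>2 + b\<^sup>2" for a b :: real
  proof -
    have "2 * \<bar>a\<bar> * \<bar>b\<bar> \<le> a\<^sup>2 + b\<^sup>2"
      using sum_squares_bound[of "\<bar>a\<bar>" "\<bar>b\<bar>"] by simp
    moreover have "0 \<le> \<bar>a\<bar> * \<bar>b\<bar>" by simp
    ultimately show ?thesis unfolding abs_mult by linarith
  qed
  then show "AE \<omega> in M. norm (x \<omega> * y \<omega>) \<le> norm ((x \<omega>)\<^sup>2 + (y \<omega>)\<^sup>2)" by simp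
qed (use assms in \<open>auto intro!: borel_measurable_times simp: square_integrable_def\<close>)

lemma square_integrable_add:
  assumes "square_integrable M x" "square_integrable M y"
  shows "square_integrable M (\<lambda>\<omega>. x \<omega> + y \<omega>)"
  using assms square_integrable_mult[OF assms]
  by (auto simp: square_integrable_def power2_sum mult.assoc)

lemma square_integrable_cmult:
  "square_integrable M x \<Longrightarrow> square_integrable M (\<lambda>\<omega>. c * x \<omega>)"
  by (auto simp: square_integrable_def power_mult_distrib)

lemma square_integrable_diff:
  assumes "square_integrable M x" "square_integrable M y"
  shows "square_integrable M (\<lambda>\<omega>. x \<omega> - y \<omega>)"
  using square_integrable_add[OF assms(1) square_integrable_cmult[OF assms(2), of "-1"]] by simp

lemma square_integrable_zero: "square_integrable M (\<lambda>\<omega>. 0)"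
  by (simp add: square_integrable_def)

lemma square_integrable_sum:
  "(\<And>i. i \<in> I \<Longrightarrow> square_integrable M (x i)) \<Longrightarrow> square_integrable M (\<lambda>\<omega>. \<Sum>i\<in>I. c i * x i \<omega>)"
  by (induction I rule: infinite_finite_induct)
    (auto simp: square_integrable_zero intro!: square_integrable_add square_integrable_cmult)

lemma norm2_nonneg: "0 \<le> norm2 M x"
  by (simp add: norm2_def)

lemma norm2_square: "(norm2 M x)\<^sup>2 = (\<integral>\<omega>. x \<omega> * x \<omega> \<partial>M)"
  by (simp add: norm2_def power2_eq_square)

lemma nn_integral_square:
  assumes "square_integrable M x"
  shows "(\<integral>\<^sup>+\<omega>. ennreal ((x \<omega>)\<^sup>2) \<partial>M) = ennreal ((norm2 M x)\<^sup>2)"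
  using assms by (subst nn_integral_eq_integral) (auto simp: square_integrable_def norm2_def)

lemma norm2_cmult: "norm2 M (\<lambda>\<omega>. c * x \<omega>) = \<bar>c\<bar> * norm2 M x"
  by (simp add: norm2_def power_mult_distrib real_sqrt_mult)

lemma norm2_minus_commute: "norm2 M (\<lambda>\<omega>. x \<omega> - y \<omega>) = norm2 M (\<lambda>\<omega>. y \<omega> - x \<omega>)"
  by (simp add: norm2_def power2_commute)

lemma norm2_triangle:
  assumes x: "square_integrable M x" and y: "square_integrable M y"
  shows "norm2 M (\<lambda>\<omega>. x \<omega> + y \<omega>) \<le> norm2 M x + norm2 M y"
proof -
  have sq: "(\<integral>\<^sup>+\<omega>. ennreal (\<bar>z \<omega>\<bar> powr 2) \<partial>M) = ennreal (norm2 M z powr 2)"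
    if "square_integrable M z" for z
    using nn_integral_square[OF that] by (simp add: norm2_nonneg)
  have "ennreal (norm2 M (\<lambda>\<omega>. x \<omega> + y \<omega>) powr 2) \<le> ennreal ((norm2 M x + norm2 M y) powr 2)"
    unfolding sq[OF square_integrable_add[OF x y], symmetric]
    by (intro moment_add_le norm2_nonneg square_integrable_borel x y)
      (simp_all only: sq[OF x] sq[OF y] order_refl one_le_numeral)
  then have "(norm2 M (\<lambda>\<omega>. x \<omega> + y \<omega>))\<^sup>2 \<le> (norm2 M x + norm2 M y)\<^sup>2"
    by (simp add: norm2_nonneg)
  then show ?thesis
    by (rule power2_le_imp_le) (simp add: norm2_nonneg)
qed

lemma norm2_triangle_diff:
  assumes "square_integrable M x" "square_integrable M y" "square_integrable M z"
  shows "norm2 M (\<lambda>\<omega>. x \<omega> - z \<omega>) \<le> norm2 M (\<lambda>\<omega>. x \<omega> - y \<omega>) + norm2 M (\<lambda>\<omega>. y \<omega> - z \<omega>)"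
  using norm2_triangle[OF square_integrable_diff[OF assms(1,2)] square_integrable_diff[OF assms(2,3)]]
  by simp

lemma norm2_diff_ge:
  assumes "square_integrable M x" "square_integrable M y"
  shows "\<bar>norm2 M x - norm2 M y\<bar> \<le> norm2 M (\<lambda>\<omega>. x \<omega> - y \<omega>)"
  using norm2_triangle_diff[OF assms square_integrable_zero]
    norm2_triangle_diff[OF assms(2,1) square_integrable_zero]
  by (simp add: norm2_minus_commute[of M y x])

lemma tendsto_norm2:
  assumes "\<And>n. square_integrable M (x n)" "square_integrable M z"
    and "(\<lambda>n. norm2 M (\<lambda>\<omega>. x n \<omega> - z \<omega>)) \<longlonglongrightarrow> 0"
  shows "(\<lambda>n. norm2 M (x n)) \<longlonglongrightarrow> norm2 M z"
proof -
  have "(\<lambda>n. norm2 M (x n) - norm2 M z) \<longlonglongrightarrow> 0"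
    by (rule Lim_null_comparison[OF _ assms(3)])
      (use norm2_diff_ge[OF assms(1,2)] in \<open>auto intro: always_eventually\<close>)
  then show ?thesis by (simp add: LIM_zero_iff)
qed

text \<open>Polarization reduces the continuity of the scalar product to that of the norm.\<close>

lemma tendsto_inner:
  assumes x: "\<And>n. square_integrable M (x n)" "square_integrable M x'"
    and y: "\<And>n. square_integrable M (y n)" "square_integrable M y'"
    and limx: "(\<lambda>n. norm2 M (\<lambda>\<omega>. x n \<omega> - x' \<omega>)) \<longlonglongrightarrow> 0"
    and limy: "(\<lambda>n. norm2 M (\<lambda>\<omega>. y n \<omega> - y' \<omega>)) \<longlonglongrightarrow> 0"
  shows "(\<lambda>n. \<integral>\<omega>. x n \<omega> * y n \<omega> \<partial>M) \<longlonglongrightarrow> (\<integral>\<omega>. x' \<omega> * y' \<omega> \<partial>M)"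
proof -
  have polar: "(\<integral>\<omega>. a \<omega> * b \<omega> \<partial>M)
      = ((norm2 M (\<lambda>\<omega>. a \<omega> + b \<omega>))\<^sup>2 - (norm2 M (\<lambda>\<omega>. a \<omega> - b \<omega>))\<^sup>2) / 4"
    if "square_integrable M a" "square_integrable M b" for a b
  proof -
    have "(norm2 M (\<lambda>\<omega>. a \<omega> + b \<omega>))\<^sup>2 - (norm2 M (\<lambda>\<omega>. a \<omega> - b \<omega>))\<^sup>2
        = (\<integral>\<omega>. (a \<omega> + b \<omega>)\<^sup>2 - (a \<omega> - b \<omega>)\<^sup>2 \<partial>M)"
      using square_integrable_add[OF that] square_integrable_diff[OF that]
      by (simp add: norm2_def square_integrable_def)
    also have "\<dots> = (\<integral>\<omega>. 4 * (a \<omega> * b \<omega>) \<partial>M)"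
      by (simp add: power2_eq_square algebra_simps)
    finally show ?thesis by simp
  qed
  have lim0: "(\<lambda>n. norm2 M (\<lambda>\<omega>. x n \<omega> - x' \<omega>) + norm2 M (\<lambda>\<omega>. y n \<omega> - y' \<omega>)) \<longlonglongrightarrow> 0"
    using tendsto_add[OF limx limy] by simp
  note dx = square_integrable_diff[OF x] and dy = square_integrable_diff[OF y]
  have "(\<lambda>n. norm2 M (\<lambda>\<omega>. x n \<omega> + y n \<omega>)) \<longlonglongrightarrow> norm2 M (\<lambda>\<omega>. x' \<omega> + y' \<omega>)"
  proof (rule tendsto_norm2)
    show "(\<lambda>n. norm2 M (\<lambda>\<omega>. x n \<omega> + y n \<omega> - (x' \<omega> + y' \<omega>))) \<longlonglongrightarrow> 0"
    proof (rule tendsto_sandwich[OF _ _ tendsto_const lim0]; intro always_eventually allI)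
      fix n
      show "norm2 M (\<lambda>\<omega>. x n \<omega> + y n \<omega> - (x' \<omega> + y' \<omega>))
          \<le> norm2 M (\<lambda>\<omega>. x n \<omega> - x' \<omega>) + norm2 M (\<lambda>\<omega>. y n \<omega> - y' \<omega>)"
        using norm2_triangle[OF dx[of n] dy[of n]] by (simp add: algebra_simps)
    qed (simp add: norm2_nonneg)
  qed (use x y in \<open>auto intro: square_integrable_add\<close>)
  moreover have "(\<lambda>n. norm2 M (\<lambda>\<omega>. x n \<omega> - y n \<omega>)) \<longlonglongrightarrow> norm2 M (\<lambda>\<omega>. x' \<omega> - y' \<omega>)"
  proof (rule tendsto_norm2)
    show "(\<lambda>n. norm2 M (\<lambda>\<omega>. x n \<omega> - y n \<omega> - (x' \<omega> - y' \<omega>))) \<longlonglongrightarrow> 0"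
    proof (rule tendsto_sandwich[OF _ _ tendsto_const lim0]; intro always_eventually allI)
      fix n
      show "norm2 M (\<lambda>\<omega>. x n \<omega> - y n \<omega> - (x' \<omega> - y' \<omega>))
          \<le> norm2 M (\<lambda>\<omega>. x n \<omega> - x' \<omega>) + norm2 M (\<lambda>\<omega>. y n \<omega> - y' \<omega>)"
        using norm2_triangle[OF dx[of n] square_integrable_cmult[OF dy[of n], of "-1"]]
        unfolding norm2_cmult by (simp add: algebra_simps)
    qed (simp add: norm2_nonneg)
  qed (use x y in \<open>auto intro: square_integrable_diff\<close>)
  ultimately show ?thesis
    unfolding polar[OF x(1) y(1)] polar[OF x(2) y(2)] by (intro tendsto_intros) auto
qed

lemma inner_sum_sum:
  assumes "\<And>i. i \<in> I \<Longrightarrow> square_integrable M (x i)" "\<And>j. j \<in> J \<Longrightarrow> square_integrable M (y j)"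
  shows "(\<integral>\<omega>. (\<Sum>i\<in>I. c i * x i \<omega>) * (\<Sum>j\<in>J. d j * y j \<omega>) \<partial>M)
    = (\<Sum>i\<in>I. \<Sum>j\<in>J. c i * d j * (\<integral>\<omega>. x i \<omega> * y j \<omega> \<partial>M))"
proof -
  have "(\<integral>\<omega>. (\<Sum>i\<in>I. c i * x i \<omega>) * (\<Sum>j\<in>J. d j * y j \<omega>) \<partial>M)
      = (\<integral>\<omega>. (\<Sum>i\<in>I. \<Sum>j\<in>J. (c i * d j) * (x i \<omega> * y j \<omega>)) \<partial>M)"
    by (simp add: sum_product mult_ac)
  also have "\<dots> = (\<Sum>i\<in>I. \<Sum>j\<in>J. c i * d j * (\<integral>\<omega>. x i \<omega> * y j \<omega> \<partial>M))"
    using square_integrable_mult[OF assms] by (subst Bochner_Integration.integral_sum) auto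
  finally show ?thesis .
qed

lemma norm2_diff_square:
  assumes "square_integrable M x" "square_integrable M y"
  shows "(norm2 M (\<lambda>\<omega>. x \<omega> - y \<omega>))\<^sup>2
    = (\<integral>\<omega>. x \<omega> * x \<omega> \<partial>M) - 2 * (\<integral>\<omega>. x \<omega> * y \<omega> \<partial>M) + (\<integral>\<omega>. y \<omega> * y \<omega> \<partial>M)"
proof -
  note int = square_integrable_mult[OF assms] square_integrable_mult[OF assms(1,1)]
    square_integrable_mult[OF assms(2,2)]
  have "(norm2 M (\<lambda>\<omega>. x \<omega> - y \<omega>))\<^sup>2 = (\<integral>\<omega>. x \<omega> * x \<omega> - 2 * (x \<omega> * y \<omega>) + y \<omega> * y \<omega> \<partial>M)"
    unfolding norm2_square by (simp add: algebra_simps)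
  also have "\<dots> = (\<integral>\<omega>. x \<omega> * x \<omega> \<partial>M) - 2 * (\<integral>\<omega>. x \<omega> * y \<omega> \<partial>M) + (\<integral>\<omega>. y \<omega> * y \<omega> \<partial>M)"
    using int by simp
  finally show ?thesis .
qed

text \<open>Distances to linear combinations depend on scalar products only. This is what carries
  statements over between \<open>L\<^sub>2\<close> of the probability space and \<open>L\<^sub>2(\<mu>)\<close>.\<close>

lemma norm2_diff_combination:
  assumes z: "square_integrable M z" and x: "\<And>j. j \<in> J \<Longrightarrow> square_integrable M (x j)"
  shows "(norm2 M (\<lambda>\<omega>. z \<omega> - (\<Sum>j\<in>J. c j * x j \<omega>)))\<^sup>2
    = (\<integral>\<omega>. z \<omega> * z \<omega> \<partial>M) - 2 * (\<Sum>j\<in>J. c j * (\<integral>\<omega>. x j \<omega> * z \<omega> \<partial>M))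
      + (\<Sum>i\<in>J. \<Sum>j\<in>J. c i * c j * (\<integral>\<omega>. x i \<omega> * x j \<omega> \<partial>M))"
proof -
  have "(\<integral>\<omega>. z \<omega> * (\<Sum>j\<in>J. c j * x j \<omega>) \<partial>M) = (\<Sum>j\<in>J. c j * (\<integral>\<omega>. x j \<omega> * z \<omega> \<partial>M))"
    using inner_sum_sum[of "{()}" M "\<lambda>_. z" J x "\<lambda>_. 1" c] z x by (simp add: mult.commute)
  then show ?thesis
    using norm2_diff_square[OF z square_integrable_sum[of J M x c]] x
      inner_sum_sum[of J M x J x c c] by simp
qed

lemma ms_converges_iff:
  assumes S: "\<And>n. square_integrable M (S n)" and h: "h \<in> borel_measurable M"
  shows "ms_converges M S h \<longleftrightarrow>
    square_integrable M h \<and> (\<lambda>n. norm2 M (\<lambda>\<omega>. S n \<omega> - h \<omega>)) \<longlonglongrightarrow> 0"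
proof
  assume ms: "ms_converges M S h"
  then have "eventually (\<lambda>n. (\<integral>\<^sup>+x. ennreal ((S n x - h x)\<^sup>2) \<partial>M) < 1) sequentially"
    unfolding ms_converges_def by (rule order_tendstoD) simp
  then obtain n where "(\<integral>\<^sup>+x. ennreal ((S n x - h x)\<^sup>2) \<partial>M) < 1"
    using eventually_happens by force
  then have "(\<integral>\<^sup>+x. ennreal ((S n x - h x)\<^sup>2) \<partial>M) < \<infinity>"
    by (rule less_trans) simp
  moreover have [measurable]: "S n \<in> borel_measurable M" "h \<in> borel_measurable M"
    using square_integrable_borel[OF S] h by auto
  ultimately have "square_integrable M (\<lambda>x. S n x - h x)"
    unfolding square_integrable_def by (auto intro!: integrableI_nonneg)
  from square_integrable_diff[OF S[of n] this] have h2: "square_integrable M h" by simp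
  have "(\<lambda>n. ennreal ((norm2 M (\<lambda>\<omega>. S n \<omega> - h \<omega>))\<^sup>2)) \<longlonglongrightarrow> ennreal 0"
    using ms unfolding ms_converges_def nn_integral_square[OF square_integrable_diff[OF S h2]] by simp
  then have "(\<lambda>n. (norm2 M (\<lambda>\<omega>. S n \<omega> - h \<omega>))\<^sup>2) \<longlonglongrightarrow> 0"
    by (subst (asm) tendsto_ennreal_iff) auto
  then have "(\<lambda>n. sqrt ((norm2 M (\<lambda>\<omega>. S n \<omega> - h \<omega>))\<^sup>2)) \<longlonglongrightarrow> sqrt 0"
    by (rule tendsto_real_sqrt)
  then show "square_integrable M h \<and> (\<lambda>n. norm2 M (\<lambda>\<omega>. S n \<omega> - h \<omega>)) \<longlonglongrightarrow> 0"
    using h2 by (simp add: norm2_nonneg)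
next
  assume a: "square_integrable M h \<and> (\<lambda>n. norm2 M (\<lambda>\<omega>. S n \<omega> - h \<omega>)) \<longlonglongrightarrow> 0"
  then have "(\<lambda>n. ennreal ((norm2 M (\<lambda>\<omega>. S n \<omega> - h \<omega>))\<^sup>2)) \<longlonglongrightarrow> ennreal (0\<^sup>2)"
    by (intro tendsto_ennrealI tendsto_power) auto
  then show "ms_converges M S h"
    using a unfolding ms_converges_def by (simp add: nn_integral_square[OF square_integrable_diff[OF S]])
qed

lemma AE_summable:
  fixes d :: "nat \<Rightarrow> 'w \<Rightarrow> real"
  assumes d: "\<And>n. d n \<in> borel_measurable M" "\<And>n \<omega>. 0 \<le> d n \<omega>"
    and le: "\<And>n. (\<integral>\<^sup>+\<omega>. ennreal (d n \<omega>) \<partial>M) \<le> ennreal (c n)"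
    and c: "summable c" "\<And>n. 0 \<le> c n"
  shows "AE \<omega> in M. summable (\<lambda>n. d n \<omega>)"
proof -
  have "(\<integral>\<^sup>+\<omega>. (\<Sum>n. ennreal (d n \<omega>)) \<partial>M) = (\<Sum>n. \<integral>\<^sup>+\<omega>. ennreal (d n \<omega>) \<partial>M)"
    using d by (intro nn_integral_suminf) auto
  also have "\<dots> \<le> (\<Sum>n. ennreal (c n))" by (intro suminf_le le) auto
  also have "\<dots> = ennreal (suminf c)" using c by (intro suminf_ennreal2) auto
  also have "\<dots> < \<infinity>" by simp
  finally have "AE \<omega> in M. (\<Sum>n. ennreal (d n \<omega>)) \<noteq> \<infinity>"
    using d by (intro nn_integral_noteq_infinite) auto
  then show ?thesis
    by eventually_elim (use d(2) in \<open>auto intro: summable_suminf_not_top\<close>)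
qed

lemma AE_tendsto_0:
  assumes d: "\<And>n. square_integrable M (d n)" and "summable (\<lambda>n. (norm2 M (d n))\<^sup>2)"
  shows "AE \<omega> in M. (\<lambda>n. d n \<omega>) \<longlonglongrightarrow> 0"
proof -
  have "AE \<omega> in M. summable (\<lambda>n. (d n \<omega>)\<^sup>2)"
    using assms by (intro AE_summable[where c = "\<lambda>n. (norm2 M (d n))\<^sup>2"])
      (auto simp: nn_integral_square[OF d] intro: borel_measurable_power square_integrable_borel)
  then show ?thesis
  proof eventually_elim
    case (elim \<omega>)
    have "(\<lambda>n. sqrt ((d n \<omega>)\<^sup>2)) \<longlonglongrightarrow> sqrt 0"
      by (intro tendsto_real_sqrt summable_LIMSEQ_zero elim)
    then show ?case by (simp add: tendsto_rabs_zero_iff)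
  qed
qed

text \<open>Along a subsequence whose increments \<open>d\<^sub>k\<close> have norm at most
  \<open>2\<^sup>-\<^sup>k\<close>, the bound \<open>\<bar>d\<^sub>k\<bar> \<le> 2\<^sup>-\<^sup>k + 2\<^sup>k d\<^sub>k\<^sup>2\<close> gives convergence almost everywhere
  on an arbitrary measure space; the limit is a limit in \<open>L\<^sub>2\<close> by Fatou's lemma.\<close>

lemma L2_complete:
  assumes S: "\<And>n. square_integrable M (S n)"
    and cauchy: "\<And>e. 0 < e \<Longrightarrow>
      \<exists>N. \<forall>m\<ge>N. \<forall>n\<ge>N. norm2 M (\<lambda>\<omega>. S m \<omega> - S n \<omega>) < e"
  shows "\<exists>h. square_integrable M h \<and> (\<lambda>n. norm2 M (\<lambda>\<omega>. S n \<omega> - h \<omega>)) \<longlonglongrightarrow> 0"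
proof -
  note [measurable] = square_integrable_borel[OF S]
  have "\<exists>N. \<forall>m\<ge>N. \<forall>n\<ge>N. norm2 M (\<lambda>\<omega>. S m \<omega> - S n \<omega>) < (1/2)^k" for k :: nat
    by (rule cauchy) simp
  then obtain N where N: "\<And>k m n. N k \<le> m \<Longrightarrow> N k \<le> n \<Longrightarrow>
      norm2 M (\<lambda>\<omega>. S m \<omega> - S n \<omega>) < (1/2)^k" by metis
  define r where "r k = k + (\<Sum>i\<le>k. N i)" for k
  have rN: "N k \<le> r k" "N k \<le> r (Suc k)" "k \<le> r k" for k
    using member_le_sum[of k "{..k}" N] by (auto simp: r_def)
  define d where "d k \<omega> = S (r (Suc k)) \<omega> - S (r k) \<omega>" for k \<omega>
  have d: "square_integrable M (d k)" for k
    unfolding d_def[abs_def] by (intro square_integrable_diff S)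
  note [measurable] = square_integrable_borel[OF d]
  have "AE \<omega> in M. summable (\<lambda>k. 2^k * (d k \<omega>)\<^sup>2)"
  proof (rule AE_summable)
    fix k
    have "(norm2 M (d k))\<^sup>2 \<le> ((1/2)^k)\<^sup>2"
      unfolding d_def[abs_def] using N[of k "r (Suc k)" "r k"] rN[of k]
      by (intro power_mono norm2_nonneg) auto
    then have "2^k * (norm2 M (d k))\<^sup>2 \<le> 2^k * ((1/2)^k)\<^sup>2" by (intro mult_left_mono) auto
    also have "\<dots> = (1/2)^k" by (simp add: power_divide power2_eq_square)
    finally have "2^k * (norm2 M (d k))\<^sup>2 \<le> (1/2)^k" .
    moreover have "(\<integral>\<^sup>+\<omega>. ennreal (2^k * (d k \<omega>)\<^sup>2) \<partial>M) = ennreal (2^k * (norm2 M (d k))\<^sup>2)"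
      by (simp add: ennreal_mult' nn_integral_cmult nn_integral_square[OF d])
    ultimately show "(\<integral>\<^sup>+\<omega>. ennreal (2^k * (d k \<omega>)\<^sup>2) \<partial>M) \<le> ennreal ((1/2)^k)"
      by (simp add: ennreal_leI)
  qed (auto simp: summable_geometric)
  then have conv: "AE \<omega> in M. convergent (\<lambda>k. S (r k) \<omega>)"
  proof eventually_elim
    case (elim \<omega>)
    have "summable (\<lambda>k. (1/2)^k + 2^k * (d k \<omega>)\<^sup>2)"
      by (intro summable_add elim) (simp add: summable_geometric)
    then have "summable (\<lambda>k. d k \<omega>)"
    proof (rule summable_comparison_test'[where N = 0])
      fix k :: nat
      have "2 * \<bar>d k \<omega>\<bar> * 2^k \<le> 1 + (2^k * \<bar>d k \<omega>\<bar>)\<^sup>2"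
        using sum_squares_bound[of 1 "2^k * \<bar>d k \<omega>\<bar>"] by (simp add: mult_ac)
      also have "\<dots> = 2^k * ((1/2)^k + 2^k * (d k \<omega>)\<^sup>2)"
        by (simp add: power_mult_distrib power2_eq_square algebra_simps power_divide)
      finally have "2 * \<bar>d k \<omega>\<bar> \<le> (1/2)^k + 2^k * (d k \<omega>)\<^sup>2"
        by (simp add: mult.commute)
      then show "norm (d k \<omega>) \<le> (1/2)^k + 2^k * (d k \<omega>)\<^sup>2" by simp
    qed
    then have "convergent (\<lambda>n. \<Sum>k<n. d k \<omega>)" by (simp add: summable_iff_convergent)
    moreover have "(\<Sum>k<n. d k \<omega>) = S (r n) \<omega> - S (r 0) \<omega>" for n
      unfolding d_def by (rule sum_lessThan_telescope)
    ultimately have "convergent (\<lambda>n. (S (r n) \<omega> - S (r 0) \<omega>) + S (r 0) \<omega>)"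
      by (intro convergent_add convergent_const) simp
    then show ?case by simp
  qed
  define h where "h \<omega> = lim (\<lambda>k. S (r k) \<omega>)" for \<omega>
  have h[measurable]: "h \<in> borel_measurable M"
    unfolding h_def[abs_def] by measurable
  have lim: "AE \<omega> in M. (\<lambda>k. S (r k) \<omega>) \<longlonglongrightarrow> h \<omega>"
    using conv by eventually_elim (simp add: h_def convergent_LIMSEQ_iff)
  have bound: "(\<integral>\<^sup>+\<omega>. ennreal ((S m \<omega> - h \<omega>)\<^sup>2) \<partial>M) \<le> ennreal (((1/2)^k)\<^sup>2)" if "N k \<le> m" for m k
  proof -
    have eq: "AE \<omega> in M. ennreal ((S m \<omega> - h \<omega>)\<^sup>2) = liminf (\<lambda>n. ennreal ((S m \<omega> - S (r n) \<omega>)\<^sup>2))"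
      using lim
    proof eventually_elim
      case (elim \<omega>)
      have "(\<lambda>n. ennreal ((S m \<omega> - S (r n) \<omega>)\<^sup>2)) \<longlonglongrightarrow> ennreal ((S m \<omega> - h \<omega>)\<^sup>2)"
        by (intro tendsto_ennrealI tendsto_intros elim)
      then show ?case by (rule lim_imp_Liminf[OF sequentially_bot, symmetric])
    qed
    have "(\<integral>\<^sup>+\<omega>. ennreal ((S m \<omega> - h \<omega>)\<^sup>2) \<partial>M)
        = (\<integral>\<^sup>+\<omega>. liminf (\<lambda>n. ennreal ((S m \<omega> - S (r n) \<omega>)\<^sup>2)) \<partial>M)"
      by (rule nn_integral_cong_AE[OF eq])
    also have "\<dots> \<le> liminf (\<lambda>n. \<integral>\<^sup>+\<omega>. ennreal ((S m \<omega> - S (r n) \<omega>)\<^sup>2) \<partial>M)"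
      by (rule nn_integral_liminf) simp
    also have "\<dots> \<le> liminf (\<lambda>n. ennreal (((1/2)^k)\<^sup>2))"
    proof (rule Liminf_mono, rule eventually_sequentiallyI)
      fix n assume "N k \<le> n"
      then have "N k \<le> r n" using rN(3)[of n] by simp
      then show "(\<integral>\<^sup>+\<omega>. ennreal ((S m \<omega> - S (r n) \<omega>)\<^sup>2) \<partial>M) \<le> ennreal (((1/2)^k)\<^sup>2)"
        unfolding nn_integral_square[OF square_integrable_diff[OF S S]]
        using N[OF that, of "r n"] by (intro ennreal_leI power_mono norm2_nonneg) auto
    qed
    finally show ?thesis by (simp add: Liminf_const)
  qed
  have "ms_converges M S h"
    unfolding ms_converges_def
  proof (rule tendsto_0_if_Limsup_eq_0_ennreal, rule antisym)
    show "limsup (\<lambda>n. \<integral>\<^sup>+\<omega>. ennreal ((S n \<omega> - h \<omega>)\<^sup>2) \<partial>M) \<le> 0"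
    proof (rule tendsto_lowerbound)
      have "(\<lambda>k. ((1/2)^k)\<^sup>2) \<longlonglongrightarrow> (0::real)\<^sup>2"
        by (intro tendsto_power LIMSEQ_power_zero) simp
      then show "(\<lambda>k. ennreal (((1/2)^k)\<^sup>2)) \<longlonglongrightarrow> 0"
        using tendsto_ennrealI by fastforce
      show "\<forall>\<^sub>F k in sequentially. limsup (\<lambda>n. \<integral>\<^sup>+\<omega>. ennreal ((S n \<omega> - h \<omega>)\<^sup>2) \<partial>M)
          \<le> ennreal (((1/2)^k)\<^sup>2)"
      proof (intro always_eventually allI)
        fix k
        show "limsup (\<lambda>n. \<integral>\<^sup>+\<omega>. ennreal ((S n \<omega> - h \<omega>)\<^sup>2) \<partial>M) \<le> ennreal (((1/2)^k)\<^sup>2)"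
          by (intro Limsup_bounded eventually_sequentiallyI[of "N k"] bound)
      qed
    qed simp
  qed simp
  then show ?thesis
    unfolding ms_converges_iff[OF S h] by (rule exI[of _ h])
qed

section \<open>Closed linear spans in \<open>L\<^sub>2\<close>\<close>

definition l2_closed_span :: "'a measure \<Rightarrow> 'i set \<Rightarrow> ('i \<Rightarrow> 'a \<Rightarrow> real) \<Rightarrow> ('a \<Rightarrow> real) set" where
  "l2_closed_span M I h = {\<eta>. square_integrable M \<eta> \<and>
     (\<forall>\<epsilon>>0. \<exists>J c. finite J \<and> J \<subseteq> I \<and>
        norm2 M (\<lambda>\<omega>. \<eta> \<omega> - (\<Sum>j\<in>J. c j * h j \<omega>)) < \<epsilon>)}"

lemma complete_systemD:
  "complete_system M I h \<Longrightarrow> square_integrable M \<phi> \<Longrightarrow> \<phi> \<in> l2_closed_span M I h"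
  by (simp add: complete_system_def l2_closed_span_def)

lemma l2_closed_span_square_integrable: "\<eta> \<in> l2_closed_span M I h \<Longrightarrow> square_integrable M \<eta>"
  by (simp add: l2_closed_span_def)

lemma l2_closed_span_approx:
  assumes "\<eta> \<in> l2_closed_span M I h" "0 < \<epsilon>"
  obtains J c where "finite J" "J \<subseteq> I" "norm2 M (\<lambda>\<omega>. \<eta> \<omega> - (\<Sum>j\<in>J. c j * h j \<omega>)) < \<epsilon>"
  using assms unfolding l2_closed_span_def by blast

lemma l2_closed_span_sequence:
  assumes x: "x \<in> l2_closed_span M I h"
  obtains J c where "\<And>n. finite (J n)" "\<And>n. J n \<subseteq> I"
    "(\<lambda>n. norm2 M (\<lambda>\<omega>. (\<Sum>j\<in>J n. c n j * h j \<omega>) - x \<omega>)) \<longlonglongrightarrow> 0"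
proof -
  have "\<exists>J c. finite J \<and> J \<subseteq> I \<and> norm2 M (\<lambda>\<omega>. x \<omega> - (\<Sum>j\<in>J. c j * h j \<omega>)) < (1/2)^n" for n :: nat
    by (rule l2_closed_span_approx[OF x, of "(1/2)^n"]) auto
  then obtain J c where J: "\<And>n. finite (J n)" "\<And>n. J n \<subseteq> I"
    and le: "\<And>n :: nat. norm2 M (\<lambda>\<omega>. x \<omega> - (\<Sum>j\<in>J n. c n j * h j \<omega>)) < (1/2)^n"
    by metis
  have "(\<lambda>n. norm2 M (\<lambda>\<omega>. (\<Sum>j\<in>J n. c n j * h j \<omega>) - x \<omega>)) \<longlonglongrightarrow> 0"
  proof (rule Lim_null_comparison)
    show "(\<lambda>n. (1/2)^n) \<longlonglongrightarrow> (0::real)" by (intro LIMSEQ_power_zero) simp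
    show "\<forall>\<^sub>F n in sequentially. norm (norm2 M (\<lambda>\<omega>. (\<Sum>j\<in>J n. c n j * h j \<omega>) - x \<omega>)) \<le> (1/2)^n"
    proof (intro always_eventually allI)
      fix n
      show "norm (norm2 M (\<lambda>\<omega>. (\<Sum>j\<in>J n. c n j * h j \<omega>) - x \<omega>)) \<le> (1/2)^n"
        using le[of n] norm2_minus_commute[of M x "\<lambda>\<omega>. \<Sum>j\<in>J n. c n j * h j \<omega>"]
        by (simp add: norm2_nonneg)
    qed
  qed
  with J show thesis by (rule that)
qed

context
  fixes M :: "'a measure" and I :: "'i set" and h :: "'i \<Rightarrow> 'a \<Rightarrow> real"
  assumes h: "\<And>i. i \<in> I \<Longrightarrow> square_integrable M (h i)"
begin

lemma l2_closed_span_combination: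
  assumes "finite J" "J \<subseteq> I"
  shows "(\<lambda>\<omega>. \<Sum>j\<in>J. c j * h j \<omega>) \<in> l2_closed_span M I h"
proof -
  have "norm2 M (\<lambda>\<omega>. (\<Sum>j\<in>J. c j * h j \<omega>) - (\<Sum>j\<in>J. c j * h j \<omega>)) = 0"
    by (simp add: norm2_def)
  then show ?thesis
    using assms h unfolding l2_closed_span_def
    by (auto intro!: square_integrable_sum exI[of _ J] exI[of _ c])
qed

lemma l2_closed_span_base:
  assumes "i \<in> I"
  shows "h i \<in> l2_closed_span M I h"
  using l2_closed_span_combination[of "{i}" "\<lambda>_. 1"] assms by simp

lemma l2_closed_span_cmult:
  assumes x: "x \<in> l2_closed_span M I h"
  shows "(\<lambda>\<omega>. a * x \<omega>) \<in> l2_closed_span M I h"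
  unfolding l2_closed_span_def
proof (intro CollectI conjI allI impI)
  show "square_integrable M (\<lambda>\<omega>. a * x \<omega>)"
    by (intro square_integrable_cmult l2_closed_span_square_integrable[OF x])
  fix \<epsilon> :: real assume "0 < \<epsilon>"
  then have "0 < \<epsilon> / (\<bar>a\<bar> + 1)" by simp
  from l2_closed_span_approx[OF x this] obtain J c where J: "finite J" "J \<subseteq> I"
    and le: "norm2 M (\<lambda>\<omega>. x \<omega> - (\<Sum>j\<in>J. c j * h j \<omega>)) < \<epsilon> / (\<bar>a\<bar> + 1)" .
  have "norm2 M (\<lambda>\<omega>. a * x \<omega> - (\<Sum>j\<in>J. (a * c j) * h j \<omega>))
      = \<bar>a\<bar> * norm2 M (\<lambda>\<omega>. x \<omega> - (\<Sum>j\<in>J. c j * h j \<omega>))"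
    unfolding norm2_cmult[symmetric] by (simp add: right_diff_distrib sum_distrib_left mult.assoc)
  also have "\<dots> \<le> (\<bar>a\<bar> + 1) * norm2 M (\<lambda>\<omega>. x \<omega> - (\<Sum>j\<in>J. c j * h j \<omega>))"
    by (intro mult_right_mono norm2_nonneg) auto
  also have "\<dots> < \<epsilon>" using le by (simp add: field_simps)
  finally show "\<exists>J c. finite J \<and> J \<subseteq> I \<and> norm2 M (\<lambda>\<omega>. a * x \<omega> - (\<Sum>j\<in>J. c j * h j \<omega>)) < \<epsilon>"
    using J by (intro exI[of _ J] exI[of _ "\<lambda>j. a * c j"]) auto
qed

lemma l2_closed_span_add:
  assumes x: "x \<in> l2_closed_span M I h" and y: "y \<in> l2_closed_span M I h"
  shows "(\<lambda>\<omega>. x \<omega> + y \<omega>) \<in> l2_closed_span M I h"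
  unfolding l2_closed_span_def
proof (intro CollectI conjI allI impI)
  note sx = l2_closed_span_square_integrable[OF x] and sy = l2_closed_span_square_integrable[OF y]
  show "square_integrable M (\<lambda>\<omega>. x \<omega> + y \<omega>)"
    by (intro square_integrable_add sx sy)
  fix \<epsilon> :: real assume "0 < \<epsilon>"
  then have e: "0 < \<epsilon> / 2" by simp
  from l2_closed_span_approx[OF x e] obtain J c where J: "finite J" "J \<subseteq> I"
    and leJ: "norm2 M (\<lambda>\<omega>. x \<omega> - (\<Sum>j\<in>J. c j * h j \<omega>)) < \<epsilon> / 2" .
  from l2_closed_span_approx[OF y e] obtain K d where K: "finite K" "K \<subseteq> I"
    and leK: "norm2 M (\<lambda>\<omega>. y \<omega> - (\<Sum>j\<in>K. d j * h j \<omega>)) < \<epsilon> / 2" .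
  define b where "b j = (if j \<in> J then c j else 0) + (if j \<in> K then d j else 0)" for j
  have sum_eq: "(\<Sum>j\<in>J \<union> K. b j * h j \<omega>)
      = (\<Sum>j\<in>J. c j * h j \<omega>) + (\<Sum>j\<in>K. d j * h j \<omega>)" for \<omega>
  proof -
    have "(\<Sum>j\<in>J. c j * h j \<omega>) = (\<Sum>j\<in>J \<union> K. (if j \<in> J then c j else 0) * h j \<omega>)"
      using J K by (intro sum.mono_neutral_cong_left) auto
    moreover have "(\<Sum>j\<in>K. d j * h j \<omega>) = (\<Sum>j\<in>J \<union> K. (if j \<in> K then d j else 0) * h j \<omega>)"
      using J K by (intro sum.mono_neutral_cong_left) auto
    ultimately show ?thesis
      unfolding b_def distrib_right sum.distrib by simp
  qed
  have "norm2 M (\<lambda>\<omega>. (x \<omega> - (\<Sum>j\<in>J. c j * h j \<omega>)) + (y \<omega> - (\<Sum>j\<in>K. d j * h j \<omega>)))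
      \<le> norm2 M (\<lambda>\<omega>. x \<omega> - (\<Sum>j\<in>J. c j * h j \<omega>)) + norm2 M (\<lambda>\<omega>. y \<omega> - (\<Sum>j\<in>K. d j * h j \<omega>))"
    using J K h by (intro norm2_triangle square_integrable_diff sx sy square_integrable_sum) auto
  then have "norm2 M (\<lambda>\<omega>. x \<omega> + y \<omega> - (\<Sum>j\<in>J \<union> K. b j * h j \<omega>)) < \<epsilon>"
    using leJ leK unfolding sum_eq by (simp add: algebra_simps)
  then show "\<exists>J c. finite J \<and> J \<subseteq> I \<and> norm2 M (\<lambda>\<omega>. x \<omega> + y \<omega> - (\<Sum>j\<in>J. c j * h j \<omega>)) < \<epsilon>"
    using J K by (intro exI[of _ "J \<union> K"] exI[of _ b]) auto
qed

lemma l2_closed_span_diff: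
  assumes x: "x \<in> l2_closed_span M I h" and y: "y \<in> l2_closed_span M I h"
  shows "(\<lambda>\<omega>. x \<omega> - y \<omega>) \<in> l2_closed_span M I h"
  using l2_closed_span_add[OF x l2_closed_span_cmult[OF y, of "-1"]] by simp

lemma l2_closed_span_sum:
  assumes "\<And>k. k \<in> K \<Longrightarrow> x k \<in> l2_closed_span M I h"
  shows "(\<lambda>\<omega>. \<Sum>k\<in>K. c k * x k \<omega>) \<in> l2_closed_span M I h"
proof -
  have zero: "(\<lambda>\<omega>. 0) \<in> l2_closed_span M I h"
    using l2_closed_span_combination[of "{}"] by simp
  show ?thesis
    using assms by (induction K rule: infinite_finite_induct)
      (auto simp: zero intro!: l2_closed_span_add l2_closed_span_cmult)
qed

lemma l2_closed_span_mean_zero: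
  assumes "prob_space M" and mean: "\<And>i. i \<in> I \<Longrightarrow> (\<integral>\<omega>. h i \<omega> \<partial>M) = 0"
    and x: "x \<in> l2_closed_span M I h"
  shows "(\<integral>\<omega>. x \<omega> \<partial>M) = 0"
proof -
  interpret prob_space M by fact
  have one: "square_integrable M (\<lambda>_. 1)" by (simp add: square_integrable_def)
  obtain J c where J: "\<And>n. finite (J n)" "\<And>n. J n \<subseteq> I"
    and lim: "(\<lambda>n. norm2 M (\<lambda>\<omega>. (\<Sum>j\<in>J n. c n j * h j \<omega>) - x \<omega>)) \<longlonglongrightarrow> 0"
    by (rule l2_closed_span_sequence[OF x]) blast
  have S: "square_integrable M (\<lambda>\<omega>. \<Sum>j\<in>J n. c n j * h j \<omega>)" for n
    using J h by (intro square_integrable_sum) auto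
  from tendsto_inner[OF S l2_closed_span_square_integrable[OF x] one one lim]
  have "(\<lambda>n. \<integral>\<omega>. (\<Sum>j\<in>J n. c n j * h j \<omega>) * 1 \<partial>M) \<longlonglongrightarrow> (\<integral>\<omega>. x \<omega> * 1 \<partial>M)"
    by (simp add: norm2_def)
  moreover have "(\<integral>\<omega>. (\<Sum>j\<in>J n. c n j * h j \<omega>) * 1 \<partial>M) = 0" for n
  proof -
    have "integrable M (h j)" if "j \<in> J n" for j
      using square_integrable_mult[OF h one, of j] J that by auto
    then show ?thesis
      using mean J by (subst Bochner_Integration.integral_sum[symmetric] | simp add: subset_iff)+
  qed
  ultimately have "(\<lambda>n. 0) \<longlonglongrightarrow> (\<integral>\<omega>. x \<omega> \<partial>M)" by simp
  then show ?thesis using LIMSEQ_unique tendsto_const by blast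
qed

end

section \<open>Strictly \<open>F\<^sub>\<psi>\<close> families\<close>

text \<open>An estimate \<open>\<parallel>S\<^sub>n\<parallel>\<^sub>\<psi> \<le> C \<parallel>S\<^sub>n\<parallel>\<^sub>2\<close> survives mean-square limits, because a subsequence
  converges almost surely. It therefore suffices to have it for finite linear combinations.\<close>

lemma ms_limit_psi_bounded:
  assumes S: "\<And>n. square_integrable M (S n)"
    and b: "\<And>n. psi_bounded M \<psi> (C * norm2 M (S n)) (S n)"
    and \<eta>: "\<eta> \<in> borel_measurable M" and lim: "ms_converges M S \<eta>"
    and \<psi>: "\<And>u. 1 \<le> u \<Longrightarrow> 0 < \<psi> u"
  shows "psi_bounded M \<psi> (C * norm2 M \<eta>) \<eta>"
proof -
  have \<eta>2: "square_integrable M \<eta>" and lim2: "(\<lambda>n. norm2 M (\<lambda>\<omega>. S n \<omega> - \<eta> \<omega>)) \<longlonglongrightarrow> 0"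
    using lim ms_converges_iff[OF S \<eta>] by auto
  have "\<exists>n. norm2 M (\<lambda>\<omega>. S n \<omega> - \<eta> \<omega>) < (1/2)^k" for k :: nat
    using order_tendstoD(2)[OF lim2, of "(1/2)^k"] eventually_happens by force
  then obtain r where r: "\<And>k :: nat. norm2 M (\<lambda>\<omega>. S (r k) \<omega> - \<eta> \<omega>) < (1/2)^k" by metis
  have d: "square_integrable M (\<lambda>\<omega>. S (r k) \<omega> - \<eta> \<omega>)" for k
    by (intro square_integrable_diff S \<eta>2)
  have half: "(\<lambda>k. (1/2)^k) \<longlonglongrightarrow> (0::real)" by (intro LIMSEQ_power_zero) simp
  have "AE \<omega> in M. (\<lambda>k. S (r k) \<omega> - \<eta> \<omega>) \<longlonglongrightarrow> 0"
  proof (rule AE_tendsto_0[OF d])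
    show "summable (\<lambda>k. (norm2 M (\<lambda>\<omega>. S (r k) \<omega> - \<eta> \<omega>))\<^sup>2)"
    proof (rule summable_comparison_test'[where N = 0])
      show "summable (\<lambda>k. (1/4 :: real)^k)" by (intro summable_geometric) simp
      fix k :: nat
      have "(norm2 M (\<lambda>\<omega>. S (r k) \<omega> - \<eta> \<omega>))\<^sup>2 \<le> ((1/2)^k)\<^sup>2"
        using r[of k] by (intro power_mono norm2_nonneg) auto
      also have "\<dots> = (1/4)^k" by (simp add: power2_eq_square power_mult_distrib[symmetric])
      finally show "norm ((norm2 M (\<lambda>\<omega>. S (r k) \<omega> - \<eta> \<omega>))\<^sup>2) \<le> (1/4)^k" by simp
    qed
  qed
  then have ae: "AE \<omega> in M. (\<lambda>k. S (r k) \<omega>) \<longlonglongrightarrow> \<eta> \<omega>"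
    by eventually_elim (simp add: LIM_zero_iff)
  have "(\<lambda>k. norm2 M (\<lambda>\<omega>. S (r k) \<omega> - \<eta> \<omega>)) \<longlonglongrightarrow> 0"
    by (rule Lim_null_comparison[OF _ half])
      (use r in \<open>auto simp: norm2_nonneg less_imp_le intro!: always_eventually\<close>)
  from tendsto_norm2[OF S \<eta>2 this]
  have "(\<lambda>k. C * norm2 M (S (r k))) \<longlonglongrightarrow> C * norm2 M \<eta>" by (intro tendsto_intros)
  then show ?thesis by (intro psi_bounded_AE_limit[OF b ae _ \<eta> \<psi>])
qed

lemma strictly_F_psiI:
  assumes "0 < C" and mean: "\<And>\<xi>. \<xi> \<in> \<Delta> \<Longrightarrow> (\<integral>\<omega>. \<xi> \<omega> \<partial>M) = 0"
    and \<Delta>: "\<And>\<xi>. \<xi> \<in> \<Delta> \<Longrightarrow> square_integrable M \<xi> \<and> \<xi> \<in> F_psi M \<psi>"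
    and fin: "\<And>n c (\<xi> :: nat \<Rightarrow> _). (\<And>i. \<xi> i \<in> \<Delta>) \<Longrightarrow>
      psi_bounded M \<psi> (C * norm2 M (\<lambda>\<omega>. \<Sum>i<n. c i * \<xi> i \<omega>)) (\<lambda>\<omega>. \<Sum>i<n. c i * \<xi> i \<omega>)"
    and \<psi>: "\<And>u. 1 \<le> u \<Longrightarrow> 0 < \<psi> u"
  shows "strictly_F_psi M \<psi> \<Delta> C"
  unfolding strictly_F_psi_def
proof (intro conjI allI impI ballI)
  fix \<xi> :: "nat \<Rightarrow> 'a \<Rightarrow> real" and c \<eta>
  assume a: "(\<forall>i. \<xi> i \<in> \<Delta>) \<and> \<eta> \<in> borel_measurable M \<and>
    ms_converges M (\<lambda>n \<omega>. \<Sum>i<n. c i * \<xi> i \<omega>) \<eta>"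
  have "square_integrable M (\<lambda>\<omega>. \<Sum>i<n. c i * \<xi> i \<omega>)" for n
    using a \<Delta> by (intro square_integrable_sum) blast
  moreover have "psi_bounded M \<psi> (C * norm2 M (\<lambda>\<omega>. \<Sum>i<n. c i * \<xi> i \<omega>))
      (\<lambda>\<omega>. \<Sum>i<n. c i * \<xi> i \<omega>)" for n
    using a by (intro fin) blast
  ultimately have "psi_bounded M \<psi> (C * norm2 M \<eta>) \<eta>"
    using a \<psi> by - (rule ms_limit_psi_bounded[where S = "\<lambda>n \<omega>. \<Sum>i<n. c i * \<xi> i \<omega>"], blast+)
  then show "\<eta> \<in> F_psi M \<psi>" and "psi_norm M \<psi> \<eta> \<le> C * norm2 M \<eta>"
    using psi_bounded_iff[of \<psi> M, OF \<psi>] by auto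
qed (use assms in auto)

locale strictly_F_psi_process = prob_space M for M :: "'w measure" +
  fixes \<psi> :: "real \<Rightarrow> real" and T :: "'t set" and X :: "'t \<Rightarrow> 'w \<Rightarrow> real" and C :: real
  assumes psi: "psi_function \<psi>"
    and strict: "strictly_F_psi M \<psi> (X ` T) C"
    and X: "\<And>t. t \<in> T \<Longrightarrow> square_integrable M (X t)"
    and nonempty: "T \<noteq> {}"
begin

lemma psi_pos: "1 \<le> u \<Longrightarrow> 0 < \<psi> u"
  using psi by (simp add: psi_function_def)

lemma C_pos: "0 < C"
  using strict by (simp add: strictly_F_psi_def)

abbreviation H :: "('w \<Rightarrow> real) set" where
  "H \<equiv> l2_closed_span M T X"

lemma psi_bounded_combination:
  assumes J: "finite J" "J \<subseteq> T"
  shows "psi_bounded M \<psi> (C * norm2 M (\<lambda>\<omega>. \<Sum>j\<in>J. c j * X j \<omega>)) (\<lambda>\<omega>. \<Sum>j\<in>J. c j * X j \<omega>)"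
    (is "psi_bounded M \<psi> (C * norm2 M ?S) ?S")
proof -
  obtain t0 where t0: "t0 \<in> T" using nonempty by blast
  obtain e where e: "bij_betw e {..<card J} J"
    using ex_bij_betw_nat_finite[OF J(1)] by (auto simp: lessThan_atLeast0)
  \<comment> \<open>The finite sum as a series: beyond \<open>card J\<close> all coefficients vanish.\<close>
  define x where "x i = (if i < card J then X (e i) else X t0)" for i
  define d where "d i = (if i < card J then c (e i) else 0)" for i
  have x: "x i \<in> X ` T" for i
    using e J(2) t0 by (auto simp: x_def bij_betw_def)
  have sum_eq: "(\<Sum>i<n. d i * x i \<omega>) = ?S \<omega>" if "card J \<le> n" for n \<omega>
  proof -
    have "(\<Sum>i<n. d i * x i \<omega>) = (\<Sum>i<card J. c (e i) * X (e i) \<omega>)"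
      using that by (intro sum.mono_neutral_cong_right) (auto simp: d_def x_def)
    also have "\<dots> = ?S \<omega>"
      by (rule sum.reindex_bij_betw[OF e, of "\<lambda>j. c j * X j \<omega>"])
    finally show ?thesis .
  qed
  have "square_integrable M ?S" using X J by (intro square_integrable_sum) auto
  moreover have "ms_converges M (\<lambda>n \<omega>. \<Sum>i<n. d i * x i \<omega>) ?S"
    unfolding ms_converges_def
    by (rule tendsto_eventually, rule eventually_sequentiallyI[of "card J"]) (simp add: sum_eq)
  ultimately have "?S \<in> F_psi M \<psi> \<and> psi_norm M \<psi> ?S \<le> C * norm2 M ?S"
    using x square_integrable_borel strict[unfolded strictly_F_psi_def, THEN conjunct2,
      THEN conjunct2, THEN spec[of _ x], THEN spec[of _ d], THEN spec[of _ ?S]] by auto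
  then show ?thesis
    using psi_bounded_iff[of \<psi> M, OF psi_pos] by simp
qed

lemma H_psi_bounded:
  assumes \<eta>: "\<eta> \<in> H"
  shows "psi_bounded M \<psi> (C * norm2 M \<eta>) \<eta>"
proof -
  obtain J c where J: "\<And>n. finite (J n)" "\<And>n. J n \<subseteq> T"
    and lim: "(\<lambda>n. norm2 M (\<lambda>\<omega>. (\<Sum>j\<in>J n. c n j * X j \<omega>) - \<eta> \<omega>)) \<longlonglongrightarrow> 0"
    by (rule l2_closed_span_sequence[OF \<eta>]) blast
  have S: "square_integrable M (\<lambda>\<omega>. \<Sum>j\<in>J n. c n j * X j \<omega>)" for n
    using J X by (intro square_integrable_sum) auto
  have \<eta>2: "square_integrable M \<eta>" by (rule l2_closed_span_square_integrable[OF \<eta>])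
  have "ms_converges M (\<lambda>n \<omega>. \<Sum>j\<in>J n. c n j * X j \<omega>) \<eta>"
    using ms_converges_iff[OF S square_integrable_borel[OF \<eta>2]] \<eta>2 lim by simp
  then show ?thesis
    using J by (intro ms_limit_psi_bounded[OF S psi_bounded_combination] psi_pos
      square_integrable_borel[OF \<eta>2]) auto
qed

lemma H_F_psi: "\<eta> \<in> H \<Longrightarrow> \<eta> \<in> F_psi M \<psi>"
  and H_psi_norm: "\<eta> \<in> H \<Longrightarrow> psi_norm M \<psi> \<eta> \<le> C * norm2 M \<eta>"
  using H_psi_bounded psi_bounded_iff[of \<psi> M, OF psi_pos] by auto

lemma H_subset_SF_space: "H \<subseteq> SF_space M \<psi> (X ` T)"
proof
  fix \<eta> assume \<eta>: "\<eta> \<in> H"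
  have "\<exists>J c. finite J \<and> J \<subseteq> X ` T \<and> psi_norm M \<psi> (\<lambda>\<omega>. \<eta> \<omega> - (\<Sum>\<zeta>\<in>J. c \<zeta> * \<zeta> \<omega>)) < \<epsilon>"
    if "0 < \<epsilon>" for \<epsilon>
  proof -
    from that C_pos have "0 < \<epsilon> / C" by simp
    from l2_closed_span_approx[OF \<eta> this] obtain J c where J: "finite J" "J \<subseteq> T"
      and le: "norm2 M (\<lambda>\<omega>. \<eta> \<omega> - (\<Sum>j\<in>J. c j * X j \<omega>)) < \<epsilon> / C" .
    \<comment> \<open>Different parameters may give the same variable; their coefficients are added.\<close>
    define d where "d \<zeta> = (\<Sum>j\<in>{j \<in> J. X j = \<zeta>}. c j)" for \<zeta>
    have eq: "(\<Sum>\<zeta>\<in>X ` J. d \<zeta> * \<zeta> \<omega>) = (\<Sum>j\<in>J. c j * X j \<omega>)" for \<omega>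
    proof -
      have "(\<Sum>j\<in>J. c j * X j \<omega>) = (\<Sum>\<zeta>\<in>X ` J. \<Sum>j\<in>{j \<in> J. X j = \<zeta>}. c j * X j \<omega>)"
        by (rule sum.image_gen[OF J(1)])
      also have "\<dots> = (\<Sum>\<zeta>\<in>X ` J. d \<zeta> * \<zeta> \<omega>)"
        unfolding d_def sum_distrib_right by (intro sum.cong) auto
      finally show ?thesis by simp
    qed
    have "(\<lambda>\<omega>. \<eta> \<omega> - (\<Sum>j\<in>J. c j * X j \<omega>)) \<in> H"
      using J by (intro l2_closed_span_diff[OF X] \<eta> l2_closed_span_combination[OF X]) auto
    then have "psi_norm M \<psi> (\<lambda>\<omega>. \<eta> \<omega> - (\<Sum>j\<in>J. c j * X j \<omega>))
        \<le> C * norm2 M (\<lambda>\<omega>. \<eta> \<omega> - (\<Sum>j\<in>J. c j * X j \<omega>))"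
      by (rule H_psi_norm)
    also have "\<dots> < \<epsilon>" using le C_pos by (simp add: field_simps)
    finally show ?thesis
      using J by (intro exI[of _ "X ` J"] exI[of _ d]) (auto simp: eq)
  qed
  then show "\<eta> \<in> SF_space M \<psi> (X ` T)"
    using H_F_psi[OF \<eta>] unfolding SF_space_def by blast
qed

lemma strictly_F_psi_subset_H:
  assumes \<Delta>: "\<Delta> \<subseteq> H" and mean: "\<And>\<xi>. \<xi> \<in> \<Delta> \<Longrightarrow> (\<integral>\<omega>. \<xi> \<omega> \<partial>M) = 0"
  shows "strictly_F_psi M \<psi> \<Delta> C"
proof (rule strictly_F_psiI[OF C_pos mean])
  fix n and c :: "nat \<Rightarrow> real" and \<xi> :: "nat \<Rightarrow> 'w \<Rightarrow> real" assume "\<And>i. \<xi> i \<in> \<Delta>"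
  then have "(\<lambda>\<omega>. \<Sum>i<n. c i * \<xi> i \<omega>) \<in> H"
    using \<Delta> by (intro l2_closed_span_sum[OF X]) auto
  then show "psi_bounded M \<psi> (C * norm2 M (\<lambda>\<omega>. \<Sum>i<n. c i * \<xi> i \<omega>)) (\<lambda>\<omega>. \<Sum>i<n. c i * \<xi> i \<omega>)"
    by (rule H_psi_bounded)
qed (use \<Delta> H_F_psi psi_pos in \<open>auto intro: l2_closed_span_square_integrable\<close>)

end

section \<open>The expansion\<close>

text \<open>Equal covariance and Gram kernels make \<open>f\<^sub>t \<mapsto> X\<^sub>t\<close> an isometry, which extends to the
  closed linear spans; \<open>\<xi>\<^sub>k\<close> is the image of \<open>g\<^sub>k\<close>.\<close>

lemma isometric_images:
  fixes X :: "'t \<Rightarrow> 'w \<Rightarrow> real" and f :: "'t \<Rightarrow> 'l \<Rightarrow> real" and g :: "'k \<Rightarrow> 'l \<Rightarrow> real"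
  assumes X: "\<And>t. t \<in> T \<Longrightarrow> square_integrable M (X t)"
    and f: "\<And>t. t \<in> T \<Longrightarrow> square_integrable \<mu> (f t)"
    and gram: "\<And>t s. t \<in> T \<Longrightarrow> s \<in> T \<Longrightarrow>
      (\<integral>\<omega>. X t \<omega> * X s \<omega> \<partial>M) = (\<integral>l. f t l * f s l \<partial>\<mu>)"
    and g: "\<And>k. k \<in> K \<Longrightarrow> g k \<in> l2_closed_span \<mu> T f"
  shows "\<exists>\<xi>. (\<forall>k\<in>K. \<xi> k \<in> l2_closed_span M T X) \<and>
    (\<forall>k\<in>K. \<forall>t\<in>T. (\<integral>\<omega>. X t \<omega> * \<xi> k \<omega> \<partial>M) = (\<integral>l. f t l * g k l \<partial>\<mu>)) \<and>
    (\<forall>j\<in>K. \<forall>k\<in>K. (\<integral>\<omega>. \<xi> j \<omega> * \<xi> k \<omega> \<partial>M) = (\<integral>l. g j l * g k l \<partial>\<mu>))"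
proof -
  have gram_sum: "(\<integral>\<omega>. (\<Sum>i\<in>I. c i * X i \<omega>) * (\<Sum>j\<in>J. d j * X j \<omega>) \<partial>M)
      = (\<integral>l. (\<Sum>i\<in>I. c i * f i l) * (\<Sum>j\<in>J. d j * f j l) \<partial>\<mu>)"
    if "I \<subseteq> T" "J \<subseteq> T" for I J c d
  proof -
    have "(\<Sum>i\<in>I. \<Sum>j\<in>J. c i * d j * (\<integral>\<omega>. X i \<omega> * X j \<omega> \<partial>M))
        = (\<Sum>i\<in>I. \<Sum>j\<in>J. c i * d j * (\<integral>l. f i l * f j l \<partial>\<mu>))"
      using that by (intro sum.cong refl) (auto simp: gram subset_iff)
    then show ?thesis
      using that X f by (simp add: inner_sum_sum subset_iff)
  qed
  define approximates where "approximates k J c \<longleftrightarrow> (\<forall>n. finite (J n) \<and> J n \<subseteq> T) \<and>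
      (\<lambda>n. norm2 \<mu> (\<lambda>l. (\<Sum>j\<in>J n. c n j * f j l) - g k l)) \<longlonglongrightarrow> 0"
    for k and J :: "nat \<Rightarrow> 't set" and c
  have "\<exists>J c. approximates k J c" if "k \<in> K" for k
    unfolding approximates_def by (rule l2_closed_span_sequence[OF g[OF that]]) blast
  then obtain J c where Jc: "\<And>k. k \<in> K \<Longrightarrow> approximates k (J k) (c k)"
    by metis
  define S where "S k n \<omega> = (\<Sum>j\<in>J k n. c k n j * X j \<omega>)" for k n \<omega>
  define \<Phi> where "\<Phi> k n l = (\<Sum>j\<in>J k n. c k n j * f j l)" for k n l
  have J: "finite (J k n)" "J k n \<subseteq> T" if "k \<in> K" for k n
    using Jc[OF that] by (auto simp: approximates_def)
  have lim\<Phi>: "(\<lambda>n. norm2 \<mu> (\<lambda>l. \<Phi> k n l - g k l)) \<longlonglongrightarrow> 0" if "k \<in> K" for k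
    using Jc[OF that] unfolding \<Phi>_def approximates_def by blast
  have S: "square_integrable M (S k n)" if "k \<in> K" for k n
    unfolding S_def[abs_def] using J[OF that] X by (intro square_integrable_sum) auto
  have \<Phi>: "square_integrable \<mu> (\<Phi> k n)" if "k \<in> K" for k n
    unfolding \<Phi>_def[abs_def] using J[OF that] f by (intro square_integrable_sum) auto
  have g2: "square_integrable \<mu> (g k)" if "k \<in> K" for k
    by (rule l2_closed_span_square_integrable[OF g[OF that]])
  have S\<Phi>: "(\<integral>\<omega>. S j m \<omega> * S k n \<omega> \<partial>M) = (\<integral>l. \<Phi> j m l * \<Phi> k n l \<partial>\<mu>)"
    if "j \<in> K" "k \<in> K" for j k m n
    unfolding S_def \<Phi>_def by (intro gram_sum J that)
  have "\<exists>h. square_integrable M h \<and> (\<lambda>n. norm2 M (\<lambda>\<omega>. S k n \<omega> - h \<omega>)) \<longlonglongrightarrow> 0"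
    if k: "k \<in> K" for k
  proof (rule L2_complete[OF S[OF k]])
    fix e :: real assume "0 < e"
    then have "eventually (\<lambda>n. norm2 \<mu> (\<lambda>l. \<Phi> k n l - g k l) < e / 2) sequentially"
      by (intro order_tendstoD(2)[OF lim\<Phi>[OF k]]) simp
    then obtain N where N: "\<And>n. N \<le> n \<Longrightarrow> norm2 \<mu> (\<lambda>l. \<Phi> k n l - g k l) < e / 2"
      by (auto simp: eventually_sequentially)
    have "norm2 M (\<lambda>\<omega>. S k m \<omega> - S k n \<omega>) < e" if "N \<le> m" "N \<le> n" for m n
    proof -
      have "(norm2 M (\<lambda>\<omega>. S k m \<omega> - S k n \<omega>))\<^sup>2 = (norm2 \<mu> (\<lambda>l. \<Phi> k m l - \<Phi> k n l))\<^sup>2"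
        using k by (simp add: norm2_diff_square S \<Phi> S\<Phi>)
      then have "norm2 M (\<lambda>\<omega>. S k m \<omega> - S k n \<omega>) = norm2 \<mu> (\<lambda>l. \<Phi> k m l - \<Phi> k n l)"
        by (simp add: norm2_nonneg power2_eq_iff_nonneg)
      also have "\<dots> \<le> norm2 \<mu> (\<lambda>l. \<Phi> k m l - g k l) + norm2 \<mu> (\<lambda>l. g k l - \<Phi> k n l)"
        by (intro norm2_triangle_diff \<Phi> g2 k)
      also have "\<dots> < e"
        using N[OF that(1)] N[OF that(2)] by (simp add: norm2_minus_commute[of \<mu> "g k"])
      finally show ?thesis .
    qed
    then show "\<exists>N. \<forall>m\<ge>N. \<forall>n\<ge>N. norm2 M (\<lambda>\<omega>. S k m \<omega> - S k n \<omega>) < e" by blast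
  qed
  then obtain \<xi> where \<xi>: "\<And>k. k \<in> K \<Longrightarrow> square_integrable M (\<xi> k)"
    and lim\<xi>: "\<And>k. k \<in> K \<Longrightarrow> (\<lambda>n. norm2 M (\<lambda>\<omega>. S k n \<omega> - \<xi> k \<omega>)) \<longlonglongrightarrow> 0"
    by metis
  show ?thesis
  proof (intro exI[of _ \<xi>] conjI ballI)
    fix k assume k: "k \<in> K"
    show "\<xi> k \<in> l2_closed_span M T X"
      unfolding l2_closed_span_def
    proof (intro CollectI conjI allI impI \<xi> k)
      fix \<epsilon> :: real assume "0 < \<epsilon>"
      then obtain n where "norm2 M (\<lambda>\<omega>. S k n \<omega> - \<xi> k \<omega>) < \<epsilon>"
        using eventually_happens[OF order_tendstoD(2)[OF lim\<xi>[OF k]]] by auto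
      then show "\<exists>J c. finite J \<and> J \<subseteq> T \<and> norm2 M (\<lambda>\<omega>. \<xi> k \<omega> - (\<Sum>j\<in>J. c j * X j \<omega>)) < \<epsilon>"
        using J[OF k, of n] norm2_minus_commute[of M "S k n" "\<xi> k"]
        by (intro exI[of _ "J k n"] exI[of _ "c k n"]) (simp add: S_def)
    qed
  next
    fix k t assume k: "k \<in> K" and t: "t \<in> T"
    have "(\<lambda>n. \<integral>\<omega>. X t \<omega> * S k n \<omega> \<partial>M) \<longlonglongrightarrow> (\<integral>\<omega>. X t \<omega> * \<xi> k \<omega> \<partial>M)"
      using tendsto_inner[OF X[OF t] X[OF t] S[OF k] \<xi>[OF k] _ lim\<xi>[OF k]]
      by (simp add: norm2_def)
    moreover have "(\<lambda>n. \<integral>l. f t l * \<Phi> k n l \<partial>\<mu>) \<longlonglongrightarrow> (\<integral>l. f t l * g k l \<partial>\<mu>)"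
      using tendsto_inner[OF f[OF t] f[OF t] \<Phi>[OF k] g2[OF k] _ lim\<Phi>[OF k]]
      by (simp add: norm2_def)
    moreover have "(\<integral>\<omega>. X t \<omega> * S k n \<omega> \<partial>M) = (\<integral>l. f t l * \<Phi> k n l \<partial>\<mu>)" for n
      using gram_sum[of "{t}" "J k n" "\<lambda>_. 1" "c k n"] t J[OF k, of n]
      by (simp add: S_def \<Phi>_def)
    ultimately show "(\<integral>\<omega>. X t \<omega> * \<xi> k \<omega> \<partial>M) = (\<integral>l. f t l * g k l \<partial>\<mu>)"
      using LIMSEQ_unique by simp
  next
    fix j k assume j: "j \<in> K" and k: "k \<in> K"
    have "(\<lambda>n. \<integral>\<omega>. S j n \<omega> * S k n \<omega> \<partial>M) \<longlonglongrightarrow> (\<integral>\<omega>. \<xi> j \<omega> * \<xi> k \<omega> \<partial>M)"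
      by (intro tendsto_inner S \<xi> lim\<xi> j k)
    moreover have "(\<lambda>n. \<integral>l. \<Phi> j n l * \<Phi> k n l \<partial>\<mu>) \<longlonglongrightarrow> (\<integral>l. g j l * g k l \<partial>\<mu>)"
      by (intro tendsto_inner \<Phi> g2 lim\<Phi> j k)
    ultimately show "(\<integral>\<omega>. \<xi> j \<omega> * \<xi> k \<omega> \<partial>M) = (\<integral>l. g j l * g k l \<partial>\<mu>)"
      using LIMSEQ_unique by (simp add: S\<Phi>[OF j k])
  qed
qed

lemma norm2_orthonormal_combination:
  assumes g: "orthonormal M I g" and z: "square_integrable M z"
    and J: "finite J" "J \<subseteq> I"
  shows "(norm2 M (\<lambda>\<omega>. z \<omega> - (\<Sum>j\<in>J. c j * g j \<omega>)))\<^sup>2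
    = (\<integral>\<omega>. z \<omega> * z \<omega> \<partial>M) - 2 * (\<Sum>j\<in>J. c j * (\<integral>\<omega>. g j \<omega> * z \<omega> \<partial>M)) + (\<Sum>j\<in>J. (c j)\<^sup>2)"
proof -
  have "(\<Sum>j\<in>J. c i * c j * (\<integral>\<omega>. g i \<omega> * g j \<omega> \<partial>M)) = (c i)\<^sup>2" if "i \<in> J" for i
  proof -
    have "(\<Sum>j\<in>J. c i * c j * (\<integral>\<omega>. g i \<omega> * g j \<omega> \<partial>M)) = (\<Sum>j\<in>J. if j = i then c i * c j else 0)"
      using g J that by (intro sum.cong refl) (auto simp: orthonormal_def subset_iff)
    then show ?thesis using J that by (simp add: power2_eq_square)
  qed
  moreover have "square_integrable M (g j)" if "j \<in> J" for j
    using g J that by (auto simp: orthonormal_def)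
  ultimately show ?thesis
    using z by (simp add: norm2_diff_combination)
qed

text \<open>The partial sums of the Fourier series are at least as close as any linear combination of
  the terms that they contain.\<close>

lemma fourier_series_converges:
  fixes g :: "nat \<Rightarrow> 'l \<Rightarrow> real"
  assumes g: "orthonormal_basis \<mu> {1..} g" and z: "square_integrable \<mu> z"
  shows "(\<lambda>n. norm2 \<mu> (\<lambda>l. z l - (\<Sum>k=1..n. (\<integral>l. z l * g k l \<partial>\<mu>) * g k l))) \<longlonglongrightarrow> 0"
proof (rule LIMSEQ_I)
  fix r :: real assume r: "0 < r"
  define a where "a k = (\<integral>l. g k l * z l \<partial>\<mu>)" for k
  have on: "orthonormal \<mu> {1..} g" and cs: "complete_system \<mu> {1..} g"
    using g by (auto simp: orthonormal_basis_def)
  from l2_closed_span_approx[OF complete_systemD[OF cs z] r] obtain J c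
    where J: "finite J" "J \<subseteq> {1..}" and le: "norm2 \<mu> (\<lambda>l. z l - (\<Sum>j\<in>J. c j * g j l)) < r" .
  have "norm2 \<mu> (\<lambda>l. z l - (\<Sum>k=1..n. a k * g k l)) < r" if n: "Max (insert 0 J) \<le> n" for n
  proof -
    have sub: "J \<subseteq> {1..n}"
      using J n by (auto simp: Max_insert)
    have "(norm2 \<mu> (\<lambda>l. z l - (\<Sum>k=1..n. a k * g k l)))\<^sup>2 = (\<integral>l. z l * z l \<partial>\<mu>) - (\<Sum>k=1..n. (a k)\<^sup>2)"
      using norm2_orthonormal_combination[OF on z, of "{1..n}" a]
      by (simp add: a_def[symmetric] power2_eq_square)
    also have "\<dots> \<le> (\<integral>l. z l * z l \<partial>\<mu>) - (\<Sum>k\<in>J. (a k)\<^sup>2)"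
      using sum_mono2[OF _ sub, of "\<lambda>k. (a k)\<^sup>2"] by simp
    also have "\<dots> \<le> (\<integral>l. z l * z l \<partial>\<mu>) - (\<Sum>k\<in>J. 2 * (c k * a k) - (c k)\<^sup>2)"
    proof -
      have "2 * (x * y) - x\<^sup>2 \<le> y\<^sup>2" for x y :: real
        using sum_squares_bound[of x y] by simp
      then have "(\<Sum>k\<in>J. 2 * (c k * a k) - (c k)\<^sup>2) \<le> (\<Sum>k\<in>J. (a k)\<^sup>2)"
        by (intro sum_mono)
      then show ?thesis by simp
    qed
    also have "\<dots> = (norm2 \<mu> (\<lambda>l. z l - (\<Sum>j\<in>J. c j * g j l)))\<^sup>2"
      using norm2_orthonormal_combination[OF on z J, of c]
      by (simp add: a_def[symmetric] sum_subtractf sum_distrib_left)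
    also have "\<dots> < r\<^sup>2"
      using le by (intro power_strict_mono norm2_nonneg) auto
    finally show ?thesis
      by (rule power2_less_imp_less) (use r in simp)
  qed
  then show "\<exists>no. \<forall>n\<ge>no. norm (norm2 \<mu> (\<lambda>l. z l - (\<Sum>k=1..n. (\<integral>l. z l * g k l \<partial>\<mu>) * g k l)) - 0) < r"
    by (intro exI[of _ "Max (insert 0 J)"]) (auto simp: norm2_nonneg a_def mult.commute)
qed

context
  fixes M :: "'w measure" and \<mu> :: "'l measure" and T :: "'t set"
    and X :: "'t \<Rightarrow> 'w \<Rightarrow> real" and f :: "'t \<Rightarrow> 'l \<Rightarrow> real" and g :: "nat \<Rightarrow> 'l \<Rightarrow> real"
  assumes X: "\<And>t. t \<in> T \<Longrightarrow> square_integrable M (X t)"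
    and f: "\<And>t. t \<in> T \<Longrightarrow> square_integrable \<mu> (f t)"
    and gram: "\<And>t s. t \<in> T \<Longrightarrow> s \<in> T \<Longrightarrow>
      (\<integral>\<omega>. X t \<omega> * X s \<omega> \<partial>M) = (\<integral>l. f t l * f s l \<partial>\<mu>)"
    and complete: "complete_system \<mu> T f"
    and basis: "orthonormal_basis \<mu> {1..} g"
begin

lemma basis_square_integrable: "1 \<le> k \<Longrightarrow> square_integrable \<mu> (g k)"
  using basis by (simp add: orthonormal_basis_def orthonormal_def)

lemma ex_ms_expansion:
  assumes "prob_space M" and mean: "\<And>t. t \<in> T \<Longrightarrow> (\<integral>\<omega>. X t \<omega> \<partial>M) = 0"
  shows "\<exists>\<xi>. ms_expansion M T X (coefficient \<mu> f g) \<xi>"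
proof -
  have g: "orthonormal \<mu> {1..} g"
    using basis by (simp add: orthonormal_basis_def)
  have g_span: "g k \<in> l2_closed_span \<mu> T f" if "k \<in> {1..}" for k
    using that by (intro complete_systemD[OF complete] basis_square_integrable) simp
  obtain \<xi> where ex: "(\<forall>k\<in>{1..}. \<xi> k \<in> l2_closed_span M T X) \<and>
      (\<forall>k\<in>{1..}. \<forall>t\<in>T. (\<integral>\<omega>. X t \<omega> * \<xi> k \<omega> \<partial>M) = (\<integral>l. f t l * g k l \<partial>\<mu>)) \<and>
      (\<forall>j\<in>{1..}. \<forall>k\<in>{1..}. (\<integral>\<omega>. \<xi> j \<omega> * \<xi> k \<omega> \<partial>M) = (\<integral>l. g j l * g k l \<partial>\<mu>))"
    by (rule exE[OF isometric_images[of T M X \<mu> f "{1..}" g, OF X f gram g_span]])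
      (assumption | rule that)+
  have \<xi>: "\<xi> k \<in> l2_closed_span M T X"
    and X\<xi>: "t \<in> T \<Longrightarrow> (\<integral>\<omega>. X t \<omega> * \<xi> k \<omega> \<partial>M) = (\<integral>l. f t l * g k l \<partial>\<mu>)" if "k \<in> {1..}" for k t
    using ex that by auto
  have \<xi>\<xi>: "(\<integral>\<omega>. \<xi> j \<omega> * \<xi> k \<omega> \<partial>M) = (\<integral>l. g j l * g k l \<partial>\<mu>)"
    if "j \<in> {1..}" "k \<in> {1..}" for j k
    using ex that by auto
  have on: "orthonormal M {1..} \<xi>"
    using g \<xi> \<xi>\<xi> by (auto simp: orthonormal_def intro: l2_closed_span_square_integrable)
  have "ms_converges M (\<lambda>n. partial_sum (coefficient \<mu> f g) \<xi> n t) (X t)" if t: "t \<in> T" for t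
  proof -
    define a where "a k = (\<integral>l. f t l * g k l \<partial>\<mu>)" for k
    have eq: "partial_sum (coefficient \<mu> f g) \<xi> n t = (\<lambda>\<omega>. \<Sum>k=1..n. a k * \<xi> k \<omega>)" for n
      by (auto simp: partial_sum_def coefficient_def a_def mult.commute)
    have S: "square_integrable M (\<lambda>\<omega>. \<Sum>k=1..n. a k * \<xi> k \<omega>)" for n
      using on by (intro square_integrable_sum) (auto simp: orthonormal_def)
    have scalar: "(\<integral>\<omega>. \<xi> k \<omega> * X t \<omega> \<partial>M) = a k" "(\<integral>l. g k l * f t l \<partial>\<mu>) = a k" if "k \<in> {1..}" for k
      unfolding a_def using X\<xi>[OF that t] by (simp_all only: mult.commute[of "\<xi> k _"] mult.commute[of "g k _"])
    have "norm2 M (\<lambda>\<omega>. X t \<omega> - (\<Sum>k=1..n. a k * \<xi> k \<omega>))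
        = norm2 \<mu> (\<lambda>l. f t l - (\<Sum>k=1..n. a k * g k l))" for n
    proof -
      have "(norm2 M (\<lambda>\<omega>. X t \<omega> - (\<Sum>k=1..n. a k * \<xi> k \<omega>)))\<^sup>2
          = (norm2 \<mu> (\<lambda>l. f t l - (\<Sum>k=1..n. a k * g k l)))\<^sup>2"
        using scalar
        by (simp add: norm2_orthonormal_combination[OF on X[OF t]]
          norm2_orthonormal_combination[OF g f[OF t]] gram[OF t t])
      then show ?thesis by (simp add: norm2_nonneg power2_eq_iff_nonneg)
    qed
    then have "(\<lambda>n. norm2 M (\<lambda>\<omega>. X t \<omega> - (\<Sum>k=1..n. a k * \<xi> k \<omega>))) \<longlonglongrightarrow> 0"
      using fourier_series_converges[OF basis f[OF t]] by (simp add: a_def)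
    then have "(\<lambda>n. norm2 M (\<lambda>\<omega>. (\<Sum>k=1..n. a k * \<xi> k \<omega>) - X t \<omega>)) \<longlonglongrightarrow> 0"
      by (subst norm2_minus_commute)
    then show ?thesis
      unfolding eq ms_converges_iff[OF S square_integrable_borel[OF X[OF t]]] using X[OF t] by simp
  qed
  moreover have "(\<integral>\<omega>. \<xi> k \<omega> \<partial>M) = 0" if "1 \<le> k" for k
    using that by (intro l2_closed_span_mean_zero[OF X \<open>prob_space M\<close> mean \<xi>]) auto
  ultimately show ?thesis
    using on unfolding ms_expansion_def by blast
qed

text \<open>The coefficient \<open>a\<^sub>k(t)\<close> is the scalar product of \<open>X\<^sub>t\<close> and \<open>\<xi>\<^sub>k\<close> as well as that of
  \<open>f\<^sub>t\<close> and \<open>g\<^sub>k\<close>. Hence a linear combination of the \<open>X\<^sub>t\<close> is as close to \<open>\<xi>\<^sub>k\<close> as the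
  same linear combination of the \<open>f\<^sub>t\<close> is to \<open>g\<^sub>k\<close>.\<close>

lemma ms_expansion_in_closed_span:
  assumes exp: "ms_expansion M T X (coefficient \<mu> f g) \<xi>" and k: "1 \<le> k"
  shows "\<xi> k \<in> l2_closed_span M T X"
proof -
  have on: "orthonormal M {1..} \<xi>" and ong: "orthonormal \<mu> {1..} g"
    using exp basis by (auto simp: ms_expansion_def orthonormal_basis_def)
  have \<xi>: "square_integrable M (\<xi> j)" if "1 \<le> j" for j
    using on that by (simp add: orthonormal_def)
  have inner: "(\<integral>\<omega>. X t \<omega> * \<xi> k \<omega> \<partial>M) = (\<integral>l. f t l * g k l \<partial>\<mu>)" if t: "t \<in> T" for t
  proof -
    let ?S = "\<lambda>n \<omega>. \<Sum>j=1..n. coefficient \<mu> f g j t * \<xi> j \<omega>"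
    have S: "square_integrable M (?S n)" for n
      using \<xi> by (intro square_integrable_sum) auto
    have "ms_converges M ?S (X t)"
      using exp t by (simp add: ms_expansion_def partial_sum_def[abs_def] mult.commute)
    then have "(\<lambda>n. norm2 M (\<lambda>\<omega>. ?S n \<omega> - X t \<omega>)) \<longlonglongrightarrow> 0"
      using ms_converges_iff[OF S square_integrable_borel[OF X[OF t]]] by simp
    then have "(\<lambda>n. \<integral>\<omega>. ?S n \<omega> * \<xi> k \<omega> \<partial>M) \<longlonglongrightarrow> (\<integral>\<omega>. X t \<omega> * \<xi> k \<omega> \<partial>M)"
      using tendsto_inner[OF S X[OF t] \<xi>[OF k] \<xi>[OF k]] by (simp add: norm2_def)
    moreover have "(\<lambda>n. \<integral>\<omega>. ?S n \<omega> * \<xi> k \<omega> \<partial>M) \<longlonglongrightarrow> coefficient \<mu> f g k t"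
    proof (rule tendsto_eventually, rule eventually_sequentiallyI[of k])
      fix n assume "k \<le> n"
      have "(\<integral>\<omega>. ?S n \<omega> * \<xi> k \<omega> \<partial>M)
          = (\<Sum>j=1..n. coefficient \<mu> f g j t * (\<integral>\<omega>. \<xi> j \<omega> * \<xi> k \<omega> \<partial>M))"
        using inner_sum_sum[of "{1..n}" M \<xi> "{()}" "\<lambda>_. \<xi> k" "\<lambda>j. coefficient \<mu> f g j t" "\<lambda>_. 1"] \<xi> k
        by simp
      also have "\<dots> = (\<Sum>j=1..n. if j = k then coefficient \<mu> f g j t else 0)"
        using on k by (intro sum.cong refl) (auto simp: orthonormal_def)
      also have "\<dots> = coefficient \<mu> f g k t" using k \<open>k \<le> n\<close> by simp
      finally show "(\<integral>\<omega>. ?S n \<omega> * \<xi> k \<omega> \<partial>M) = coefficient \<mu> f g k t" .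
    qed
    ultimately show ?thesis
      using LIMSEQ_unique unfolding coefficient_def by blast
  qed
  show ?thesis
    unfolding l2_closed_span_def
  proof (intro CollectI conjI allI impI \<xi> k)
    fix \<epsilon> :: real assume "0 < \<epsilon>"
    from l2_closed_span_approx[OF complete_systemD[OF complete basis_square_integrable[OF k]] this]
    obtain J c where J: "finite J" "J \<subseteq> T"
      and le: "norm2 \<mu> (\<lambda>l. g k l - (\<Sum>j\<in>J. c j * f j l)) < \<epsilon>" .
    have fJ: "square_integrable \<mu> (f j)" and XJ: "square_integrable M (X j)" if "j \<in> J" for j
      using f X J that by auto
    have "(\<integral>\<omega>. \<xi> k \<omega> * \<xi> k \<omega> \<partial>M) = (\<integral>l. g k l * g k l \<partial>\<mu>)"
      using on ong k by (simp add: orthonormal_def)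
    moreover have "(\<Sum>j\<in>J. c j * (\<integral>\<omega>. X j \<omega> * \<xi> k \<omega> \<partial>M)) = (\<Sum>j\<in>J. c j * (\<integral>l. f j l * g k l \<partial>\<mu>))"
      using J by (intro sum.cong refl) (auto simp: inner)
    moreover have "(\<Sum>i\<in>J. \<Sum>j\<in>J. c i * c j * (\<integral>\<omega>. X i \<omega> * X j \<omega> \<partial>M))
        = (\<Sum>i\<in>J. \<Sum>j\<in>J. c i * c j * (\<integral>l. f i l * f j l \<partial>\<mu>))"
      using J by (intro sum.cong refl) (auto simp: gram subset_iff)
    ultimately have "(norm2 M (\<lambda>\<omega>. \<xi> k \<omega> - (\<Sum>j\<in>J. c j * X j \<omega>)))\<^sup>2
        = (norm2 \<mu> (\<lambda>l. g k l - (\<Sum>j\<in>J. c j * f j l)))\<^sup>2"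
      by (simp add: norm2_diff_combination[OF \<xi>[OF k] XJ]
        norm2_diff_combination[OF basis_square_integrable[OF k] fJ])
    then have "norm2 M (\<lambda>\<omega>. \<xi> k \<omega> - (\<Sum>j\<in>J. c j * X j \<omega>))
        = norm2 \<mu> (\<lambda>l. g k l - (\<Sum>j\<in>J. c j * f j l))"
      by (simp add: norm2_nonneg power2_eq_iff_nonneg)
    with J le show "\<exists>J c. finite J \<and> J \<subseteq> T \<and> norm2 M (\<lambda>\<omega>. \<xi> k \<omega> - (\<Sum>j\<in>J. c j * X j \<omega>)) < \<epsilon>"
      by (intro exI[of _ J] exI[of _ c]) auto
  qed
qed

end

section \<open>Metric entropy\<close>

text \<open>Total boundedness of \<open>T\<close> makes the minimum exist; the balls of an optimal cover are then
  enlarged to the common radius \<open>u\<close>.\<close>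

lemma metric_massiveness_cover:
  assumes "compact T" "0 < u"
  shows "\<exists>c. (\<forall>i<metric_massiveness T u. c i \<in> T) \<and> T \<subseteq> (\<Union>i<metric_massiveness T u. cball (c i) u)"
proof -
  let ?P = "\<lambda>n. \<exists>c r. (\<forall>i<n. c i \<in> T \<and> r i \<le> u) \<and> T \<subseteq> (\<Union>i<n. cball (c i) (r i))"
  obtain A where A: "finite A" "A \<subseteq> T" "T \<subseteq> (\<Union>x\<in>A. ball x u)"
    using seq_compact_imp_totally_bounded[of T] assms by (auto simp: compact_eq_seq_compact_metric)
  obtain e where e: "bij_betw e {..<card A} A"
    using ex_bij_betw_nat_finite[OF A(1)] by (auto simp: lessThan_atLeast0)
  have "T \<subseteq> (\<Union>i<card A. cball (e i) u)"
  proof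
    fix t assume "t \<in> T"
    then obtain x where "x \<in> A" "dist x t < u" using A(3) by auto
    then have "x \<in> e ` {..<card A}" using e by (simp add: bij_betw_def)
    then obtain i where "i < card A" "e i = x" by auto
    then show "t \<in> (\<Union>i<card A. cball (e i) u)" using \<open>dist x t < u\<close> by (auto intro!: bexI[of _ i])
  qed
  moreover have "\<forall>i<card A. e i \<in> T"
    using e A(2) by (auto simp: bij_betw_def)
  ultimately have "?P (card A)"
    by (intro exI[of _ e] exI[of _ "\<lambda>_. u"]) simp
  then have "?P (metric_massiveness T u)"
    unfolding metric_massiveness_def by (rule LeastI)
  then obtain c r where c: "\<forall>i<metric_massiveness T u. c i \<in> T \<and> r i \<le> u"
    "T \<subseteq> (\<Union>i<metric_massiveness T u. cball (c i) (r i))" by blast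
  have "T \<subseteq> (\<Union>i<metric_massiveness T u. cball (c i) u)"
  proof
    fix t assume "t \<in> T"
    then obtain i where "i < metric_massiveness T u" "dist (c i) t \<le> r i" using c(2) by auto
    then show "t \<in> (\<Union>i<metric_massiveness T u. cball (c i) u)"
      using c(1) by (auto intro!: bexI[of _ i] intro: order_trans)
  qed
  then show ?thesis using c(1) by blast
qed

lemma metric_massiveness_pos:
  assumes "compact T" "T \<noteq> {}" "0 < u"
  shows "1 \<le> metric_massiveness T u"
proof (rule ccontr)
  assume "\<not> 1 \<le> metric_massiveness T u"
  then have "metric_massiveness T u = 0" by simp
  then show False using metric_massiveness_cover[OF assms(1,3)] assms(2) by auto
qed

lemma metric_massiveness_antimono:
  assumes "compact T" "0 < u" "u \<le> v"
  shows "metric_massiveness T v \<le> metric_massiveness T u"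
proof -
  obtain c where "\<forall>i<metric_massiveness T u. c i \<in> T"
    "T \<subseteq> (\<Union>i<metric_massiveness T u. cball (c i) u)"
    using metric_massiveness_cover[OF assms(1,2)] by blast
  then have "\<exists>c r. (\<forall>i<metric_massiveness T u. c i \<in> T \<and> r i \<le> v) \<and>
      T \<subseteq> (\<Union>i<metric_massiveness T u. cball (c i) (r i))"
    using assms(3) by (intro exI[of _ c] exI[of _ "\<lambda>_. u"]) simp
  then show ?thesis
    unfolding metric_massiveness_def[of T v] by (rule Least_le)
qed

lemma the_inv_into_modulus:
  fixes \<sigma> :: "real \<Rightarrow> real"
  assumes \<sigma>: "continuous_on {0..} \<sigma>" "strict_mono_on {0..} \<sigma>" "\<sigma> 0 = 0"
    and s: "0 \<le> s" "s \<le> \<sigma> d" "0 \<le> d"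
  shows "0 \<le> the_inv_into {0..} \<sigma> s" "\<sigma> (the_inv_into {0..} \<sigma> s) = s"
proof -
  have inj: "inj_on \<sigma> {0..}" using \<sigma>(2) by (rule strict_mono_on_imp_inj_on)
  have "continuous_on {0..d} \<sigma>"
    using \<sigma>(1) by (rule continuous_on_subset) auto
  then obtain x where x: "0 \<le> x" "\<sigma> x = s"
    using IVT'[of \<sigma> 0 s d] s \<sigma>(3) by auto
  then have "the_inv_into {0..} \<sigma> s = x"
    using the_inv_into_f_f[OF inj, of x] by auto
  then show "0 \<le> the_inv_into {0..} \<sigma> s" "\<sigma> (the_inv_into {0..} \<sigma> s) = s"
    using x by auto
qed

text \<open>Away from 0 a nonincreasing function is bounded and measurable, so only its behaviour near 0
  matters for integrability.\<close>

lemma antimono_set_integrable: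
  fixes F :: "real \<Rightarrow> real"
  assumes anti: "\<And>x y. 0 < x \<Longrightarrow> x \<le> y \<Longrightarrow> y < \<gamma> \<Longrightarrow> F y \<le> F x"
    and nonneg: "\<And>x. 0 < x \<Longrightarrow> x < \<gamma> \<Longrightarrow> 0 \<le> F x"
    and z: "0 < z" "set_integrable lborel {0<..<z} F" and b: "b < \<gamma>"
  shows "set_integrable lborel {0<..<b} F"
proof (cases "b \<le> z")
  case True
  then show ?thesis by (intro set_integrable_subset[OF z(2)]) auto
next
  case False
  have "mono_on {z..<b} (\<lambda>x. - F x)"
    using anti z(1) b by (auto intro!: mono_onI)
  then have "(\<lambda>x. - F x) \<in> borel_measurable (restrict_space borel {z..<b})"
    by (rule borel_measurable_mono_on_fnc)
  then have "(\<lambda>x. - (- F x)) \<in> borel_measurable (restrict_space borel {z..<b})"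
    by (rule borel_measurable_uminus)
  then have meas: "(\<lambda>x. indicator {z..<b} x *\<^sub>R F x) \<in> borel_measurable lborel"
    by (simp add: borel_measurable_restrict_space_iff)
  have "integrable lborel (\<lambda>x. F z * indicator {z..<b} x)"
    using False by (intro integrable_mult_right integrable_real_indicator) auto
  then have "integrable lborel (\<lambda>x. indicator {z..<b} x *\<^sub>R F x)"
  proof (rule Bochner_Integration.integrable_bound[OF _ meas], intro AE_I2)
    fix x
    show "norm (indicator {z..<b} x *\<^sub>R F x) \<le> norm (F z * indicator {z..<b} x)"
      using anti[OF z(1), of x] nonneg[of x] z(1) b by (auto simp: indicator_def)
  qed
  then have "set_integrable lborel {z..<b} F" by (simp add: set_integrable_def)
  moreover have "{0<..<b} = {0<..<z} \<union> {z..<b}" using False z(1) by auto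
  ultimately show ?thesis
    using set_integrable_Un[OF z(2)] by simp
qed

text \<open>The sum is the integral of the step function that takes the value of \<open>F\<close> at the right end of
  each interval from \<open>\<gamma> p\<^sup>k\<^sup>+\<^sup>1\<close> to \<open>\<gamma> p\<^sup>k\<close>; a nonincreasing \<open>F\<close> lies above it.\<close>

lemma antimono_geometric_sum_le:
  fixes F :: "real \<Rightarrow> real"
  assumes anti: "\<And>x y. 0 < x \<Longrightarrow> x \<le> y \<Longrightarrow> y < \<gamma> \<Longrightarrow> F y \<le> F x"
    and nonneg: "\<And>x. 0 < x \<Longrightarrow> x < \<gamma> \<Longrightarrow> 0 \<le> F x"
    and int: "set_integrable lborel {0<..<\<gamma> * p} F" and p: "0 < p" "p < 1" and \<gamma>: "0 \<le> \<gamma>"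
  shows "(\<Sum>k=1..K. F (\<gamma> * p^k) * (\<gamma> * p^k * (1 - p))) \<le> (LINT u:{0<..<\<gamma> * p}|lborel. F u)"
proof (cases "\<gamma> = 0")
  case False
  then have \<gamma>: "0 < \<gamma>" using \<gamma> by simp
  define A where "A k = {\<gamma> * p^Suc k..<\<gamma> * p^k}" for k
  have pk: "p^j \<le> p^k" if "k \<le> j" for j k
    using p that by (intro power_decreasing) auto
  have step: "\<gamma> * p^Suc k \<le> \<gamma> * p^k" for k
    using \<gamma> pk[of k "Suc k"] by (intro mult_left_mono) auto
  have A: "integrable lborel (\<lambda>u. F (\<gamma> * p^k) * indicator (A k) u)" for k
    unfolding A_def using emeasure_lborel_Ico[OF step[of k]]
    by (intro integrable_mult_right integrable_real_indicator) auto
  have len: "(\<integral>u. F (\<gamma> * p^k) * indicator (A k) u \<partial>lborel) = F (\<gamma> * p^k) * (\<gamma> * p^k * (1 - p))" for k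
  proof -
    have "measure lborel (A k) = \<gamma> * p^k - \<gamma> * p^Suc k"
      unfolding A_def by (intro measure_lborel_Ico step)
    then have "measure lborel (A k) = \<gamma> * p^k * (1 - p)"
      by (simp add: algebra_simps)
    then show ?thesis by simp
  qed
  have "(\<Sum>k=1..K. F (\<gamma> * p^k) * (\<gamma> * p^k * (1 - p)))
      = (\<integral>u. (\<Sum>k=1..K. F (\<gamma> * p^k) * indicator (A k) u) \<partial>lborel)"
    using A by (simp only: Bochner_Integration.integral_sum len)
  also have "\<dots> \<le> (\<integral>u. indicator {0<..<\<gamma> * p} u *\<^sub>R F u \<partial>lborel)"
  proof (rule integral_mono)
    fix u :: real
    show "(\<Sum>k=1..K. F (\<gamma> * p^k) * indicator (A k) u) \<le> indicator {0<..<\<gamma> * p} u *\<^sub>R F u"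
    proof (cases "\<exists>k\<in>{1..K}. u \<in> A k")
      case True
      then obtain k where k: "k \<in> {1..K}" "u \<in> A k" by blast
      have "u \<notin> A j" if "j \<noteq> k" for j
      proof
        assume "u \<in> A j"
        with k have "\<gamma> * p^Suc j < \<gamma> * p^k" "\<gamma> * p^Suc k < \<gamma> * p^j"
          by (auto simp: A_def)
        then have "p^Suc j < p^k" "p^Suc k < p^j" using \<gamma> by auto
        then have "\<not> Suc j \<le> k" "\<not> Suc k \<le> j"
          using pk[of "Suc j" k] pk[of "Suc k" j] by auto
        then show False using that by simp
      qed
      then have "(\<Sum>j=1..K. F (\<gamma> * p^j) * indicator (A j) u)
          = (\<Sum>j=1..K. if j = k then F (\<gamma> * p^k) else 0)"
        using k(2) by (intro sum.cong refl) (auto simp: indicator_def)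
      then have eq: "(\<Sum>j=1..K. F (\<gamma> * p^j) * indicator (A j) u) = F (\<gamma> * p^k)"
        using k(1) by simp
      have "0 < \<gamma> * p^Suc k" using \<gamma> p by simp
      then have u: "0 < u" "u < \<gamma> * p^k" using k(2) by (auto simp: A_def)
      have le: "\<gamma> * p^k \<le> \<gamma> * p" using pk[of 1 k] k(1) \<gamma> by (intro mult_left_mono) auto
      have "\<gamma> * p < \<gamma>" using p \<gamma> by simp
      then have "F (\<gamma> * p^k) \<le> F u" using u le
        by (intro anti order.strict_trans1[OF le] less_imp_le)
      then show ?thesis unfolding eq using u le by simp
    next
      case False
      then have "(\<Sum>k=1..K. F (\<gamma> * p^k) * indicator (A k) u) = 0"
        by (intro sum.neutral) auto
      moreover have "\<gamma> * p < \<gamma>" using p \<gamma> by simp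
      ultimately show ?thesis using nonneg[of u] by (auto simp: indicator_def)
    qed
  next
    show "integrable lborel (\<lambda>u. \<Sum>k=1..K. F (\<gamma> * p^k) * indicator (A k) u)"
      by (rule Bochner_Integration.integrable_sum) (rule A)
    show "integrable lborel (\<lambda>u. indicator {0<..<\<gamma> * p} u *\<^sub>R F u)"
      using int unfolding set_integrable_def .
  qed
  finally show ?thesis by (simp add: set_lebesgue_integral_def)
qed (simp add: set_lebesgue_integral_def)

section \<open>Chaining\<close>

lemma psi_bounded_abs: "psi_bounded M \<psi> B \<xi> \<Longrightarrow> psi_bounded M \<psi> B (\<lambda>\<omega>. \<bar>\<xi> \<omega>\<bar>)"
  by (auto simp: psi_bounded_def intro: borel_measurable_abs)

text \<open>The crude bound of a maximum by the sum serves to show that the maximum belongs to \<open>F\<^sub>\<psi>\<close>,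
  which a majorizing characteristic does not assert.\<close>

lemma psi_bounded_max:
  assumes \<xi>: "\<And>i. i \<in> I \<Longrightarrow> psi_bounded M \<psi> (B i) (\<xi> i)" and I: "finite I" "I \<noteq> {}"
    and \<psi>: "\<And>u. 1 \<le> u \<Longrightarrow> 0 < \<psi> u"
  shows "psi_bounded M \<psi> (\<Sum>i\<in>I. B i) (\<lambda>\<omega>. MAX i\<in>I. \<bar>\<xi> i \<omega>\<bar>)"
proof -
  have abs: "psi_bounded M \<psi> (B i) (\<lambda>\<omega>. \<bar>\<xi> i \<omega>\<bar>)" if "i \<in> I" for i
    by (intro psi_bounded_abs \<xi> that)
  have "(\<lambda>\<omega>. Max ((\<lambda>i. \<bar>\<xi> i \<omega>\<bar>) ` I)) \<in> borel_measurable M"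
    using I by (intro borel_measurable_Max psi_boundedD(2)[OF abs]) auto
  moreover have "\<bar>MAX i\<in>I. \<bar>\<xi> i \<omega>\<bar>\<bar> \<le> \<bar>\<Sum>i\<in>I. \<bar>\<xi> i \<omega>\<bar>\<bar>" for \<omega>
  proof -
    have "(MAX i\<in>I. \<bar>\<xi> i \<omega>\<bar>) \<le> (\<Sum>i\<in>I. \<bar>\<xi> i \<omega>\<bar>)"
      using I by (subst Max_le_iff) (auto intro!: member_le_sum)
    moreover have "0 \<le> (MAX i\<in>I. \<bar>\<xi> i \<omega>\<bar>)"
      using I by (subst Max_ge_iff) auto
    ultimately show ?thesis by (simp add: sum_nonneg)
  qed
  ultimately show ?thesis
    by (intro psi_bounded_mono[OF psi_bounded_sum[of I M \<psi> B "\<lambda>i \<omega>. \<bar>\<xi> i \<omega>\<bar>", OF abs \<psi>] _ _ order_refl \<psi>]) auto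
qed

text \<open>Every point of the \<open>K\<close>-th net is joined to the single point \<open>t\<^sub>0\<close> of the initial net by
  projecting it successively to the coarser nets, so that the value of the process there is at most
  \<open>\<bar>Y(t\<^sub>0)\<bar>\<close> plus the maximal increments \<open>D\<^sub>k\<close> of all links. Up to an error that tends to 0 the
  same holds at an arbitrary point, almost surely.\<close>

lemma (in prob_space) chaining:
  fixes Y :: "'t \<Rightarrow> 'a \<Rightarrow> real" and net :: "nat \<Rightarrow> nat \<Rightarrow> 't" and \<alpha> :: "nat \<Rightarrow> 't \<Rightarrow> 't"
  assumes \<psi>: "\<And>u. 1 \<le> u \<Longrightarrow> 0 < \<psi> u"
    and \<alpha>: "\<And>k t. t \<in> T \<Longrightarrow> \<alpha> k t \<in> net k ` {1..n k}"
    and net: "\<And>k i. i \<in> {1..n k} \<Longrightarrow> net k i \<in> T" and net0: "net 0 ` {1..n 0} = {t0}"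
    and Y: "\<And>t. t \<in> T \<Longrightarrow> square_integrable M (Y t)"
    and start: "psi_bounded M \<psi> b0 (Y t0)"
    and link: "\<And>k. psi_bounded M \<psi> (b k)
      (\<lambda>\<omega>. MAX i\<in>{1..n (Suc k)}. \<bar>Y (net (Suc k) i) \<omega> - Y (\<alpha> k (net (Suc k) i)) \<omega>\<bar>)"
    and total: "\<And>K. (\<Sum>k<K. b k) \<le> s"
    and proj: "\<And>t. t \<in> T \<Longrightarrow> summable (\<lambda>k. (norm2 M (\<lambda>\<omega>. Y t \<omega> - Y (\<alpha> k t) \<omega>))\<^sup>2)"
    and S: "countable S" "S \<subseteq> T"
  shows "\<exists>Z. psi_bounded M \<psi> (b0 + s) Z \<and> (AE \<omega> in M. \<forall>t\<in>S. \<bar>Y t \<omega>\<bar> \<le> Z \<omega>)"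
proof -
  define D where "D k \<omega> = (MAX i\<in>{1..n (Suc k)}. \<bar>Y (net (Suc k) i) \<omega> - Y (\<alpha> k (net (Suc k) i)) \<omega>\<bar>)"
    for k \<omega>
  define W where "W K \<omega> = \<bar>Y t0 \<omega>\<bar> + (\<Sum>k<K. D k \<omega>)" for K \<omega>
  have "t0 \<in> net 0 ` {1..n 0}" using net0 by simp
  then have t0: "t0 \<in> T" by (auto intro: net)
  have n: "1 \<le> n k" for k
    using \<alpha>[OF t0, of k] by (cases "n k") auto
  have D_ge: "\<bar>Y x \<omega> - Y (\<alpha> k x) \<omega>\<bar> \<le> D k \<omega>" if "x \<in> net (Suc k) ` {1..n (Suc k)}" for k x \<omega>
    unfolding D_def using that by (auto intro!: Max_ge)
  have D_nonneg: "0 \<le> D k \<omega>" for k \<omega>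
    using D_ge[of "net (Suc k) 1" k \<omega>] n[of "Suc k"] by (force intro: order_trans[OF abs_ge_zero])
  have W_ge: "\<bar>Y x \<omega>\<bar> \<le> W K \<omega>" if "x \<in> net K ` {1..n K}" for x K \<omega>
    using that
  proof (induction K arbitrary: x)
    case 0
    then show ?case using net0 by (simp add: W_def)
  next
    case (Suc K)
    have "x \<in> T" using Suc.prems net by auto
    then have "\<bar>Y (\<alpha> K x) \<omega>\<bar> \<le> W K \<omega>" by (intro Suc.IH \<alpha>)
    moreover have "\<bar>Y x \<omega> - Y (\<alpha> K x) \<omega>\<bar> \<le> D K \<omega>" by (rule D_ge[OF Suc.prems])
    ultimately show ?case by (simp add: W_def)
  qed
  have W_mono: "incseq (\<lambda>K. W K \<omega>)" for \<omega>
    by (intro incseq_SucI) (simp add: W_def D_nonneg)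
  have W_nonneg: "0 \<le> W K \<omega>" for K \<omega>
    by (simp add: W_def sum_nonneg D_nonneg)
  have W: "psi_bounded M \<psi> (b0 + s) (W K)" for K
  proof -
    have "psi_bounded M \<psi> b0 (\<lambda>\<omega>. \<bar>Y t0 \<omega>\<bar>)" using start by (rule psi_bounded_abs)
    moreover have "psi_bounded M \<psi> (\<Sum>k<K. b k) (\<lambda>\<omega>. \<Sum>k<K. D k \<omega>)"
      using link unfolding D_def by (intro psi_bounded_sum \<psi>)
    ultimately have WK: "psi_bounded M \<psi> (b0 + (\<Sum>k<K. b k)) (W K)"
      unfolding W_def[abs_def] by (intro psi_bounded_add \<psi>)
    show ?thesis
      using total[of K] by (intro psi_bounded_mono[OF WK psi_boundedD(2)[OF WK] _ _ \<psi>]) auto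
  qed
  note [measurable] = psi_boundedD(2)[OF W]
  have "(\<integral>\<^sup>+\<omega>. (SUP K. ennreal (W K \<omega>)) \<partial>M) = (SUP K. \<integral>\<^sup>+\<omega>. ennreal (W K \<omega>) \<partial>M)"
    using W_mono by (intro nn_integral_monotone_convergence_SUP)
      (auto simp: incseq_def le_fun_def intro!: ennreal_leI)
  also have "\<dots> \<le> ennreal (((b0 + s) * \<psi> 1) powr 1)"
  proof (rule SUP_least)
    fix K
    show "(\<integral>\<^sup>+\<omega>. ennreal (W K \<omega>) \<partial>M) \<le> ennreal (((b0 + s) * \<psi> 1) powr 1)"
      using psi_boundedD(3)[OF W[of K], of 1] W_nonneg by simp
  qed
  also have "\<dots> < \<infinity>" by simp
  finally have fin: "AE \<omega> in M. (SUP K. ennreal (W K \<omega>)) \<noteq> \<infinity>"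
    by (intro nn_integral_noteq_infinite) auto
  define Z where "Z \<omega> = lim (\<lambda>K. W K \<omega>)" for \<omega>
  have lim: "AE \<omega> in M. (\<lambda>K. W K \<omega>) \<longlonglongrightarrow> Z \<omega>"
    using fin
  proof eventually_elim
    case (elim \<omega>)
    then obtain r where r: "0 \<le> r" "(SUP K. ennreal (W K \<omega>)) = ennreal r"
      by (cases "SUP K. ennreal (W K \<omega>)") auto
    have "W K \<omega> \<le> r" for K
      using SUP_upper[of K UNIV "\<lambda>K. ennreal (W K \<omega>)"] r by (simp add: ennreal_le_iff)
    then obtain L where "(\<lambda>K. W K \<omega>) \<longlonglongrightarrow> L"
      using incseq_convergent[OF W_mono] by blast
    then show ?case by (simp add: Z_def limI)
  qed
  have "Z \<in> borel_measurable M" unfolding Z_def[abs_def] by measurable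
  then have Z: "psi_bounded M \<psi> (b0 + s) Z"
    by (intro psi_bounded_AE_limit[OF W lim tendsto_const _ \<psi>])
  have "AE \<omega> in M. \<forall>t\<in>S. (\<lambda>k. Y t \<omega> - Y (\<alpha> k t) \<omega>) \<longlonglongrightarrow> 0"
  proof (subst AE_ball_countable[OF S(1)], intro ballI AE_tendsto_0)
    fix t k assume t: "t \<in> S"
    have "\<alpha> k t \<in> net k ` {1..n k}" using t S(2) by (intro \<alpha>) auto
    then obtain i where "i \<in> {1..n k}" "\<alpha> k t = net k i" by blast
    then have "\<alpha> k t \<in> T" by (simp only: net)
    then show "square_integrable M (\<lambda>\<omega>. Y t \<omega> - Y (\<alpha> k t) \<omega>)"
      using t S(2) by (intro square_integrable_diff Y) auto
  qed (use S(2) proj in auto)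
  then have "AE \<omega> in M. \<forall>t\<in>S. \<bar>Y t \<omega>\<bar> \<le> Z \<omega>"
    using lim
  proof eventually_elim
    case (elim \<omega>)
    show ?case
    proof
      fix t assume t: "t \<in> S"
      have "\<bar>Y t \<omega>\<bar> \<le> W k \<omega> + \<bar>Y t \<omega> - Y (\<alpha> k t) \<omega>\<bar>" for k
        using W_ge[OF \<alpha>, of t k \<omega>] t S(2) by auto
      moreover have "(\<lambda>k. W k \<omega> + \<bar>Y t \<omega> - Y (\<alpha> k t) \<omega>\<bar>) \<longlonglongrightarrow> Z \<omega> + \<bar>0\<bar>"
        using elim t by (intro tendsto_add tendsto_rabs) auto
      ultimately show "\<bar>Y t \<omega>\<bar> \<le> Z \<omega>"
        by (intro LIMSEQ_le_const[where a = "\<bar>Y t \<omega>\<bar>"]) auto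
    qed
  qed
  with Z show ?thesis by blast
qed

context strictly_F_psi_process
begin

text \<open>For a single variable \<open>\<eta> \<noteq> 0\<close> the defining inequality reads \<open>\<parallel>\<eta>\<parallel>\<^sub>\<psi> \<le> \<kappa>(1) \<parallel>\<eta>\<parallel>\<^sub>\<psi>\<close>, whence
  \<open>\<kappa>(1) \<ge> 1\<close>.\<close>

lemma majorizing_characteristic_nonneg:
  assumes maj: "majorizing_characteristic M \<psi> (SF_space M \<psi> (X ` T)) \<kappa>"
    and \<eta>: "\<eta> \<in> H" "norm2 M \<eta> \<noteq> 0" and n: "1 \<le> n"
  shows "0 \<le> \<kappa> n"
proof -
  have F: "\<eta> \<in> F_psi M \<psi>" by (rule H_F_psi[OF \<eta>(1)])
  have "psi_norm M \<psi> \<eta> \<noteq> 0"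
  proof
    assume "psi_norm M \<psi> \<eta> = 0"
    then have "psi_bounded M \<psi> 0 \<eta>" using F psi_bounded_iff[of \<psi> M, OF psi_pos] by simp
    from psi_bounded_integrable(2)[OF this, of 2] have "(\<integral>\<omega>. (\<eta> \<omega>)\<^sup>2 \<partial>M) \<le> 0" by simp
    then have "norm2 M \<eta> = 0" by (simp add: norm2_def antisym)
    then show False using \<eta>(2) by simp
  qed
  then have pos: "0 < psi_norm M \<psi> \<eta>"
    using psi_norm_nonneg[OF F psi_pos] by simp
  have "\<forall>i\<in>{1..1::nat}. \<eta> \<in> SF_space M \<psi> (X ` T)" using \<eta>(1) H_subset_SF_space by auto
  then have "psi_norm M \<psi> (\<lambda>\<omega>. MAX i\<in>{1..1::nat}. \<bar>\<eta> \<omega>\<bar>) \<le> \<kappa> 1 * (MAX i\<in>{1..1::nat}. psi_norm M \<psi> \<eta>)"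
    using maj[unfolded majorizing_characteristic_def, THEN conjunct2, THEN spec[of _ 1]]
    by (elim impE allE[of _ "\<lambda>_. \<eta>"]) auto
  then have "psi_norm M \<psi> \<eta> \<le> \<kappa> 1 * psi_norm M \<psi> \<eta>"
    by (simp add: psi_norm_def)
  then have "1 \<le> \<kappa> 1" using pos by simp
  also have "\<kappa> 1 \<le> \<kappa> n"
    using maj n by (auto simp: majorizing_characteristic_def intro: mono_onD)
  finally show ?thesis by simp
qed

lemma majorizing_characteristic_max:
  assumes maj: "majorizing_characteristic M \<psi> (SF_space M \<psi> (X ` T)) \<kappa>"
    and n: "1 \<le> n" "0 \<le> \<kappa> n" and \<xi>: "\<And>i. i \<in> {1..n} \<Longrightarrow> \<xi> i \<in> H"
    and r: "\<And>i. i \<in> {1..n} \<Longrightarrow> norm2 M (\<xi> i) \<le> r"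
  shows "psi_bounded M \<psi> (\<kappa> n * (C * r)) (\<lambda>\<omega>. MAX i\<in>{1..n}. \<bar>\<xi> i \<omega>\<bar>)"
proof -
  have "psi_bounded M \<psi> (\<Sum>i\<in>{1..n}. C * norm2 M (\<xi> i)) (\<lambda>\<omega>. MAX i\<in>{1..n}. \<bar>\<xi> i \<omega>\<bar>)"
    using n by (intro psi_bounded_max H_psi_bounded \<xi> psi_pos) auto
  then have "(\<lambda>\<omega>. MAX i\<in>{1..n}. \<bar>\<xi> i \<omega>\<bar>) \<in> F_psi M \<psi>"
    using psi_bounded_iff[of \<psi> M, OF psi_pos] by blast
  moreover have "psi_norm M \<psi> (\<lambda>\<omega>. MAX i\<in>{1..n}. \<bar>\<xi> i \<omega>\<bar>) \<le> \<kappa> n * (MAX i\<in>{1..n}. psi_norm M \<psi> (\<xi> i))"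
    using maj[unfolded majorizing_characteristic_def, THEN conjunct2, THEN spec[of _ n]] n(1) \<xi>
      H_subset_SF_space by (elim impE allE[of _ \<xi>]) auto
  moreover have "\<kappa> n * (MAX i\<in>{1..n}. psi_norm M \<psi> (\<xi> i)) \<le> \<kappa> n * (C * r)"
  proof (intro mult_left_mono n)
    have "psi_norm M \<psi> (\<xi> i) \<le> C * r" if "i \<in> {1..n}" for i
      by (rule order_trans[OF H_psi_norm[OF \<xi>[OF that]] mult_left_mono[OF r[OF that]]])
        (use C_pos in simp)
    then show "(MAX i\<in>{1..n}. psi_norm M \<psi> (\<xi> i)) \<le> C * r"
      using n(1) by (subst Max_le_iff) auto
  qed
  ultimately show ?thesis
    using psi_bounded_iff[of \<psi> M, OF psi_pos] by simp
qed

end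

text \<open>Chaining sees the remainder only through these properties: its values lie in \<open>H\<close>, where
  mean-square increments control the norm of \<open>F\<^sub>\<psi>\<close>, and \<open>\<sigma>\<close> bounds those increments.\<close>

locale entropy_process = strictly_F_psi_process M \<psi> T X C
  for M :: "'w measure" and \<psi> and T :: "'t::metric_space set" and X :: "'t \<Rightarrow> 'w \<Rightarrow> real" and C +
  fixes Y :: "'t \<Rightarrow> 'w \<Rightarrow> real" and \<kappa> :: "nat \<Rightarrow> real" and \<sigma> :: "real \<Rightarrow> real"
  assumes compact: "compact T"
    and majorizing: "majorizing_characteristic M \<psi> (SF_space M \<psi> (X ` T)) \<kappa>"
    and \<kappa>_nonneg: "\<And>n. 1 \<le> n \<Longrightarrow> 0 \<le> \<kappa> n"
    and Y: "\<And>t. t \<in> T \<Longrightarrow> Y t \<in> H"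
    and \<sigma>: "continuous_on {0..} \<sigma>" "strict_mono_on {0..} \<sigma>" "\<sigma> 0 = 0"
    and modulus_pos: "\<And>h t s. 0 < h \<Longrightarrow> t \<in> T \<Longrightarrow> s \<in> T \<Longrightarrow> dist t s \<le> h \<Longrightarrow>
      norm2 M (\<lambda>\<omega>. Y t \<omega> - Y s \<omega>) \<le> \<sigma> h"
    and entropy: "\<exists>z>0. set_integrable lborel {0<..<z} (entropy_integrand T \<kappa> C \<sigma>)"
begin

lemma Y_square_integrable: "t \<in> T \<Longrightarrow> square_integrable M (Y t)"
  by (rule l2_closed_span_square_integrable[OF Y])

lemma modulus:
  assumes "0 \<le> h" "t \<in> T" "s \<in> T" "dist t s \<le> h"
  shows "norm2 M (\<lambda>\<omega>. Y t \<omega> - Y s \<omega>) \<le> \<sigma> h"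
proof (cases "h = 0")
  case True
  then have "t = s" using assms by simp
  then show ?thesis using True \<sigma>(3) by (simp add: norm2_def)
qed (use assms modulus_pos in auto)

abbreviation F :: "real \<Rightarrow> real" where
  "F \<equiv> entropy_integrand T \<kappa> C \<sigma>"

definition \<gamma> :: real where
  "\<gamma> = C * \<sigma> (diameter T)"

lemma diameter_nonneg: "0 \<le> diameter T"
  by (intro diameter_ge_0 compact_imp_bounded compact)

lemma \<sigma>_le: "0 \<le> x \<Longrightarrow> 0 \<le> y \<Longrightarrow> \<sigma> x \<le> \<sigma> y \<longleftrightarrow> x \<le> y"
  using strict_mono_on_less_eq[OF \<sigma>(2), of x y] by simp

lemma \<gamma>_nonneg: "0 \<le> \<gamma>"
  using \<sigma>_le[of 0 "diameter T"] \<sigma>(3) diameter_nonneg C_pos by (simp add: \<gamma>_def)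

abbreviation \<sigma>_inv :: "real \<Rightarrow> real" where
  "\<sigma>_inv \<equiv> the_inv_into {0..} \<sigma>"

lemma \<sigma>_inv:
  assumes "0 \<le> u" "u \<le> \<gamma>"
  shows "0 \<le> \<sigma>_inv (u / C)" "\<sigma> (\<sigma>_inv (u / C)) = u / C"
  using the_inv_into_modulus[OF \<sigma>, of "u / C" "diameter T"] assms C_pos diameter_nonneg
  by (auto simp: \<gamma>_def field_simps)

lemma \<sigma>_inv_pos:
  assumes "0 < u" "u \<le> \<gamma>"
  shows "0 < \<sigma>_inv (u / C)"
proof -
  have "\<sigma>_inv (u / C) \<noteq> 0"
    using \<sigma>_inv(2)[of u] assms \<sigma>(3) C_pos by auto
  then show ?thesis using \<sigma>_inv(1)[of u] assms by simp
qed

lemma F_nonneg: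
  assumes "0 < u" "u < \<gamma>"
  shows "0 \<le> F u"
  unfolding entropy_integrand_def using assms
  by (intro \<kappa>_nonneg metric_massiveness_pos compact nonempty \<sigma>_inv_pos) auto

lemma F_antimono:
  assumes "0 < x" "x \<le> y" "y < \<gamma>"
  shows "F y \<le> F x"
proof -
  have "x / C \<le> y / C" using assms C_pos by (simp add: divide_right_mono)
  then have le: "\<sigma>_inv (x / C) \<le> \<sigma>_inv (y / C)"
    using \<sigma>_inv[of x] \<sigma>_inv[of y] \<sigma>_le[of "\<sigma>_inv (x / C)" "\<sigma>_inv (y / C)"] assms by simp
  have "1 \<le> metric_massiveness T (\<sigma>_inv (y / C))"
    using assms by (intro metric_massiveness_pos compact nonempty \<sigma>_inv_pos) auto
  moreover have "metric_massiveness T (\<sigma>_inv (y / C)) \<le> metric_massiveness T (\<sigma>_inv (x / C))"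
    using assms by (intro metric_massiveness_antimono compact le \<sigma>_inv_pos) auto
  ultimately show ?thesis
    unfolding entropy_integrand_def using majorizing
    by (auto simp: majorizing_characteristic_def intro: mono_onD)
qed

text \<open>The radii \<open>\<epsilon>\<^sub>k\<close> of the nets are chosen such that the bounds \<open>C \<sigma>(\<epsilon>\<^sub>k) = \<gamma> p\<^sup>k\<close> of the
  increments form a geometric sequence. The \<open>k\<close>-th link then contributes
  \<open>\<kappa>(N(\<epsilon>\<^sub>k)) \<gamma> p\<^sup>k\<^sup>-\<^sup>1\<close>, which is at most \<open>1 / (p (1 - p))\<close> times the entropy integral over the
  interval from \<open>\<gamma> p\<^sup>k\<^sup>+\<^sup>1\<close> to \<open>\<gamma> p\<^sup>k\<close>.\<close>

lemma chain_bound: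
  assumes t0: "t0 \<in> T" and p: "0 < p" "p < 1" and S: "countable S" "S \<subseteq> T"
  shows "\<exists>Z. psi_bounded M \<psi>
      (C * norm2 M (Y t0) + 1 / (p * (1 - p)) * (LINT u:{0<..<\<gamma> * p}|lborel. F u)) Z \<and>
    (AE \<omega> in M. \<forall>t\<in>S. \<bar>Y t \<omega>\<bar> \<le> Z \<omega>)"
proof -
  define \<epsilon> where "\<epsilon> k = \<sigma>_inv (\<gamma> * p^k / C)" for k :: nat
  have \<gamma>k: "0 \<le> \<gamma> * p^k" "\<gamma> * p^k \<le> \<gamma>" for k :: nat
    using \<gamma>_nonneg p mult_left_mono[of "p^k" 1 \<gamma>] by (auto simp: power_le_one)
  have \<epsilon>: "0 \<le> \<epsilon> k" "C * \<sigma> (\<epsilon> k) = \<gamma> * p^k" for k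
    using \<sigma>_inv[OF \<gamma>k[of k]] C_pos by (auto simp: \<epsilon>_def)
  have dist_le: "dist s t \<le> diameter T" if "s \<in> T" "t \<in> T" for s t
    using that by (intro diameter_bounded_bound compact_imp_bounded compact)
  define good where "good k m c \<longleftrightarrow> (\<forall>i\<in>{1..m}. c i \<in> T) \<and>
      (\<forall>t\<in>T. \<exists>x\<in>c ` {1..m}. dist t x \<le> \<epsilon> k) \<and>
      (k \<noteq> 0 \<longrightarrow> \<kappa> m * (\<gamma> * p^k) = F (\<gamma> * p^k) * (\<gamma> * p^k)) \<and>
      (k = 0 \<longrightarrow> c ` {1..m} = {t0})" for k and m :: nat and c :: "nat \<Rightarrow> 't"
  have "\<exists>m c. good k m c" for k
  proof (cases "k = 0 \<or> \<gamma> = 0")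
    \<comment> \<open>One point suffices because the radius is at least the diameter of \<open>T\<close>; if \<open>\<gamma> = 0\<close>, that
      diameter is 0.\<close>
    case True
    have "diameter T \<le> \<epsilon> k"
    proof -
      have "C * \<sigma> (diameter T) \<le> C * \<sigma> (\<epsilon> k)"
        using True \<epsilon>(2)[of k] by (auto simp: \<gamma>_def)
      then show ?thesis using \<sigma>_le[OF diameter_nonneg \<epsilon>(1)] C_pos by simp
    qed
    then have "good k 1 (\<lambda>_. t0)"
      using True t0 dist_le[OF _ t0] by (auto simp: good_def intro: order_trans)
    then show ?thesis by blast
  next
    case False
    then have "0 < \<gamma> * p^k" using \<gamma>_nonneg p by simp
    then have pos: "0 < \<epsilon> k" unfolding \<epsilon>_def by (intro \<sigma>_inv_pos \<gamma>k)
    define m where "m = metric_massiveness T (\<epsilon> k)"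
    obtain c where c: "\<forall>i<m. c i \<in> T" "T \<subseteq> (\<Union>i<m. cball (c i) (\<epsilon> k))"
      using metric_massiveness_cover[OF compact pos] unfolding m_def by blast
    have "\<exists>x\<in>(\<lambda>i. c (i - 1)) ` {1..m}. dist t x \<le> \<epsilon> k" if t: "t \<in> T" for t
    proof -
      obtain i where "i < m" "dist (c i) t \<le> \<epsilon> k" using c(2) t by auto
      then show ?thesis by (intro bexI[of _ "c i"]) (auto simp: dist_commute intro!: image_eqI[of _ _ "Suc i"])
    qed
    then have "good k m (\<lambda>i. c (i - 1))"
      using False c(1) by (auto simp: good_def m_def \<epsilon>_def entropy_integrand_def)
    then show ?thesis by blast
  qed
  then obtain n net where good: "\<And>k. good k (n k) (net k)" by metis
  have net_T: "\<forall>i\<in>{1..n k}. net k i \<in> T"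
    and net_cover: "\<forall>t\<in>T. \<exists>x\<in>net k ` {1..n k}. dist t x \<le> \<epsilon> k"
    and net_F: "k \<noteq> 0 \<longrightarrow> \<kappa> (n k) * (\<gamma> * p^k) = F (\<gamma> * p^k) * (\<gamma> * p^k)"
    and net_0: "k = 0 \<longrightarrow> net k ` {1..n k} = {t0}" for k
    using good[of k] unfolding good_def by - (elim conjE; assumption)+
  have "\<forall>k t. \<exists>x. t \<in> T \<longrightarrow> x \<in> net k ` {1..n k} \<and> dist t x \<le> \<epsilon> k"
  proof (intro allI)
    fix k t
    show "\<exists>x. t \<in> T \<longrightarrow> x \<in> net k ` {1..n k} \<and> dist t x \<le> \<epsilon> k"
      using net_cover[of k] by blast
  qed
  then obtain \<alpha> where \<alpha>: "\<And>k t. t \<in> T \<Longrightarrow> \<alpha> k t \<in> net k ` {1..n k}"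
    and \<alpha>_dist: "\<And>k t. t \<in> T \<Longrightarrow> dist t (\<alpha> k t) \<le> \<epsilon> k"
    by metis
  have net: "net k i \<in> T" if "i \<in> {1..n k}" for k i
    using net_T[of k] that by blast
  have \<alpha>T: "\<alpha> k t \<in> T" if "t \<in> T" for k t
    using \<alpha>[OF that, of k] net by auto
  have n: "1 \<le> n k" for k
    using \<alpha>[OF t0, of k] by (cases "n k") auto
  have proj: "norm2 M (\<lambda>\<omega>. Y t \<omega> - Y (\<alpha> k t) \<omega>) \<le> \<sigma> (\<epsilon> k)" if "t \<in> T" for k t
    using that by (intro modulus \<epsilon> \<alpha>T \<alpha>_dist)
  show ?thesis
  proof (rule chaining[where T = T and \<alpha> = \<alpha> and net = net and n = n
        and b = "\<lambda>k. \<kappa> (n (Suc k)) * (C * \<sigma> (\<epsilon> k))"])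
    show "net 0 ` {1..n 0} = {t0}" using net_0[of 0] by simp
    show "psi_bounded M \<psi> (C * norm2 M (Y t0)) (Y t0)" by (intro H_psi_bounded Y t0)
    show "psi_bounded M \<psi> (\<kappa> (n (Suc k)) * (C * \<sigma> (\<epsilon> k)))
        (\<lambda>\<omega>. MAX i\<in>{1..n (Suc k)}. \<bar>Y (net (Suc k) i) \<omega> - Y (\<alpha> k (net (Suc k) i)) \<omega>\<bar>)" for k
      by (intro majorizing_characteristic_max[OF majorizing] n \<kappa>_nonneg l2_closed_span_diff[OF X]
        Y proj \<alpha>T net)
    show "(\<Sum>k<K. \<kappa> (n (Suc k)) * (C * \<sigma> (\<epsilon> k)))
        \<le> 1 / (p * (1 - p)) * (LINT u:{0<..<\<gamma> * p}|lborel. F u)" for K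
    proof -
      have int: "set_integrable lborel {0<..<\<gamma> * p} F"
      proof (cases "\<gamma> = 0")
        case False
        then have "\<gamma> * p < \<gamma>" using \<gamma>_nonneg p by simp
        moreover obtain z where "0 < z" "set_integrable lborel {0<..<z} F" using entropy by blast
        ultimately show ?thesis
          by (intro antimono_set_integrable[of \<gamma> F z "\<gamma> * p"] F_antimono F_nonneg)
      qed (simp add: set_integrable_def)
      have "\<kappa> (n (Suc k)) * (C * \<sigma> (\<epsilon> k))
          = 1 / (p * (1 - p)) * (F (\<gamma> * p^Suc k) * (\<gamma> * p^Suc k * (1 - p)))" for k
      proof -
        have "\<kappa> (n (Suc k)) * (C * \<sigma> (\<epsilon> k)) = \<kappa> (n (Suc k)) * (\<gamma> * p^Suc k) / p"
          unfolding \<epsilon>(2) using p by simp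
        also have "\<kappa> (n (Suc k)) * (\<gamma> * p^Suc k) = F (\<gamma> * p^Suc k) * (\<gamma> * p^Suc k)"
          using net_F[of "Suc k"] by simp
        also have "\<dots> / p = 1 / (p * (1 - p)) * (F (\<gamma> * p^Suc k) * (\<gamma> * p^Suc k * (1 - p)))"
          using p by (simp del: power_Suc)
        finally show ?thesis .
      qed
      then have "(\<Sum>k<K. \<kappa> (n (Suc k)) * (C * \<sigma> (\<epsilon> k)))
          = 1 / (p * (1 - p)) * (\<Sum>k=1..K. F (\<gamma> * p^k) * (\<gamma> * p^k * (1 - p)))"
        by (simp add: sum_distrib_left sum.atLeast1_atMost_eq del: power_Suc)
      also have "\<dots> \<le> 1 / (p * (1 - p)) * (LINT u:{0<..<\<gamma> * p}|lborel. F u)"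
        using p by (intro mult_left_mono antimono_geometric_sum_le[of \<gamma> F p K] F_antimono
          F_nonneg int \<gamma>_nonneg) auto
      finally show ?thesis .
    qed
    show "summable (\<lambda>k. (norm2 M (\<lambda>\<omega>. Y t \<omega> - Y (\<alpha> k t) \<omega>))\<^sup>2)" if t: "t \<in> T" for t
    proof (rule summable_comparison_test'[where N = 0])
      have "summable (\<lambda>k. (p\<^sup>2)^k)"
        using p by (intro summable_geometric) (simp add: power_less_one_iff abs_square_less_1)
      then show "summable (\<lambda>k. (\<gamma> / C)\<^sup>2 * (p\<^sup>2)^k)" by (rule summable_mult)
      fix k :: nat
      have "\<sigma> (\<epsilon> k) = \<gamma> / C * p^k" using \<epsilon>(2)[of k] C_pos by (simp add: field_simps)
      then have "(norm2 M (\<lambda>\<omega>. Y t \<omega> - Y (\<alpha> k t) \<omega>))\<^sup>2 \<le> (\<gamma> / C * p^k)\<^sup>2"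
        using proj[OF t, of k] by (intro power_mono norm2_nonneg) simp
      also have "\<dots> = (\<gamma> / C)\<^sup>2 * (p\<^sup>2)^k"
        by (simp only: power_mult_distrib power_mult[symmetric] mult.commute[of k])
      finally show "norm ((norm2 M (\<lambda>\<omega>. Y t \<omega> - Y (\<alpha> k t) \<omega>))\<^sup>2) \<le> (\<gamma> / C)\<^sup>2 * (p\<^sup>2)^k" by simp
    qed
  qed (rule psi_pos \<alpha> net Y_square_integrable S; assumption)+
qed

end

section \<open>Suprema of separable processes\<close>

lemma borel_measurable_completion_AE:
  fixes g W :: "'a \<Rightarrow> real"
  assumes W: "W \<in> borel_measurable M" and eq: "AE \<omega> in M. g \<omega> = W \<omega>"
  shows "g \<in> borel_measurable (completion M)"
proof (rule measurableI)
  fix A :: "real set" assume A: "A \<in> sets borel"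
  have [measurable]: "Measurable.pred (completion M) (\<lambda>\<omega>. W \<omega> \<in> A)"
    using measurable_sets[OF measurable_completion[OF W] A]
    by (simp add: pred_def vimage_def Int_def conj_commute)
  have [measurable]: "Measurable.pred (completion M) (\<lambda>\<omega>. g \<omega> \<noteq> W \<omega>)"
    by (rule sets_completion_AE) (use eq in simp)
  have [measurable]: "Measurable.pred (completion M) (\<lambda>\<omega>. g \<omega> \<noteq> W \<omega> \<and> g \<omega> \<in> A)"
    by (rule sets_completion_AE) (use eq in auto)
  have "Measurable.pred (completion M)
      (\<lambda>\<omega>. (W \<omega> \<in> A \<and> \<not> g \<omega> \<noteq> W \<omega>) \<or> (g \<omega> \<noteq> W \<omega> \<and> g \<omega> \<in> A))"
    by measurable
  also have "(\<lambda>\<omega>. (W \<omega> \<in> A \<and> \<not> g \<omega> \<noteq> W \<omega>) \<or> (g \<omega> \<noteq> W \<omega> \<and> g \<omega> \<in> A)) = (\<lambda>\<omega>. g \<omega> \<in> A)"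
    by auto
  finally show "g -` A \<inter> space (completion M) \<in> sets (completion M)"
    by (simp add: pred_def vimage_def Int_def conj_commute)
qed simp

text \<open>On the right-hand side the supremum is taken in the extended reals because there a countable
  supremum of measurable functions is measurable even where the functions are unbounded.\<close>

lemma SUP_dense_subset:
  fixes y :: "'t \<Rightarrow> real"
  assumes "S \<subseteq> T" "T \<noteq> {}"
    and dense: "\<And>t \<epsilon>. t \<in> T \<Longrightarrow> 0 < \<epsilon> \<Longrightarrow> \<exists>s\<in>S. \<bar>y s - y t\<bar> < \<epsilon>"
    and bound: "\<And>s. s \<in> S \<Longrightarrow> \<bar>y s\<bar> \<le> z"
  shows "\<And>t. t \<in> T \<Longrightarrow> \<bar>y t\<bar> \<le> z"
    and "(SUP t\<in>T. y t) = real_of_ereal (SUP s\<in>S. ereal (y s))"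
proof -
  show T: "\<bar>y t\<bar> \<le> z" if t: "t \<in> T" for t
  proof (rule field_le_epsilon)
    fix \<epsilon> :: real assume "0 < \<epsilon>"
    with dense[OF t] obtain s where "s \<in> S" "\<bar>y s - y t\<bar> < \<epsilon>" by blast
    then show "\<bar>y t\<bar> \<le> z + \<epsilon>" using bound[of s] by linarith
  qed
  have S: "S \<noteq> {}" using dense[of _ 1] \<open>T \<noteq> {}\<close> by force
  have bddS: "bdd_above (y ` S)" using bound by (intro bdd_aboveI2[where M = z]) force
  have bddT: "bdd_above (y ` T)" using T by (intro bdd_aboveI2[where M = z]) force
  have "(SUP t\<in>T. y t) = (SUP s\<in>S. y s)"
  proof (rule antisym)
    show "(SUP t\<in>T. y t) \<le> (SUP s\<in>S. y s)"
    proof (rule cSUP_least[OF \<open>T \<noteq> {}\<close>], rule field_le_epsilon)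
      fix t and \<epsilon> :: real assume "t \<in> T" "0 < \<epsilon>"
      with dense obtain s where s: "s \<in> S" "\<bar>y s - y t\<bar> < \<epsilon>" by blast
      then show "y t \<le> (SUP s\<in>S. y s) + \<epsilon>" using cSUP_upper[OF s(1) bddS] by linarith
    qed
    show "(SUP s\<in>S. y s) \<le> (SUP t\<in>T. y t)"
      by (intro cSUP_subset_mono S bddT \<open>S \<subseteq> T\<close>) simp
  qed
  moreover have "ereal (SUP s\<in>S. y s) = (SUP s\<in>S. ereal (y s))"
  proof (rule ereal_SUP, rule ereal_SUP_not_infty[OF S])
    show "\<forall>s\<in>S. ereal (- z) \<le> ereal (y s) \<and> ereal (y s) \<le> ereal z"
    proof
      fix s assume "s \<in> S"
      from bound[OF this] show "ereal (- z) \<le> ereal (y s) \<and> ereal (y s) \<le> ereal z"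
        by auto
    qed
  qed auto
  ultimately show "(SUP t\<in>T. y t) = real_of_ereal (SUP s\<in>S. ereal (y s))"
    by (metis real_of_ereal.simps(1))
qed

lemma psi_bounded_square_integrable:
  assumes "psi_bounded M \<psi> B x"
  shows "square_integrable M x"
  using psi_bounded_integrable(1)[OF assms, of 2] psi_boundedD(2)[OF assms]
  by (simp add: square_integrable_def)

text \<open>For a single variable \<open>\<zeta>\<close> all linear combinations are multiples of \<open>\<zeta>\<close>, so the ratio of
  its two norms is a determining constant.\<close>

lemma strictly_F_psi_singleton:
  assumes \<zeta>: "psi_bounded M \<psi> c \<zeta>" and mean: "(\<integral>\<omega>. \<zeta> \<omega> \<partial>M) = 0"
    and \<psi>: "\<And>u. 1 \<le> u \<Longrightarrow> 0 < \<psi> u"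
  shows "\<exists>C. strictly_F_psi M \<psi> {\<zeta>} C"
proof -
  have \<zeta>2: "square_integrable M \<zeta>" by (rule psi_bounded_square_integrable[OF \<zeta>])
  note [measurable] = square_integrable_borel[OF \<zeta>2]
  \<comment> \<open>The summand 1 keeps the constant positive also if \<open>\<zeta> = 0\<close> almost surely; then the quotient
    is 0 by convention.\<close>
  define C where "C = c / norm2 M \<zeta> + 1"
  have c: "0 \<le> c" by (rule psi_boundedD(1)[OF \<zeta>])
  have C: "0 < C" using c norm2_nonneg[of M \<zeta>] by (simp add: C_def add_nonneg_pos)
  have le: "psi_bounded M \<psi> (C * norm2 M \<zeta>) \<zeta>"
  proof (cases "norm2 M \<zeta> = 0")
    case True
    have "(\<integral>\<^sup>+\<omega>. ennreal ((\<zeta> \<omega>)\<^sup>2) \<partial>M) = 0"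
      using nn_integral_square[OF \<zeta>2] True by simp
    then have "AE \<omega> in M. ennreal ((\<zeta> \<omega>)\<^sup>2) = 0"
      by (subst (asm) nn_integral_0_iff_AE) auto
    then have "AE \<omega> in M. \<bar>\<zeta> \<omega>\<bar> \<le> \<bar>0\<bar>"
      by eventually_elim (simp add: ennreal_eq_0_iff)
    then show ?thesis
      using True by (intro psi_bounded_mono[OF psi_bounded_zero _ _ _ \<psi>]) auto
  next
    case False
    then have "c \<le> C * norm2 M \<zeta>"
      using norm2_nonneg[of M \<zeta>] by (simp add: C_def distrib_right)
    then show ?thesis
      by (intro psi_bounded_mono[OF \<zeta> _ _ _ \<psi>]) auto
  qed
  have "strictly_F_psi M \<psi> {\<zeta>} C"
  proof (rule strictly_F_psiI[OF C])
    fix n and a :: "nat \<Rightarrow> real" and \<xi> :: "nat \<Rightarrow> 'a \<Rightarrow> real" assume "\<And>i. \<xi> i \<in> {\<zeta>}"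
    then have "(\<lambda>\<omega>. \<Sum>i<n. a i * \<xi> i \<omega>) = (\<lambda>\<omega>. (\<Sum>i<n. a i) * \<zeta> \<omega>)"
      by (simp add: sum_distrib_right)
    then show "psi_bounded M \<psi> (C * norm2 M (\<lambda>\<omega>. \<Sum>i<n. a i * \<xi> i \<omega>)) (\<lambda>\<omega>. \<Sum>i<n. a i * \<xi> i \<omega>)"
      using psi_bounded_cmult[OF le \<psi>, of "\<Sum>i<n. a i"] by (simp only: norm2_cmult mult.left_commute[of C])
  qed (use mean \<zeta>2 le \<psi> psi_bounded_iff[of \<psi> M, OF \<psi>] in auto)
  then show ?thesis by blast
qed

context entropy_process
begin

context
  assumes separable: "separable_process M T Y"
begin

definition sup_Y :: "'w \<Rightarrow> real" where
  "sup_Y \<omega> = (SUP t\<in>T. Y t \<omega>)"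

definition sup_abs_Y :: "'w \<Rightarrow> real" where
  "sup_abs_Y \<omega> = (SUP t\<in>T. \<bar>Y t \<omega>\<bar>)"

lemma Y_borel: "t \<in> T \<Longrightarrow> Y t \<in> borel_measurable M"
  by (intro square_integrable_borel Y_square_integrable)

text \<open>Separability turns the bound on a countable set of parameters into one on all of \<open>T\<close>, and
  the suprema into countable ones up to a null set.\<close>

lemma sup_facts:
  assumes t0: "t0 \<in> T" and p: "0 < p" "p < 1"
  shows "psi_bounded (completion M) \<psi>
      (C * norm2 M (Y t0) + 1 / (p * (1 - p)) * (LINT u:{0<..<\<gamma> * p}|lborel. F u)) sup_abs_Y"
    and "sup_Y \<in> borel_measurable (completion M)"
    and "AE \<omega> in M. bdd_above ((\<lambda>t. \<bar>Y t \<omega>\<bar>) ` T)"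
    and "AE \<omega> in M. \<bar>sup_Y \<omega>\<bar> \<le> \<bar>sup_abs_Y \<omega>\<bar>"
proof -
  let ?B = "C * norm2 M (Y t0) + 1 / (p * (1 - p)) * (LINT u:{0<..<\<gamma> * p}|lborel. F u)"
  obtain S where S: "countable S" "S \<subseteq> T" and dense:
    "AE \<omega> in M. \<forall>t\<in>T. \<forall>\<epsilon>>0. \<exists>s\<in>S. dist s t < \<epsilon> \<and> \<bar>Y s \<omega> - Y t \<omega>\<bar> < \<epsilon>"
    using separable unfolding separable_process_def by blast
  obtain Z where Z: "psi_bounded M \<psi> ?B Z" "AE \<omega> in M. \<forall>t\<in>S. \<bar>Y t \<omega>\<bar> \<le> Z \<omega>"
    using chain_bound[OF t0 p S] by blast
  define W where "W \<omega> = real_of_ereal (SUP s\<in>S. ereal (Y s \<omega>))" for \<omega>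
  define V where "V \<omega> = real_of_ereal (SUP s\<in>S. ereal \<bar>Y s \<omega>\<bar>)" for \<omega>
  have meas: "W \<in> borel_measurable M" "V \<in> borel_measurable M"
    unfolding W_def[abs_def] V_def[abs_def] using S Y_borel
    by (auto intro!: borel_measurable_real_of_ereal borel_measurable_SUP borel_measurable_ereal
      borel_measurable_abs)
  have all: "AE \<omega> in M. (\<forall>t\<in>T. \<bar>Y t \<omega>\<bar> \<le> Z \<omega>) \<and> sup_Y \<omega> = W \<omega> \<and> sup_abs_Y \<omega> = V \<omega>"
    using dense Z(2)
  proof eventually_elim
    case (elim \<omega>)
    have d: "\<exists>s\<in>S. \<bar>Y s \<omega> - Y t \<omega>\<bar> < \<epsilon>" if "t \<in> T" "0 < \<epsilon>" for t \<epsilon>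
      using elim that by blast
    have d': "\<exists>s\<in>S. \<bar>\<bar>Y s \<omega>\<bar> - \<bar>Y t \<omega>\<bar>\<bar> < \<epsilon>" if "t \<in> T" "0 < \<epsilon>" for t \<epsilon>
      using d[OF that] by (auto intro: le_less_trans[OF abs_triangle_ineq3])
    have b: "\<bar>Y s \<omega>\<bar> \<le> Z \<omega>" "\<bar>\<bar>Y s \<omega>\<bar>\<bar> \<le> Z \<omega>" if "s \<in> S" for s
      using elim that by auto
    show ?case
      using SUP_dense_subset[OF S(2) nonempty d b(1)] SUP_dense_subset(2)[OF S(2) nonempty d' b(2)]
      by (auto simp: sup_Y_def sup_abs_Y_def W_def V_def)
  qed
  show "sup_Y \<in> borel_measurable (completion M)"
    using all by (intro borel_measurable_completion_AE[OF meas(1)]) auto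
  have sup_abs: "sup_abs_Y \<in> borel_measurable (completion M)"
    using all by (intro borel_measurable_completion_AE[OF meas(2)]) auto
  show bdd: "AE \<omega> in M. bdd_above ((\<lambda>t. \<bar>Y t \<omega>\<bar>) ` T)"
    using all by eventually_elim (auto intro: bdd_aboveI2)
  show "AE \<omega> in M. \<bar>sup_Y \<omega>\<bar> \<le> \<bar>sup_abs_Y \<omega>\<bar>"
    using bdd
  proof eventually_elim
    case (elim \<omega>)
    have le: "\<bar>Y t \<omega>\<bar> \<le> sup_abs_Y \<omega>" if "t \<in> T" for t
      unfolding sup_abs_Y_def by (intro cSUP_upper elim that)
    have "bdd_above ((\<lambda>t. Y t \<omega>) ` T)"
      using le by (intro bdd_aboveI2[where M = "sup_abs_Y \<omega>"]) force
    then have "Y t0 \<omega> \<le> sup_Y \<omega>"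
      unfolding sup_Y_def by (intro cSUP_upper t0)
    moreover have "sup_Y \<omega> \<le> sup_abs_Y \<omega>"
      unfolding sup_Y_def using le by (intro cSUP_least nonempty) force
    ultimately show ?case using le[OF t0] by linarith
  qed
  have "AE \<omega> in M. \<bar>sup_abs_Y \<omega>\<bar> \<le> \<bar>Z \<omega>\<bar>"
    using all
  proof eventually_elim
    case (elim \<omega>)
    have "\<bar>Y t0 \<omega>\<bar> \<le> sup_abs_Y \<omega>"
      unfolding sup_abs_Y_def using elim by (intro cSUP_upper t0 bdd_aboveI2) auto
    moreover have "sup_abs_Y \<omega> \<le> Z \<omega>"
      unfolding sup_abs_Y_def using elim by (intro cSUP_least nonempty) auto
    ultimately show ?case by linarith
  qed
  then show "psi_bounded (completion M) \<psi> ?B sup_abs_Y"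
    by (intro psi_bounded_mono[OF psi_bounded_completion[OF Z(1)] sup_abs _ order_refl psi_pos]
      AE_completion)
qed

text \<open>The initial point of the chain is arbitrary, which produces the infimum over \<open>T\<close>.\<close>

lemma sup_abs_Y_bounded:
  assumes p: "0 < p" "p < 1"
  shows "psi_bounded (completion M) \<psi> (sup_bound M T Y \<kappa> C \<sigma> p) sup_abs_Y"
proof -
  let ?I = "1 / (p * (1 - p)) * (LINT u:{0<..<\<gamma> * p}|lborel. F u)"
  have iff: "psi_bounded (completion M) \<psi> B sup_abs_Y \<longleftrightarrow>
      sup_abs_Y \<in> F_psi (completion M) \<psi> \<and> psi_norm (completion M) \<psi> sup_abs_Y \<le> B" for B
    using psi_pos by (rule psi_bounded_iff)
  have "psi_norm (completion M) \<psi> sup_abs_Y - ?I \<le> (INF t\<in>T. C * norm2 M (Y t))"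
    using sup_facts(1)[OF _ p] unfolding iff by (intro cINF_greatest nonempty) (auto simp: algebra_simps)
  moreover have "sup_abs_Y \<in> F_psi (completion M) \<psi>"
    using sup_facts(1)[OF _ p] nonempty unfolding iff by blast
  ultimately show ?thesis
    unfolding iff sup_bound_def Let_def \<gamma>_def by simp
qed

lemma sup_Y_bounded: "\<exists>c. psi_bounded (completion M) \<psi> c sup_Y"
proof -
  obtain t0 where t0: "t0 \<in> T" using nonempty by blast
  have half: "0 < (1/2 :: real)" "1/2 < (1 :: real)" by auto
  note facts = sup_facts[OF t0 half]
  show ?thesis
    by (rule exI, rule psi_bounded_mono[OF facts(1,2) AE_completion[OF facts(4)] order_refl psi_pos])
qed

lemma sup_Y_strictly:
  "\<exists>C'. strictly_F_psi (completion M) \<psi> {\<lambda>\<omega>. sup_Y \<omega> - (\<integral>\<omega>'. sup_Y \<omega>' \<partial>completion M)} C'"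
proof -
  interpret N: prob_space "completion M" by (rule prob_space_completion)
  obtain c where c: "psi_bounded (completion M) \<psi> c sup_Y" using sup_Y_bounded by blast
  define m where "m = (\<integral>\<omega>'. sup_Y \<omega>' \<partial>completion M)"
  have "psi_bounded (completion M) \<psi> (\<bar>- m\<bar> / \<psi> 1) (\<lambda>\<omega>. - m)"
    using psi psi_pos by (intro N.psi_bounded_const) (auto simp: psi_function_def)
  from psi_bounded_add[OF c this psi_pos]
  have b: "psi_bounded (completion M) \<psi> (c + \<bar>- m\<bar> / \<psi> 1) (\<lambda>\<omega>. sup_Y \<omega> - m)" by simp
  have "integrable (completion M) sup_Y"
    using square_integrable_mult[OF psi_bounded_square_integrable[OF c], of "\<lambda>_. 1"]
    by (simp add: square_integrable_def)
  then have "(\<integral>\<omega>. sup_Y \<omega> - m \<partial>completion M) = 0"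
    by (simp add: m_def N.prob_space[simplified])
  from strictly_F_psi_singleton[OF b this psi_pos] show ?thesis
    unfolding m_def by blast
qed

lemma sup_conclusions:
  "(AE \<omega> in M. bdd_above ((\<lambda>t. \<bar>Y t \<omega>\<bar>) ` T)) \<and>
   sup_Y \<in> F_psi (completion M) \<psi> \<and>
   (\<exists>C'. strictly_F_psi (completion M) \<psi>
      {\<lambda>\<omega>. sup_Y \<omega> - (\<integral>\<omega>'. sup_Y \<omega>' \<partial>completion M)} C') \<and>
   sup_abs_Y \<in> F_psi (completion M) \<psi> \<and>
   (\<forall>p. 0 < p \<and> p < 1 \<longrightarrow>
      psi_norm (completion M) \<psi> sup_abs_Y \<le> sup_bound M T Y \<kappa> C \<sigma> p \<and>
      (\<forall>\<epsilon>>0. measure (completion M) {\<omega> \<in> space M. sup_abs_Y \<omega> > \<epsilon>}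
         \<le> (INF u\<in>{1..}. sup_bound M T Y \<kappa> C \<sigma> p powr u * \<psi> u powr u / \<epsilon> powr u)))"
proof -
  interpret N: prob_space "completion M" by (rule prob_space_completion)
  obtain t0 where t0: "t0 \<in> T" using nonempty by blast
  have iff: "psi_bounded (completion M) \<psi> B x \<longleftrightarrow>
      x \<in> F_psi (completion M) \<psi> \<and> psi_norm (completion M) \<psi> x \<le> B" for B x
    using psi_pos by (rule psi_bounded_iff)
  have "AE \<omega> in M. bdd_above ((\<lambda>t. \<bar>Y t \<omega>\<bar>) ` T)"
    using sup_facts(3)[OF t0, of "1/2"] by simp
  moreover have "sup_Y \<in> F_psi (completion M) \<psi>"
    using sup_Y_bounded unfolding iff by blast
  moreover have "sup_abs_Y \<in> F_psi (completion M) \<psi>"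
    using sup_abs_Y_bounded[of "1/2"] unfolding iff by simp
  moreover have "psi_norm (completion M) \<psi> sup_abs_Y \<le> sup_bound M T Y \<kappa> C \<sigma> p"
    if "0 < p \<and> p < 1" for p
    using sup_abs_Y_bounded[of p] that unfolding iff by simp
  moreover have "measure (completion M) {\<omega> \<in> space M. sup_abs_Y \<omega> > \<epsilon>}
      \<le> (INF u\<in>{1..}. sup_bound M T Y \<kappa> C \<sigma> p powr u * \<psi> u powr u / \<epsilon> powr u)"
    if "0 < p \<and> p < 1" "0 < \<epsilon>" for p \<epsilon>
    using N.psi_bounded_tail[OF sup_abs_Y_bounded[of p] that(2) psi_pos] that(1)
    unfolding space_completion by simp
  ultimately show ?thesis using sup_Y_strictly by blast
qed

end

end

section \<open>The remainder of the expansion\<close>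

theorem theorem4p7:
  fixes M :: "'w measure" and \<mu> :: "'l measure" and v :: "'t::metric_space measure"
    and T :: "'t set" and X :: "'t \<Rightarrow> 'w \<Rightarrow> real" and \<psi> :: "real \<Rightarrow> real" and C :: real
    and f :: "'t \<Rightarrow> 'l \<Rightarrow> real" and g :: "nat \<Rightarrow> 'l \<Rightarrow> real" and b :: "nat \<Rightarrow> 't \<Rightarrow> real"
    and \<kappa> :: "nat \<Rightarrow> real"
  assumes "prob_space M"
    and "psi_function \<psi>"
    and "compact T"
    and "strictly_F_psi M \<psi> (X ` T) C"
    and "\<forall>t\<in>T. square_integrable M (X t) \<and> (\<integral>\<omega>. X t \<omega> \<partial>M) = 0"
    and "sigma_finite_measure \<mu>"
    and "sigma_finite_measure v" and "space v = T"
    and "\<forall>t\<in>T. square_integrable \<mu> (f t)"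
    and "square_integrable (v \<Otimes>\<^sub>M \<mu>) (\<lambda>(t, l). f t l)"
    and "\<forall>t\<in>T. \<forall>s\<in>T. (\<integral>\<omega>. X t \<omega> * X s \<omega> \<partial>M) = (\<integral>l. f t l * f s l \<partial>\<mu>)"
    and "complete_system \<mu> T f"
    and "orthonormal_basis \<mu> {1..} g"
    and "\<forall>k\<ge>1. square_integrable v (b k) \<and> (AE l in \<mu>. g k l = (\<integral>t. b k t * f t l \<partial>v))"
    and "majorizing_characteristic M \<psi> (SF_space M \<psi> (X ` T)) \<kappa>"
  shows "(\<exists>\<xi>. ms_expansion M T X (coefficient \<mu> f g) \<xi>) \<and>
    (\<forall>\<xi>. ms_expansion M T X (coefficient \<mu> f g) \<xi> \<longrightarrow>
      (let Y = remainder X (coefficient \<mu> f g) \<xi> in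
        (\<forall>t\<in>T. (\<forall>n. Y n t \<in> F_psi M \<psi>) \<and> (\<lambda>n. psi_norm M \<psi> (Y n t)) \<longlonglongrightarrow> 0) \<and>
        strictly_F_psi M \<psi> (\<xi> ` {1..}) C \<and> \<xi> ` {1..} \<subseteq> SF_space M \<psi> (X ` T) \<and>
        (\<forall>N \<sigma>. 1 \<le> N \<and>
           separable_process M T (Y N) \<and>
           continuous_on {0..} \<sigma> \<and> strict_mono_on {0..} \<sigma> \<and> \<sigma> 0 = 0 \<and>
           (\<forall>h>0. \<forall>t\<in>T. \<forall>s\<in>T. dist t s \<le> h \<longrightarrow>
              norm2 M (\<lambda>\<omega>. Y N t \<omega> - Y N s \<omega>) \<le> \<sigma> h) \<and>
           (\<exists>z>0. set_integrable lborel {0<..<z} (entropy_integrand T \<kappa> C \<sigma>)) \<longrightarrow>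
           (let sup_Y = (\<lambda>\<omega>. SUP t\<in>T. Y N t \<omega>);
                sup_abs_Y = (\<lambda>\<omega>. SUP t\<in>T. \<bar>Y N t \<omega>\<bar>);
                B = sup_bound M T (Y N) \<kappa> C \<sigma>
            in (AE \<omega> in M. bdd_above ((\<lambda>t. \<bar>Y N t \<omega>\<bar>) ` T)) \<and>
               sup_Y \<in> F_psi (completion M) \<psi> \<and>
               (\<exists>C'. strictly_F_psi (completion M) \<psi>
                  {\<lambda>\<omega>. sup_Y \<omega> - (\<integral>\<omega>'. sup_Y \<omega>' \<partial>completion M)} C') \<and>
               sup_abs_Y \<in> F_psi (completion M) \<psi> \<and>
               (\<forall>p. 0 < p \<and> p < 1 \<longrightarrow>
                  psi_norm (completion M) \<psi> sup_abs_Y \<le> B p \<and>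
                  (\<forall>\<epsilon>>0. measure (completion M) {\<omega> \<in> space M. sup_abs_Y \<omega> > \<epsilon>}
                     \<le> (INF u\<in>{1..}. B p powr u * \<psi> u powr u / \<epsilon> powr u)))))))"
proof -
  note psi = assms(2) and compact = assms(3) and strict = assms(4) and gram = assms(11)
    and complete = assms(12) and basis = assms(13) and majorizing = assms(15)
  interpret prob_space M by fact
  have X: "square_integrable M (X t)" and mean: "(\<integral>\<omega>. X t \<omega> \<partial>M) = 0" if "t \<in> T" for t
    using assms(5) that by auto
  have f: "square_integrable \<mu> (f t)" if "t \<in> T" for t
    using assms(9) that by auto
  have "T \<noteq> {}"
  proof
    \<comment> \<open>Otherwise \<open>g\<^sub>1\<close>, which has norm 1, would be approximated by the empty sum.\<close>
    assume T: "T = {}"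
    have g: "square_integrable \<mu> (g 1)" "norm2 \<mu> (g 1) = 1"
      using basis by (auto simp: orthonormal_basis_def orthonormal_def norm2_def power2_eq_square)
    show False
      by (rule l2_closed_span_approx[OF complete_systemD[OF complete g(1)], of 1])
        (use T g(2) in auto)
  qed
  interpret strictly_F_psi_process M \<psi> T X C
    by unfold_locales (use psi strict X \<open>T \<noteq> {}\<close> in auto)
  have gram': "(\<integral>\<omega>. X t \<omega> * X s \<omega> \<partial>M) = (\<integral>l. f t l * f s l \<partial>\<mu>)"
    if "t \<in> T" "s \<in> T" for t s
    using gram that by blast
  have ex: "\<exists>\<xi>. ms_expansion M T X (coefficient \<mu> f g) \<xi>"
    by (rule ex_ms_expansion[OF X f gram' complete basis prob_space_axioms mean])
  show ?thesis
  proof (intro conjI ex allI impI, goal_cases)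
    case (1 \<xi>)
    note exp = this
    define Y where "Y = remainder X (coefficient \<mu> f g) \<xi>"
    have \<xi>: "\<xi> k \<in> H" if "1 \<le> k" for k
      by (rule ms_expansion_in_closed_span[OF X f gram' complete basis exp that])
    have on: "orthonormal M {1..} \<xi>" and \<xi>_mean: "(\<integral>\<omega>. \<xi> k \<omega> \<partial>M) = 0" if "1 \<le> k" for k
      using exp that by (auto simp: ms_expansion_def)
    have partial: "partial_sum (coefficient \<mu> f g) \<xi> n t \<in> H" for n t
    proof -
      have "partial_sum (coefficient \<mu> f g) \<xi> n t = (\<lambda>\<omega>. \<Sum>k=1..n. coefficient \<mu> f g k t * \<xi> k \<omega>)"
        by (auto simp: partial_sum_def mult.commute)
      also have "\<dots> \<in> H"
        by (rule l2_closed_span_sum) (use X \<xi> in auto)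
      finally show ?thesis .
    qed
    have Y: "Y n t \<in> H" if "t \<in> T" for n t
      unfolding Y_def remainder_def[abs_def]
      by (intro l2_closed_span_diff[OF X] l2_closed_span_base[OF X] partial that)
    have lim: "(\<lambda>n. psi_norm M \<psi> (Y n t)) \<longlonglongrightarrow> 0" if t: "t \<in> T" for t
    proof (rule Lim_null_comparison)
      have "ms_converges M (\<lambda>n. partial_sum (coefficient \<mu> f g) \<xi> n t) (X t)"
        using exp t by (simp add: ms_expansion_def)
      then have "(\<lambda>n. norm2 M (\<lambda>\<omega>. partial_sum (coefficient \<mu> f g) \<xi> n t \<omega> - X t \<omega>)) \<longlonglongrightarrow> 0"
        using ms_converges_iff[OF l2_closed_span_square_integrable[OF partial]
          square_integrable_borel[OF X[OF t]]] by simp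
      then have "(\<lambda>n. norm2 M (Y n t)) \<longlonglongrightarrow> 0"
        unfolding Y_def remainder_def[abs_def] by (subst norm2_minus_commute)
      then show "(\<lambda>n. C * norm2 M (Y n t)) \<longlonglongrightarrow> 0"
        by (rule tendsto_mult_right_zero)
      show "\<forall>\<^sub>F n in sequentially. norm (psi_norm M \<psi> (Y n t)) \<le> C * norm2 M (Y n t)"
        using H_psi_norm[OF Y[OF t]] psi_norm_nonneg[OF H_F_psi[OF Y[OF t]] psi_pos]
        by (intro always_eventually allI) simp
    qed
    have "norm2 M (\<xi> 1) \<noteq> 0"
      using on[of 1] by (simp add: orthonormal_def norm2_def power2_eq_square)
    then have \<kappa>: "0 \<le> \<kappa> n" if "1 \<le> n" for n
      using that by (intro majorizing_characteristic_nonneg[OF majorizing \<xi>]) auto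
    show ?case
      unfolding Let_def[of "remainder X (coefficient \<mu> f g) \<xi>"] unfolding Y_def[symmetric]
    proof (intro conjI ballI allI impI, goal_cases)
      case (1 t n)
      then show ?case by (intro H_F_psi Y)
    next
      case (2 t)
      then show ?case by (rule lim)
    next
      case 3
      show ?case using \<xi> \<xi>_mean by (intro strictly_F_psi_subset_H) auto
    next
      case 4
      show ?case using \<xi> H_subset_SF_space by auto
    next
      case (5 N \<sigma>)
      interpret entropy_process M \<psi> T X C "Y N" \<kappa> \<sigma>
        by unfold_locales (use 5 compact majorizing \<kappa> Y in auto)
      have sep: "separable_process M T (Y N)" using 5 by simp
      from sup_conclusions[OF sep] show ?case
        unfolding Let_def sup_Y_def[OF sep, abs_def] sup_abs_Y_def[OF sep, abs_def] .
    qed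
  qed
qed

end
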